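(* For any finitary biframe $\mathcal L$, the bisober bisubspaces of $\mathsf{bpt}(\mathcal L)$ are exactly those whose underlying sets are patch-closed sets of $Sk(\mathsf{bpt}(\mathcal L))$.
   Context: A biframe is a triple $\mathcal L=(L^+,L^-,L)$ of frames with injective frame maps $e_L^{\pm}:L^{\pm}\to L$ such that every element of $L$ (the main component) is a join of elements $e_L^+(x^+)\wedge e_L^-(x^-)$; we identify $x^{\pm}$ with $e_L^{\pm}(x^{\pm})$. A biframe map $(f^+,f^-):\mathcal L\to\mathcal M$ is a pair of frame maps $f^{\pm}:L^{\pm}\to M^{\pm}$ for which there is a (necessarily unique) frame map $f:L\to M$ with $f\circ e_L^{\pm}=e_M^{\pm}\circ f^{\pm}$. A relation $R$ on a frame is treated as a set of inequalities: the quotient by $R$ is the universal frame quotient $q$ with $q(a)\le q(b)$ for $(a,b)\in R$; the congruence generated by $R$ is the kernel of $q$. $\mathsf{fin}(L)\subseteq L$ is the set of finite joins of elements $x^+\wedge x^-$; a congruence on $L$ is finitary if generated by some $R\subseteq\mathsf{fin}(L)\times\mathsf{fin}(L)$. With $L^+\oplus L^-$ the frame coproduct and $C_L$ the kernel of the canonical surjection $L^+\oplus L^-\to L$, $\mathcal L$ is finitary if $C_L$ is a finitary congruence on $L^+\oplus L^-$ (the main component of $(L^+,L^-,L^+\oplus L^-)$). A bispace is a set $X$ with two topologies $\Omega^+(X),\Omega^-(X)$; its patch topology is generated by $\Omega^+(X)\cup\Omega^-(X)$, and patch-closed means closed in it. A bisubspace is a subset with both subspace topologies. $Sk(X)$ (Skula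 bispace) has the same points as $X$; its positive topology is generated by the positive opens and the negative closed sets of $X$, its negative topology by the negative opens and the positive closed sets of $X$. $\mathsf{bpt}(\mathcal L)$ is the bispace of biframe maps $\mathcal L\to(2,2,2)$ with positive opens $\{f:f^+(a^+)=1\}$ ($a^+\in L^+$) and negative opens $\{f:f^-(a^-)=1\}$ ($a^-\in L^-$). $\mathsf{b}\Omega_{\mathsf{fin}}(X)=(\Omega^+(X),\Omega^-(X),\Omega_{\mathsf{fin}}(X))$, with $\Omega_{\mathsf{fin}}(X)$ the quotient of $\Omega^+(X)\oplus\Omega^-(X)$ by $\{(U^+\wedge U^-,V^+\vee V^-):U^+\cap U^-\subseteq V^+\cup V^-\}$. $X$ is bisober if $X\to\mathsf{bpt}(\mathsf{b}\Omega_{\mathsf{fin}}(X))$, $x\mapsto(N_x^+,N_x^-)$ with $N_x^{\pm}(U)=1$ iff $x\in U$, is a bihomeomorphism (a bijection that is a homeomorphism for both topologies). *)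

theory Defs
  imports "HOL-Algebra.Complete_Lattice" "HOL-Analysis.Abstract_Topology"
begin

section \<open>Frames\<close>

locale frame = complete_lattice L for L (structure) +
  assumes meet_Sup_distrib:
    "\<lbrakk>x \<in> carrier L; A \<subseteq> carrier L\<rbrakk> \<Longrightarrow> x \<sqinter> (\<Squnion>A) = \<Squnion>((\<lambda>a. x \<sqinter> a) ` A)"

definition frame_hom ::
    "('a, 'm) gorder_scheme \<Rightarrow> ('b, 'n) gorder_scheme \<Rightarrow> ('a \<Rightarrow> 'b) set" where
  "frame_hom L M = {f \<in> carrier L \<rightarrow> carrier M.
     (\<forall>A \<subseteq> carrier L. f (\<Squnion>\<^bsub>L\<^esub>A) = \<Squnion>\<^bsub>M\<^esub>(f ` A)) \<and>
     f \<top>\<^bsub>L\<^esub> = \<top>\<^bsub>M\<^esub> \<and>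
     (\<forall>x \<in> carrier L. \<forall>y \<in> carrier L. f (x \<sqinter>\<^bsub>L\<^esub> y) = f x \<sqinter>\<^bsub>M\<^esub> f y)}"

definition set_order :: "'a set set \<Rightarrow> 'a set gorder" where
  "set_order \<A> = \<lparr>carrier = \<A>, eq = (=), le = (\<subseteq>)\<rparr>"

definition two :: "bool gorder" where
  "two = \<lparr>carrier = UNIV, eq = (=), le = (\<le>)\<rparr>"


section \<open>Frame congruences and quotients\<close>

definition frame_congruence :: "('a, 'm) gorder_scheme \<Rightarrow> ('a \<times> 'a) set \<Rightarrow> bool" where
  "frame_congruence L C \<longleftrightarrow>
     equiv (carrier L) C \<and>
     (\<forall>(a, b) \<in> C. \<forall>(c, d) \<in> C. (a \<sqinter>\<^bsub>L\<^esub> c, b \<sqinter>\<^bsub>L\<^esub> d) \<in> C) \<and>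
     (\<forall>P \<subseteq> C. (\<Squnion>\<^bsub>L\<^esub>(fst ` P), \<Squnion>\<^bsub>L\<^esub>(snd ` P)) \<in> C)"

text \<open>
  A pair \<open>(a, b)\<close> of the relation \<open>R\<close> stands for the inequality \<open>a \<le> b\<close>, that is, for the
  equation \<open>a \<sqinter> b = a\<close>. By the lemmas \<open>quotient_proj_hom\<close>, \<open>quotient_proj_le\<close> and
  \<open>frame_quotient_universal\<close> below, \<open>frame_quotient L R\<close> is the universal quotient forcing these
  inequalities; by \<open>quotient_proj_kernel\<close>, \<open>congruence_generated L R\<close> is the kernel of its projection.
\<close>

definition congruence_generated ::
    "('a, 'm) gorder_scheme \<Rightarrow> ('a \<times> 'a) set \<Rightarrow> ('a \<times> 'a) set" where
  "congruence_generated L R =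
     \<Inter>{C. frame_congruence L C \<and> (\<forall>(a, b) \<in> R. (a \<sqinter>\<^bsub>L\<^esub> b, a) \<in> C)}"

definition frame_quotient ::
    "('a, 'm) gorder_scheme \<Rightarrow> ('a \<times> 'a) set \<Rightarrow> 'a set gorder" where
  "frame_quotient L R =
     \<lparr>carrier = carrier L // congruence_generated L R, eq = (=),
      le = (\<lambda>X Y. \<exists>a \<in> X. \<exists>b \<in> Y. a \<sqsubseteq>\<^bsub>L\<^esub> b)\<rparr>"

definition quotient_proj ::
    "('a, 'm) gorder_scheme \<Rightarrow> ('a \<times> 'a) set \<Rightarrow> 'a \<Rightarrow> 'a set" where
  "quotient_proj L R a = congruence_generated L R `` {a}"


section \<open>The coproduct of two frames\<close>

text \<open>
  The coproduct is realised, as usual, by the frame of those down-closed subsets of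
  \<open>L \<times> M\<close> that are closed under arbitrary (in particular empty) joins in each variable.
  The element \<open>coprod_tensor L M a b\<close> is the smallest such set containing \<open>(a, b)\<close>.
  The universal property is the lemma \<open>frame_coprod_universal\<close> below.
\<close>

definition coprod_ideal ::
    "('a, 'm) gorder_scheme \<Rightarrow> ('b, 'n) gorder_scheme \<Rightarrow> ('a \<times> 'b) set \<Rightarrow> bool" where
  "coprod_ideal L M I \<longleftrightarrow>
     I \<subseteq> carrier L \<times> carrier M \<and>
     (\<forall>(a, b) \<in> I. \<forall>a' \<in> carrier L. \<forall>b' \<in> carrier M.
        a' \<sqsubseteq>\<^bsub>L\<^esub> a \<and> b' \<sqsubseteq>\<^bsub>M\<^esub> b \<longrightarrow> (a', b') \<in> I) \<and>
     (\<forall>A \<subseteq> carrier L. \<forall>b \<in> carrier M. A \<times> {b} \<subseteq> I \<longrightarrow> (\<Squnion>\<^bsub>L\<^esub>A, b) \<in> I) \<and>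
     (\<forall>a \<in> carrier L. \<forall>B \<subseteq> carrier M. {a} \<times> B \<subseteq> I \<longrightarrow> (a, \<Squnion>\<^bsub>M\<^esub>B) \<in> I)"

definition frame_coprod ::
    "('a, 'm) gorder_scheme \<Rightarrow> ('b, 'n) gorder_scheme \<Rightarrow> ('a \<times> 'b) set gorder" where
  "frame_coprod L M = set_order {I. coprod_ideal L M I}"

definition coprod_tensor ::
    "('a, 'm) gorder_scheme \<Rightarrow> ('b, 'n) gorder_scheme \<Rightarrow> 'a \<Rightarrow> 'b \<Rightarrow> ('a \<times> 'b) set" where
  "coprod_tensor L M a b = {(x, y) \<in> carrier L \<times> carrier M.
     (x \<sqsubseteq>\<^bsub>L\<^esub> a \<and> y \<sqsubseteq>\<^bsub>M\<^esub> b) \<or> x = \<bottom>\<^bsub>L\<^esub> \<or> y = \<bottom>\<^bsub>M\<^esub>}"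

definition coprod_inl ::
    "('a, 'm) gorder_scheme \<Rightarrow> ('b, 'n) gorder_scheme \<Rightarrow> 'a \<Rightarrow> ('a \<times> 'b) set" where
  "coprod_inl L M a = coprod_tensor L M a \<top>\<^bsub>M\<^esub>"

definition coprod_inr ::
    "('a, 'm) gorder_scheme \<Rightarrow> ('b, 'n) gorder_scheme \<Rightarrow> 'b \<Rightarrow> ('a \<times> 'b) set" where
  "coprod_inr L M b = coprod_tensor L M \<top>\<^bsub>L\<^esub> b"

text \<open>The frame map out of the coproduct induced by \<open>f\<close> and \<open>g\<close> (again by \<open>frame_coprod_universal\<close>).\<close>

definition copairing ::
    "('c, 'k) gorder_scheme \<Rightarrow> ('a \<Rightarrow> 'c) \<Rightarrow> ('b \<Rightarrow> 'c) \<Rightarrow> ('a \<times> 'b) set \<Rightarrow> 'c" where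
  "copairing K f g I = \<Squnion>\<^bsub>K\<^esub>((\<lambda>(a, b). f a \<sqinter>\<^bsub>K\<^esub> g b) ` I)"


section \<open>Biframes\<close>

record ('p, 'n, 'a) biframe =
  bf_pos :: "'p gorder"
  bf_neg :: "'n gorder"
  bf_main :: "'a gorder"
  bf_epos :: "'p \<Rightarrow> 'a"
  bf_eneg :: "'n \<Rightarrow> 'a"

definition bf_rectangles :: "('p, 'n, 'a) biframe \<Rightarrow> 'a set" where
  "bf_rectangles \<L> = {bf_epos \<L> x \<sqinter>\<^bsub>bf_main \<L>\<^esub> bf_eneg \<L> y | x y.
     x \<in> carrier (bf_pos \<L>) \<and> y \<in> carrier (bf_neg \<L>)}"

definition is_biframe :: "('p, 'n, 'a) biframe \<Rightarrow> bool" where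
  "is_biframe \<L> \<longleftrightarrow>
     frame (bf_pos \<L>) \<and> frame (bf_neg \<L>) \<and> frame (bf_main \<L>) \<and>
     bf_epos \<L> \<in> frame_hom (bf_pos \<L>) (bf_main \<L>) \<and> inj_on (bf_epos \<L>) (carrier (bf_pos \<L>)) \<and>
     bf_eneg \<L> \<in> frame_hom (bf_neg \<L>) (bf_main \<L>) \<and> inj_on (bf_eneg \<L>) (carrier (bf_neg \<L>)) \<and>
     (\<forall>x \<in> carrier (bf_main \<L>). \<exists>A \<subseteq> bf_rectangles \<L>. x = \<Squnion>\<^bsub>bf_main \<L>\<^esub>A)"

text \<open>
  The components of a biframe map are required to be \<open>extensional\<close>, so that two biframe maps
  are equal as soon as they agree on the carriers.
\<close>

definition biframe_maps ::
    "('p, 'n, 'a) biframe \<Rightarrow> ('q, 'm, 'b) biframe \<Rightarrow> (('p \<Rightarrow> 'q) \<times> ('n \<Rightarrow> 'm)) set" where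
  "biframe_maps \<L> \<M> = {(f, g).
     f \<in> frame_hom (bf_pos \<L>) (bf_pos \<M>) \<inter> extensional (carrier (bf_pos \<L>)) \<and>
     g \<in> frame_hom (bf_neg \<L>) (bf_neg \<M>) \<inter> extensional (carrier (bf_neg \<L>)) \<and>
     (\<exists>h \<in> frame_hom (bf_main \<L>) (bf_main \<M>).
        (\<forall>x \<in> carrier (bf_pos \<L>). h (bf_epos \<L> x) = bf_epos \<M> (f x)) \<and>
        (\<forall>y \<in> carrier (bf_neg \<L>). h (bf_eneg \<L> y) = bf_eneg \<M> (g y)))}"

definition two_biframe :: "(bool, bool, bool) biframe" where
  "two_biframe =
     \<lparr>bf_pos = two, bf_neg = two, bf_main = two, bf_epos = id, bf_eneg = id\<rparr>"

definition bf_fin :: "('p, 'n, 'a) biframe \<Rightarrow> 'a set" where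
  "bf_fin \<L> = {\<Squnion>\<^bsub>bf_main \<L>\<^esub>F | F. finite F \<and> F \<subseteq> bf_rectangles \<L>}"

definition finitary_congruence :: "('p, 'n, 'a) biframe \<Rightarrow> ('a \<times> 'a) set \<Rightarrow> bool" where
  "finitary_congruence \<L> C \<longleftrightarrow>
     (\<exists>R \<subseteq> bf_fin \<L> \<times> bf_fin \<L>. C = congruence_generated (bf_main \<L>) R)"

definition coprod_biframe ::
    "('p, 'n, 'a) biframe \<Rightarrow> ('p, 'n, ('p \<times> 'n) set) biframe" where
  "coprod_biframe \<L> =
     \<lparr>bf_pos = bf_pos \<L>, bf_neg = bf_neg \<L>, bf_main = frame_coprod (bf_pos \<L>) (bf_neg \<L>),
      bf_epos = coprod_inl (bf_pos \<L>) (bf_neg \<L>), bf_eneg = coprod_inr (bf_pos \<L>) (bf_neg \<L>)\<rparr>"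

definition canonical_surjection :: "('p, 'n, 'a) biframe \<Rightarrow> ('p \<times> 'n) set \<Rightarrow> 'a" where
  "canonical_surjection \<L> = copairing (bf_main \<L>) (bf_epos \<L>) (bf_eneg \<L>)"

definition canonical_kernel ::
    "('p, 'n, 'a) biframe \<Rightarrow> (('p \<times> 'n) set \<times> ('p \<times> 'n) set) set" where
  "canonical_kernel \<L> = {(I, J).
     I \<in> carrier (frame_coprod (bf_pos \<L>) (bf_neg \<L>)) \<and>
     J \<in> carrier (frame_coprod (bf_pos \<L>) (bf_neg \<L>)) \<and>
     canonical_surjection \<L> I = canonical_surjection \<L> J}"

definition finitary_biframe :: "('p, 'n, 'a) biframe \<Rightarrow> bool" where
  "finitary_biframe \<L> \<longleftrightarrow>
     is_biframe \<L> \<and> finitary_congruence (coprod_biframe \<L>) (canonical_kernel \<L>)"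


section \<open>Bispaces\<close>

record 'x bispace =
  bs_pos :: "'x topology"
  bs_neg :: "'x topology"

definition is_bispace :: "'x bispace \<Rightarrow> bool" where
  "is_bispace X \<longleftrightarrow> topspace (bs_pos X) = topspace (bs_neg X)"

definition bs_points :: "'x bispace \<Rightarrow> 'x set" where
  "bs_points X = topspace (bs_pos X)"

definition patch :: "'x bispace \<Rightarrow> 'x topology" where
  "patch X = topology_generated_by ({U. openin (bs_pos X) U} \<union> {U. openin (bs_neg X) U})"

definition bisubspace :: "'x bispace \<Rightarrow> 'x set \<Rightarrow> 'x bispace" where
  "bisubspace X S =
     \<lparr>bs_pos = subtopology (bs_pos X) S, bs_neg = subtopology (bs_neg X) S\<rparr>"

definition Sk :: "'x bispace \<Rightarrow> 'x bispace" where
  "Sk X =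
     \<lparr>bs_pos = topology_generated_by ({U. openin (bs_pos X) U} \<union> {F. closedin (bs_neg X) F}),
      bs_neg = topology_generated_by ({U. openin (bs_neg X) U} \<union> {F. closedin (bs_pos X) F})\<rparr>"

definition bihomeomorphic_map :: "'x bispace \<Rightarrow> 'y bispace \<Rightarrow> ('x \<Rightarrow> 'y) \<Rightarrow> bool" where
  "bihomeomorphic_map X Y h \<longleftrightarrow>
     homeomorphic_map (bs_pos X) (bs_pos Y) h \<and> homeomorphic_map (bs_neg X) (bs_neg Y) h"


section \<open>The bispace of points and bisobriety\<close>

definition bpoints ::
    "('p, 'n, 'a) biframe \<Rightarrow> (('p \<Rightarrow> bool) \<times> ('n \<Rightarrow> bool)) set" where
  "bpoints \<L> = biframe_maps \<L> two_biframe"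

text \<open>
  The argument of \<open>topology\<close> has to satisfy \<open>istopology\<close> for this to be meaningful; for a biframe
  \<open>\<L>\<close> it does, see the lemmas \<open>openin_bpt_pos\<close> and \<open>openin_bpt_neg\<close>.
\<close>

definition bpt ::
    "('p, 'n, 'a) biframe \<Rightarrow> (('p \<Rightarrow> bool) \<times> ('n \<Rightarrow> bool)) bispace" where
  "bpt \<L> =
     \<lparr>bs_pos = topology (\<lambda>U. \<exists>a \<in> carrier (bf_pos \<L>). U = {f \<in> bpoints \<L>. fst f a}),
      bs_neg = topology (\<lambda>U. \<exists>a \<in> carrier (bf_neg \<L>). U = {f \<in> bpoints \<L>. snd f a})\<rparr>"

definition opens_frame :: "'x topology \<Rightarrow> 'x set gorder" where
  "opens_frame T = set_order {U. openin T U}"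

definition fin_relation :: "'x bispace \<Rightarrow> (('x set \<times> 'x set) set \<times> ('x set \<times> 'x set) set) set" where
  "fin_relation X =
     (let P = opens_frame (bs_pos X); N = opens_frame (bs_neg X); K = frame_coprod P N
      in {(coprod_inl P N U \<sqinter>\<^bsub>K\<^esub> coprod_inr P N U', coprod_inl P N V \<squnion>\<^bsub>K\<^esub> coprod_inr P N V')
            | U U' V V'.
            U \<in> carrier P \<and> V \<in> carrier P \<and> U' \<in> carrier N \<and> V' \<in> carrier N \<and>
            U \<inter> U' \<subseteq> V \<union> V'})"

definition bOmega_fin ::
    "'x bispace \<Rightarrow> ('x set, 'x set, ('x set \<times> 'x set) set set) biframe" where
  "bOmega_fin X =
     (let P = opens_frame (bs_pos X); N = opens_frame (bs_neg X);
          K = frame_coprod P N; R = fin_relation X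
      in \<lparr>bf_pos = P, bf_neg = N, bf_main = frame_quotient K R,
          bf_epos = (\<lambda>U. quotient_proj K R (coprod_inl P N U)),
          bf_eneg = (\<lambda>U. quotient_proj K R (coprod_inr P N U))\<rparr>)"

definition nbhd_point :: "'x bispace \<Rightarrow> 'x \<Rightarrow> ('x set \<Rightarrow> bool) \<times> ('x set \<Rightarrow> bool)" where
  "nbhd_point X x =
     (restrict (\<lambda>U. x \<in> U) {U. openin (bs_pos X) U},
      restrict (\<lambda>U. x \<in> U) {U. openin (bs_neg X) U})"

definition bisober :: "'x bispace \<Rightarrow> bool" where
  "bisober X \<longleftrightarrow> is_bispace X \<and> bihomeomorphic_map X (bpt (bOmega_fin X)) (nbhd_point X)"


section \<open>The constructions have the expected properties\<close>

subsection \<open>Frames\<close>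

lemma Sup_eqI:
  assumes "partial_order L" "A \<subseteq> carrier L" "s \<in> carrier L"
    "\<And>x. x \<in> A \<Longrightarrow> x \<sqsubseteq>\<^bsub>L\<^esub> s"
    "\<And>y. \<lbrakk>y \<in> carrier L; \<And>x. x \<in> A \<Longrightarrow> x \<sqsubseteq>\<^bsub>L\<^esub> y\<rbrakk> \<Longrightarrow> s \<sqsubseteq>\<^bsub>L\<^esub> y"
  shows "least L s (Upper L A)" "\<Squnion>\<^bsub>L\<^esub>A = s"
proof -
  interpret partial_order L by fact
  show l: "least L s (Upper L A)"
  proof (rule least_UpperI)
    show "s \<sqsubseteq>\<^bsub>L\<^esub> y" if "y \<in> Upper L A" for y
    proof (rule assms(5))
      show "y \<in> carrier L" using that Upper_closed[of L A] by (rule subsetD[rotated])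
      show "x \<sqsubseteq>\<^bsub>L\<^esub> y" if "x \<in> A" for x
        using Upper_memD[OF \<open>y \<in> Upper L A\<close> that assms(2)] by (rule conjunct1)
    qed
  qed (rule assms(4), assumption, rule assms(2), rule assms(3))
  show "\<Squnion>\<^bsub>L\<^esub>A = s"
    unfolding Lattice.sup_def by (rule some_equality, rule l) (rule least_unique[OF _ l])
qed

lemma meet_eqI:
  assumes "partial_order L" "x \<in> carrier L" "y \<in> carrier L" "m \<in> carrier L"
    "m \<sqsubseteq>\<^bsub>L\<^esub> x" "m \<sqsubseteq>\<^bsub>L\<^esub> y"
    "\<And>z. \<lbrakk>z \<in> carrier L; z \<sqsubseteq>\<^bsub>L\<^esub> x; z \<sqsubseteq>\<^bsub>L\<^esub> y\<rbrakk> \<Longrightarrow> z \<sqsubseteq>\<^bsub>L\<^esub> m"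
  shows "x \<sqinter>\<^bsub>L\<^esub> y = m"
proof -
  interpret partial_order L by fact
  have l: "greatest L m (Lower L {x, y})"
  proof (rule greatest_LowerI)
    show "m \<sqsubseteq>\<^bsub>L\<^esub> z" if "z \<in> {x, y}" for z using that assms(5,6) by fastforce
    show "z \<sqsubseteq>\<^bsub>L\<^esub> m" if "z \<in> Lower L {x, y}" for z
    proof (rule assms(7))
      show "z \<in> carrier L" using that Lower_closed[of L "{x, y}"] by (rule subsetD[rotated])
      show "z \<sqsubseteq>\<^bsub>L\<^esub> x" "z \<sqsubseteq>\<^bsub>L\<^esub> y"
        using Lower_memD[OF that, of x] Lower_memD[OF that, of y] assms(2,3) by simp_all
    qed
    show "{x, y} \<subseteq> carrier L" using assms(2,3) by simp
  qed (rule assms(4))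
  show ?thesis
    unfolding meet_def Lattice.inf_def by (rule some_equality, rule l) (rule greatest_unique[OF _ l])
qed

lemma top_eqI:
  assumes "partial_order L" "t \<in> carrier L" "\<And>x. x \<in> carrier L \<Longrightarrow> x \<sqsubseteq>\<^bsub>L\<^esub> t"
  shows "\<top>\<^bsub>L\<^esub> = t"
proof -
  interpret partial_order L by fact
  have l: "greatest L t (carrier L)"
    using assms(2-3) unfolding greatest_def by auto
  show ?thesis
    unfolding Order.top_def by (rule some_equality, rule l) (rule greatest_unique[OF _ l])
qed

lemma frame_criterion:
  assumes po: "partial_order L"
    and sup: "\<And>A. A \<subseteq> carrier L \<Longrightarrow> \<exists>s. least L s (Upper L A)"
    and dist: "\<And>x A. \<lbrakk>x \<in> carrier L; A \<subseteq> carrier L\<rbrakk> \<Longrightarrow>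
        x \<sqinter>\<^bsub>L\<^esub> (\<Squnion>\<^bsub>L\<^esub>A) = \<Squnion>\<^bsub>L\<^esub>((\<lambda>a. x \<sqinter>\<^bsub>L\<^esub> a) ` A)"
  shows "frame L"
proof -
  interpret partial_order L by fact
  have inf: "\<exists>i. greatest L i (Lower L A)" if "A \<subseteq> carrier L" for A
  proof -
    obtain s where s: "least L s (Upper L (Lower L A))" using sup[of "Lower L A"] by auto
    have "greatest L s (Lower L A)"
      unfolding greatest_def
    proof (intro conjI ballI)
      have sc: "s \<in> carrier L" using s by auto
      show "s \<in> Lower L A"
      proof (rule Lower_memI)
        fix x assume x: "x \<in> A"
        then have "x \<in> Upper L (Lower L A)" using that unfolding Upper_def Lower_def by auto
        then show "s \<sqsubseteq>\<^bsub>L\<^esub> x" using s unfolding least_def by blast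
      qed (rule sc)
      show "x \<sqsubseteq>\<^bsub>L\<^esub> s" if "x \<in> Lower L A" for x
        using s that unfolding least_def Upper_def Lower_def by blast
    qed auto
    then show ?thesis ..
  qed
  show ?thesis
    by unfold_locales (use sup inf dist in auto)
qed

context frame
begin

lemma po: "partial_order L" ..

lemma Sup_closed: "A \<subseteq> carrier L \<Longrightarrow> \<Squnion>A \<in> carrier L" by simp

lemma meet_Sup_le:
  assumes "A \<subseteq> carrier L" "x \<in> carrier L" "z \<in> carrier L"
    "\<And>a. a \<in> A \<Longrightarrow> x \<sqinter> a \<sqsubseteq> z"
  shows "x \<sqinter> \<Squnion>A \<sqsubseteq> z"
  unfolding meet_Sup_distrib[OF assms(2,1)]
  by (rule sup_least) (use assms in \<open>auto intro!: meet_closed\<close>)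

lemma Sup_empty: "\<Squnion>{} = \<bottom>"
  using weak_sup_empty eq_is_equal by simp

lemma meet_commute: "x \<sqinter> y = y \<sqinter> x" by (rule meet_comm)

lemma meet_absorb: "\<lbrakk>x \<sqsubseteq> y; x \<in> carrier L; y \<in> carrier L\<rbrakk> \<Longrightarrow> x \<sqinter> y = x"
  using le_iff_join by simp

lemma le_meet_iff: "\<lbrakk>x \<in> carrier L; y \<in> carrier L\<rbrakk> \<Longrightarrow> x \<sqsubseteq> y \<longleftrightarrow> x \<sqinter> y = x"
  using le_iff_join[of x y] by auto

lemma top_meet_eq: "x \<in> carrier L \<Longrightarrow> x \<sqinter> \<top> = x" 
  by (rule meet_absorb) auto

lemma bot_unique: "\<lbrakk>x \<sqsubseteq> \<bottom>; x \<in> carrier L\<rbrakk> \<Longrightarrow> x = \<bottom>"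
  by (auto intro: le_antisym)

lemma le_meet_both:
  assumes "x \<in> carrier L" "a \<in> carrier L" "b \<in> carrier L"
  shows "x \<sqsubseteq> a \<sqinter> b \<longleftrightarrow> x \<sqsubseteq> a \<and> x \<sqsubseteq> b"
proof
  have m: "a \<sqinter> b \<in> carrier L" using assms(2,3) by (rule meet_closed)
  assume x: "x \<sqsubseteq> a \<sqinter> b"
  show "x \<sqsubseteq> a \<and> x \<sqsubseteq> b"
    using le_trans[OF x meet_left[OF assms(2,3)] assms(1) m assms(2)]
      le_trans[OF x meet_right[OF assms(2,3)] assms(1) m assms(3)] by simp
next
  assume "x \<sqsubseteq> a \<and> x \<sqsubseteq> b"
  then show "x \<sqsubseteq> a \<sqinter> b" using meet_le[OF _ _ assms(2,3,1)] by simp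
qed

lemma meet_mono: "\<lbrakk>a \<sqsubseteq> a'; b \<sqsubseteq> b'; a \<in> carrier L; a' \<in> carrier L; b \<in> carrier L; b' \<in> carrier L\<rbrakk>
    \<Longrightarrow> a \<sqinter> b \<sqsubseteq> a' \<sqinter> b'"
  by (meson le_trans meet_closed meet_le meet_left meet_right)

end

lemma frame_homD:
  assumes "f \<in> frame_hom L M"
  shows "\<And>x. x \<in> carrier L \<Longrightarrow> f x \<in> carrier M"
    "\<And>A. A \<subseteq> carrier L \<Longrightarrow> f (\<Squnion>\<^bsub>L\<^esub>A) = \<Squnion>\<^bsub>M\<^esub>(f ` A)"
    "f \<top>\<^bsub>L\<^esub> = \<top>\<^bsub>M\<^esub>"
    "\<And>x y. \<lbrakk>x \<in> carrier L; y \<in> carrier L\<rbrakk> \<Longrightarrow> f (x \<sqinter>\<^bsub>L\<^esub> y) = f x \<sqinter>\<^bsub>M\<^esub> f y"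
  using assms unfolding frame_hom_def by auto

lemma frame_hom_mono:
  assumes "frame L" "frame M" "f \<in> frame_hom L M" "x \<in> carrier L" "y \<in> carrier L" "x \<sqsubseteq>\<^bsub>L\<^esub> y"
  shows "f x \<sqsubseteq>\<^bsub>M\<^esub> f y"
proof -
  interpret L: frame L by fact
  interpret M: frame M by fact
  have "f x = f x \<sqinter>\<^bsub>M\<^esub> f y"
    using frame_homD(4)[OF assms(3-5)] L.meet_absorb[OF assms(6,4,5)] by simp
  then show ?thesis using frame_homD(1)[OF assms(3)] assms(4,5) M.le_meet_iff by metis
qed

lemma frame_hom_bot:
  assumes "frame L" "frame M" "f \<in> frame_hom L M"
  shows "f \<bottom>\<^bsub>L\<^esub> = \<bottom>\<^bsub>M\<^esub>"
  using frame_homD(2)[OF assms(3), of "{}"] frame.Sup_empty[OF assms(1)] frame.Sup_empty[OF assms(2)]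
  by simp

lemma frame_hom_comp:
  assumes "f \<in> frame_hom L M" "g \<in> frame_hom M K"
  shows "(\<lambda>x. g (f x)) \<in> frame_hom L K"
proof -
  have "g (f (\<Squnion>\<^bsub>L\<^esub>A)) = \<Squnion>\<^bsub>K\<^esub>((\<lambda>x. g (f x)) ` A)" if "A \<subseteq> carrier L" for A
  proof -
    have "f ` A \<subseteq> carrier M" using frame_homD(1)[OF assms(1)] that by auto
    from frame_homD(2)[OF assms(2) this] show ?thesis
      using frame_homD(2)[OF assms(1) that] by (simp add: image_image)
  qed
  then show ?thesis
    using frame_homD[OF assms(1)] frame_homD[OF assms(2)] unfolding frame_hom_def by auto
qed

lemma set_order_simps [simp]:
  "carrier (set_order \<A>) = \<A>" "U \<sqsubseteq>\<^bsub>set_order \<A>\<^esub> V \<longleftrightarrow> U \<subseteq> V"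
  by (auto simp: set_order_def)

lemma set_order_po: "partial_order (set_order \<A>)"
  by unfold_locales (auto simp: set_order_def)

lemma two_po: "partial_order two"
  by unfold_locales (auto simp: two_def)

lemma two_simps [simp]:
  "carrier two = UNIV" "a \<sqsubseteq>\<^bsub>two\<^esub> b \<longleftrightarrow> (a \<longrightarrow> b)"
  "\<Squnion>\<^bsub>two\<^esub>A \<longleftrightarrow> True \<in> A" "a \<sqinter>\<^bsub>two\<^esub> b \<longleftrightarrow> a \<and> b" "\<top>\<^bsub>two\<^esub> = True"
proof -
  show 1: "carrier two = UNIV" "a \<sqsubseteq>\<^bsub>two\<^esub> b \<longleftrightarrow> (a \<longrightarrow> b)" for a b by (auto simp: two_def)
  have "\<Squnion>\<^bsub>two\<^esub>A = (True \<in> A)"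
    by (rule Sup_eqI[OF two_po]) (auto simp: 1)
  then show "\<Squnion>\<^bsub>two\<^esub>A \<longleftrightarrow> True \<in> A" by simp
  have "a \<sqinter>\<^bsub>two\<^esub> b = (a \<and> b)"
    by (rule meet_eqI[OF two_po]) (auto simp: 1)
  then show "a \<sqinter>\<^bsub>two\<^esub> b \<longleftrightarrow> a \<and> b" by simp
  show "\<top>\<^bsub>two\<^esub> = True"
    by (rule top_eqI[OF two_po]) (auto simp: 1)
qed

lemma two_frame: "frame two"
proof (rule frame_criterion[OF two_po])
  fix A :: "bool set"
  have "least two (True \<in> A) (Upper two A)"
    by (rule Sup_eqI[OF two_po]) auto
  then show "\<exists>s. least two s (Upper two A)" ..
qed auto

lemma two_biframe_is_biframe: "is_biframe two_biframe"
proof -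
  have [simp]: "id \<in> frame_hom two two" by (auto simp: frame_hom_def)
  have r: "bf_rectangles two_biframe = UNIV"
    unfolding bf_rectangles_def two_biframe_def by auto
  show ?thesis unfolding is_biframe_def r
    by (auto simp: two_biframe_def two_frame intro!: exI[of _ "{x}" for x])
qed

lemma opens_Sup:
  assumes "\<And>U. U \<in> A \<Longrightarrow> openin T U"
  shows "least (opens_frame T) (\<Union>A) (Upper (opens_frame T) A)" "\<Squnion>\<^bsub>opens_frame T\<^esub>A = \<Union>A"
  using Sup_eqI[of "opens_frame T" A "\<Union>A"] assms unfolding opens_frame_def
  by (auto simp: set_order_po)

lemma opens_meet:
  "\<lbrakk>openin T U; openin T V\<rbrakk> \<Longrightarrow> U \<sqinter>\<^bsub>opens_frame T\<^esub> V = U \<inter> V"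
  unfolding opens_frame_def by (rule meet_eqI[OF set_order_po]) auto

lemma opens_top: "\<top>\<^bsub>opens_frame T\<^esub> = topspace T"
  unfolding opens_frame_def by (rule top_eqI[OF set_order_po]) (auto dest: openin_subset)

lemma carrier_opens [simp]: "carrier (opens_frame T) = {U. openin T U}"
  by (simp add: opens_frame_def)

lemma opens_frame: "frame (opens_frame T)"
proof (rule frame_criterion)
  show "partial_order (opens_frame T)" unfolding opens_frame_def by (rule set_order_po)
  show "\<exists>s. least (opens_frame T) s (Upper (opens_frame T) A)" if "A \<subseteq> carrier (opens_frame T)" for A
    using opens_Sup(1)[of A T] that by auto
  show "U \<sqinter>\<^bsub>opens_frame T\<^esub> (\<Squnion>\<^bsub>opens_frame T\<^esub>A) =
      \<Squnion>\<^bsub>opens_frame T\<^esub>((\<lambda>a. U \<sqinter>\<^bsub>opens_frame T\<^esub> a) ` A)"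
    if "U \<in> carrier (opens_frame T)" "A \<subseteq> carrier (opens_frame T)" for U A
  proof -
    have A: "openin T V" if "V \<in> A" for V using that \<open>A \<subseteq> _\<close> by auto
    have U: "openin T U" using that by auto
    have "(\<lambda>V. U \<sqinter>\<^bsub>opens_frame T\<^esub> V) ` A = (\<lambda>V. U \<inter> V) ` A"
      by (rule image_cong) (auto simp: opens_meet U A)
    moreover have "\<Squnion>\<^bsub>opens_frame T\<^esub>((\<lambda>V. U \<inter> V) ` A) = \<Union>((\<lambda>V. U \<inter> V) ` A)"
      by (rule opens_Sup(2)) (use A U in auto)
    ultimately show ?thesis
      by (simp add: opens_Sup(2)[of A T] A opens_meet U openin_Union) 
  qed
qed

subsection \<open>Quotients\<close>

lemma frame_congruenceD:
  assumes "frame_congruence L C"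
  shows "equiv (carrier L) C"
    "\<And>a b c d. \<lbrakk>(a, b) \<in> C; (c, d) \<in> C\<rbrakk> \<Longrightarrow> (a \<sqinter>\<^bsub>L\<^esub> c, b \<sqinter>\<^bsub>L\<^esub> d) \<in> C"
    "\<And>P. P \<subseteq> C \<Longrightarrow> (\<Squnion>\<^bsub>L\<^esub>(fst ` P), \<Squnion>\<^bsub>L\<^esub>(snd ` P)) \<in> C"
  using assms unfolding frame_congruence_def by auto

lemma frame_congruenceI:
  assumes "equiv (carrier L) C"
    "\<And>a b c d. \<lbrakk>(a, b) \<in> C; (c, d) \<in> C\<rbrakk> \<Longrightarrow> (a \<sqinter>\<^bsub>L\<^esub> c, b \<sqinter>\<^bsub>L\<^esub> d) \<in> C"
    "\<And>P. P \<subseteq> C \<Longrightarrow> (\<Squnion>\<^bsub>L\<^esub>(fst ` P), \<Squnion>\<^bsub>L\<^esub>(snd ` P)) \<in> C"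
  shows "frame_congruence L C"
  using assms unfolding frame_congruence_def by auto

lemma kernel_frame_congruence:
  assumes "frame L" "frame M" "f \<in> frame_hom L M"
  shows "frame_congruence L {(a, b). a \<in> carrier L \<and> b \<in> carrier L \<and> f a = f b}" (is "frame_congruence L ?C")
proof -
  interpret L: frame L by fact
  note f = frame_homD[OF assms(3)]
  have "(\<Squnion>\<^bsub>L\<^esub>(fst ` P), \<Squnion>\<^bsub>L\<^esub>(snd ` P)) \<in> ?C" if P: "P \<subseteq> ?C" for P
  proof -
    have s: "fst ` P \<subseteq> carrier L" "snd ` P \<subseteq> carrier L" using P by auto
    have "f ` fst ` P = f ` snd ` P" unfolding image_image by (rule image_cong) (use P in auto)
    then show ?thesis using s by (auto simp: f(2))
  qed
  moreover have "equiv (carrier L) ?C"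
    by (rule equivI) (auto simp: refl_on_def sym_def trans_def)
  moreover have "\<forall>(a, b) \<in> ?C. \<forall>(c, d) \<in> ?C. (a \<sqinter>\<^bsub>L\<^esub> c, b \<sqinter>\<^bsub>L\<^esub> d) \<in> ?C"
    by (auto simp: f(4))
  ultimately show ?thesis unfolding frame_congruence_def by blast
qed

lemma congruence_generated_is_congruence:
  assumes "frame L" "R \<subseteq> carrier L \<times> carrier L"
  shows "frame_congruence L (congruence_generated L R)"
    "\<And>a b. (a, b) \<in> R \<Longrightarrow> (a \<sqinter>\<^bsub>L\<^esub> b, a) \<in> congruence_generated L R"
    "\<And>C. \<lbrakk>frame_congruence L C; \<And>a b. (a, b) \<in> R \<Longrightarrow> (a \<sqinter>\<^bsub>L\<^esub> b, a) \<in> C\<rbrakk> \<Longrightarrow>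
       congruence_generated L R \<subseteq> C"
proof -
  interpret L: frame L by fact
  let ?K = "{C. frame_congruence L C \<and> (\<forall>(a, b) \<in> R. (a \<sqinter>\<^bsub>L\<^esub> b, a) \<in> C)}"
  have all: "carrier L \<times> carrier L \<in> ?K"
  proof -
    have "equiv (carrier L) (carrier L \<times> carrier L)"
      by (rule equivI) (auto simp: refl_on_def sym_def trans_def)
    moreover have "(\<Squnion>\<^bsub>L\<^esub>(fst ` P), \<Squnion>\<^bsub>L\<^esub>(snd ` P)) \<in> carrier L \<times> carrier L"
      if "P \<subseteq> carrier L \<times> carrier L" for P
      using that by (auto intro!: L.Sup_closed)
    ultimately show ?thesis using assms(2) unfolding frame_congruence_def by auto
  qed
  have "equiv (carrier L) (\<Inter>?K)"
  proof (rule equivI)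
    show "\<Inter>?K \<subseteq> carrier L \<times> carrier L" using all by blast
    show "refl_on (carrier L) (\<Inter>?K)"
      unfolding refl_on_def
    proof (intro ballI InterI)
      fix a D assume h: "a \<in> carrier L" "D \<in> ?K"
      then show "(a, a) \<in> D" using frame_congruenceD(1)[of L D] by (simp add: equiv_def refl_on_def)
    qed
    show "sym (\<Inter>?K)"
    proof (intro symI InterI)
      fix a b D assume h: "(a, b) \<in> \<Inter>?K" "D \<in> ?K"
      have "(a, b) \<in> D" by (rule InterD[OF h(1,2)])
      moreover have "sym D" using h(2) frame_congruenceD(1)[of L D] by (simp add: equiv_def)
      ultimately show "(b, a) \<in> D" by (meson symD)
    qed
    show "trans (\<Inter>?K)"
    proof (intro transI InterI)
      fix a b c D assume h: "(a, b) \<in> \<Inter>?K" "(b, c) \<in> \<Inter>?K" "D \<in> ?K"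
      have "(a, b) \<in> D" "(b, c) \<in> D" by (rule InterD[OF h(1) h(3)], rule InterD[OF h(2) h(3)])
      moreover have "trans D" using h(3) frame_congruenceD(1)[of L D] by (simp add: equiv_def)
      ultimately show "(a, c) \<in> D" by (meson transD)
    qed
  qed
  moreover have "(a \<sqinter>\<^bsub>L\<^esub> c, b \<sqinter>\<^bsub>L\<^esub> d) \<in> \<Inter>?K"
    if "(a, b) \<in> \<Inter>?K" "(c, d) \<in> \<Inter>?K" for a b c d
  proof (rule InterI)
    fix D assume D: "D \<in> ?K"
    have "(a, b) \<in> D" "(c, d) \<in> D" by (rule InterD[OF that(1) D], rule InterD[OF that(2) D])
    then show "(a \<sqinter>\<^bsub>L\<^esub> c, b \<sqinter>\<^bsub>L\<^esub> d) \<in> D" using D frame_congruenceD(2)[of L D] by simp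
  qed
  moreover have "(\<Squnion>\<^bsub>L\<^esub>(fst ` P), \<Squnion>\<^bsub>L\<^esub>(snd ` P)) \<in> \<Inter>?K" if "P \<subseteq> \<Inter>?K" for P
  proof (rule InterI)
    fix D assume D: "D \<in> ?K"
    have "P \<subseteq> D" by (rule order_trans[OF that Inter_lower[OF D]])
    then show "(\<Squnion>\<^bsub>L\<^esub>(fst ` P), \<Squnion>\<^bsub>L\<^esub>(snd ` P)) \<in> D" using D frame_congruenceD(3)[of L D] by simp
  qed
  ultimately show "frame_congruence L (congruence_generated L R)"
    unfolding congruence_generated_def by (rule frame_congruenceI)
  show "(a \<sqinter>\<^bsub>L\<^esub> b, a) \<in> congruence_generated L R" if "(a, b) \<in> R" for a b
    using that unfolding congruence_generated_def by auto
  show "congruence_generated L R \<subseteq> C"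
    if "frame_congruence L C" "\<And>a b. (a, b) \<in> R \<Longrightarrow> (a \<sqinter>\<^bsub>L\<^esub> b, a) \<in> C" for C
    using that unfolding congruence_generated_def by blast
qed

locale frame_presentation = frame +
  fixes R
  assumes R: "R \<subseteq> carrier L \<times> carrier L"
begin

abbreviation "C \<equiv> congruence_generated L R"
abbreviation "Q \<equiv> frame_quotient L R"
abbreviation "q \<equiv> quotient_proj L R"

lemma fc: "frame_congruence L C"
  by (rule congruence_generated_is_congruence) (use R frame_axioms in auto)

lemmas eqv = frame_congruenceD(1)[OF fc]

lemma Q_carrier: "carrier Q = q ` carrier L"
  unfolding frame_quotient_def quotient_proj_def quotient_def by auto

lemma C_carrier: "(a, b) \<in> C \<Longrightarrow> a \<in> carrier L \<and> b \<in> carrier L"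
  using eqv unfolding equiv_def by auto

lemma C_refl: "a \<in> carrier L \<Longrightarrow> (a, a) \<in> C"
  using eqv unfolding equiv_def refl_on_def by auto

lemma C_sym: "(a, b) \<in> C \<Longrightarrow> (b, a) \<in> C"
  using eqv unfolding equiv_def sym_def by auto

lemma C_trans: "(a, b) \<in> C \<Longrightarrow> (b, c) \<in> C \<Longrightarrow> (a, c) \<in> C"
  using eqv unfolding equiv_def trans_def by blast

lemma q_eq: "\<lbrakk>a \<in> carrier L; b \<in> carrier L\<rbrakk> \<Longrightarrow> q a = q b \<longleftrightarrow> (a, b) \<in> C"
  unfolding quotient_proj_def using eq_equiv_class_iff[OF eqv] by simp

lemma q_le:
  assumes "a \<in> carrier L" "b \<in> carrier L"
  shows "q a \<sqsubseteq>\<^bsub>Q\<^esub> q b \<longleftrightarrow> (a \<sqinter> b, a) \<in> C"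
proof
  assume "q a \<sqsubseteq>\<^bsub>Q\<^esub> q b"
  then obtain a' b' where h: "(a, a') \<in> C" "(b, b') \<in> C" "a' \<sqsubseteq> b'"
    unfolding frame_quotient_def quotient_proj_def by auto
  then have "(a \<sqinter> b, a' \<sqinter> b') \<in> C" by (intro frame_congruenceD(2)[OF fc])
  moreover have "a' \<sqinter> b' = a'" using meet_absorb h C_carrier by blast
  ultimately show "(a \<sqinter> b, a) \<in> C" using h C_trans C_sym by metis
next
  assume "(a \<sqinter> b, a) \<in> C"
  then show "q a \<sqsubseteq>\<^bsub>Q\<^esub> q b"
    using C_sym C_refl[OF assms(2)] meet_right[OF assms]
    unfolding frame_quotient_def quotient_proj_def by auto
qed

lemma Q_po: "partial_order Q"
proof -
  have e: "eq Q = (=)" by (simp add: frame_quotient_def)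
  have anti: "X = Y" if XY: "X \<in> carrier Q" "Y \<in> carrier Q" "X \<sqsubseteq>\<^bsub>Q\<^esub> Y" "Y \<sqsubseteq>\<^bsub>Q\<^esub> X" for X Y
  proof -
    obtain a b where ab: "a \<in> carrier L" "b \<in> carrier L" "X = q a" "Y = q b"
      using XY(1,2) unfolding Q_carrier by blast
    then have "(a \<sqinter> b, a) \<in> C" "(b \<sqinter> a, b) \<in> C" using XY q_le by auto
    then have "(a, b) \<in> C" using C_sym C_trans meet_commute[of a b] by metis
    then show ?thesis using ab q_eq by simp
  qed
  have tr: "X \<sqsubseteq>\<^bsub>Q\<^esub> Z" if XY: "X \<in> carrier Q" "Y \<in> carrier Q" "Z \<in> carrier Q" "X \<sqsubseteq>\<^bsub>Q\<^esub> Y" "Y \<sqsubseteq>\<^bsub>Q\<^esub> Z" for X Y Z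
  proof -
    obtain a b c where ab: "a \<in> carrier L" "b \<in> carrier L" "c \<in> carrier L" "X = q a" "Y = q b" "Z = q c"
      using XY(1-3) unfolding Q_carrier by blast
    then have h: "(a \<sqinter> b, a) \<in> C" "(b \<sqinter> c, b) \<in> C" using XY q_le by auto
    have "(a \<sqinter> c, (a \<sqinter> b) \<sqinter> c) \<in> C"
      by (rule frame_congruenceD(2)[OF fc]) (use h C_sym C_refl ab in auto)
    moreover have "((a \<sqinter> b) \<sqinter> c, a \<sqinter> b) \<in> C"
      unfolding meet_assoc[OF ab(1-3)]
      by (rule frame_congruenceD(2)[OF fc]) (use h C_sym C_refl ab in auto)
    ultimately have "(a \<sqinter> c, a) \<in> C" using h C_trans by blast
    then show ?thesis using ab q_le by simp
  qed
  have rf: "X \<sqsubseteq>\<^bsub>Q\<^esub> X" if X: "X \<in> carrier Q" for X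
  proof -
    obtain a where a: "a \<in> carrier L" "X = q a" using X unfolding Q_carrier by blast
    have "a \<sqinter> a = a" by (rule meet_absorb) (use a in simp_all)
    then show ?thesis unfolding a(2) q_le[OF a(1) a(1)] using C_refl[OF a(1)] by simp
  qed
  show ?thesis
  proof unfold_locales
    show "X \<sqsubseteq>\<^bsub>Q\<^esub> Z"
      if "X \<sqsubseteq>\<^bsub>Q\<^esub> Y" "Y \<sqsubseteq>\<^bsub>Q\<^esub> Z" "X \<in> carrier Q" "Y \<in> carrier Q" "Z \<in> carrier Q" for X Y Z
      by (rule tr[OF that(3-5) that(1,2)])
    show "X .=\<^bsub>Q\<^esub> Y"
      if "X \<sqsubseteq>\<^bsub>Q\<^esub> Y" "Y \<sqsubseteq>\<^bsub>Q\<^esub> X" "X \<in> carrier Q" "Y \<in> carrier Q" for X Y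
      unfolding e by (rule anti[OF that(3,4) that(1,2)])
  qed (simp_all add: e rf)
qed

lemma q_Sup:
  assumes "A \<subseteq> carrier L"
  shows "least Q (q (\<Squnion>A)) (Upper Q (q ` A))" "\<Squnion>\<^bsub>Q\<^esub>(q ` A) = q (\<Squnion>A)"
proof -
  have 1: "q ` A \<subseteq> carrier Q" "q (\<Squnion>A) \<in> carrier Q" using assms by (auto simp: Q_carrier)
  have 2: "X \<sqsubseteq>\<^bsub>Q\<^esub> q (\<Squnion>A)" if "X \<in> q ` A" for X
    using that assms by (auto simp: q_le meet_absorb sup_upper C_refl subset_iff)
  have 3: "q (\<Squnion>A) \<sqsubseteq>\<^bsub>Q\<^esub> Y" if Y: "Y \<in> carrier Q" "\<And>X. X \<in> q ` A \<Longrightarrow> X \<sqsubseteq>\<^bsub>Q\<^esub> Y" for Y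
  proof -
    obtain b where b: "b \<in> carrier L" "Y = q b" using Y unfolding Q_carrier by auto
    have "(a \<sqinter> b, a) \<in> C" if "a \<in> A" for a
      using Y(2)[of "q a"] that assms b q_le[of a b] by auto
    then have "(\<lambda>a. (a \<sqinter> b, a)) ` A \<subseteq> C" by auto
    from frame_congruenceD(3)[OF fc this]
    have "(\<Squnion>((\<lambda>a. b \<sqinter> a) ` A), \<Squnion>A) \<in> C" by (simp add: image_image meet_commute)
    then have "(\<Squnion>A \<sqinter> b, \<Squnion>A) \<in> C"
      using meet_Sup_distrib[OF b(1) assms] meet_commute by simp
    then show ?thesis using b assms by (simp add: q_le)
  qed
  show "least Q (q (\<Squnion>A)) (Upper Q (q ` A))"
  proof (rule Sup_eqI(1)[OF Q_po 1])
    show "X \<sqsubseteq>\<^bsub>Q\<^esub> q (\<Squnion>A)" if "X \<in> q ` A" for X by (rule 2[OF that])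
    show "q (\<Squnion>A) \<sqsubseteq>\<^bsub>Q\<^esub> Y" if "Y \<in> carrier Q" "\<And>X. X \<in> q ` A \<Longrightarrow> X \<sqsubseteq>\<^bsub>Q\<^esub> Y" for Y
      by (rule 3[OF that])
  qed
  show "\<Squnion>\<^bsub>Q\<^esub>(q ` A) = q (\<Squnion>A)"
  proof (rule Sup_eqI(2)[OF Q_po 1])
    show "X \<sqsubseteq>\<^bsub>Q\<^esub> q (\<Squnion>A)" if "X \<in> q ` A" for X by (rule 2[OF that])
    show "q (\<Squnion>A) \<sqsubseteq>\<^bsub>Q\<^esub> Y" if "Y \<in> carrier Q" "\<And>X. X \<in> q ` A \<Longrightarrow> X \<sqsubseteq>\<^bsub>Q\<^esub> Y" for Y
      by (rule 3[OF that])
  qed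
qed

lemma q_meet:
  assumes ab: "a \<in> carrier L" "b \<in> carrier L"
  shows "q a \<sqinter>\<^bsub>Q\<^esub> q b = q (a \<sqinter> b)"
proof (rule meet_eqI[OF Q_po])
  have m: "a \<sqinter> b \<in> carrier L" using ab by (rule meet_closed)
  show "q a \<in> carrier Q" "q b \<in> carrier Q" "q (a \<sqinter> b) \<in> carrier Q"
    unfolding Q_carrier using ab m by blast+
  have "(a \<sqinter> b) \<sqinter> a = a \<sqinter> b" "(a \<sqinter> b) \<sqinter> b = a \<sqinter> b"
    using meet_absorb[OF meet_left[OF ab] m ab(1)] meet_absorb[OF meet_right[OF ab] m ab(2)]
    by simp_all
  then show "q (a \<sqinter> b) \<sqsubseteq>\<^bsub>Q\<^esub> q a" "q (a \<sqinter> b) \<sqsubseteq>\<^bsub>Q\<^esub> q b"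
    unfolding q_le[OF m ab(1)] q_le[OF m ab(2)] using C_refl[OF m] by simp_all
  fix Z assume Z: "Z \<in> carrier Q" "Z \<sqsubseteq>\<^bsub>Q\<^esub> q a" "Z \<sqsubseteq>\<^bsub>Q\<^esub> q b"
  obtain c where c: "c \<in> carrier L" "Z = q c" using Z(1) unfolding Q_carrier by blast
  have h: "(c \<sqinter> a, c) \<in> C" "(c \<sqinter> b, c) \<in> C"
    using Z(2,3) unfolding c(2) q_le[OF c(1) ab(1)] q_le[OF c(1) ab(2)] by simp_all
  have "((c \<sqinter> a) \<sqinter> b, c \<sqinter> b) \<in> C"
    by (rule frame_congruenceD(2)[OF fc h(1) C_refl[OF ab(2)]])
  from C_trans[OF this h(2)] have "(c \<sqinter> (a \<sqinter> b), c) \<in> C"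
    unfolding meet_assoc[OF c(1) ab] .
  then show "Z \<sqsubseteq>\<^bsub>Q\<^esub> q (a \<sqinter> b)" unfolding c(2) q_le[OF c(1) m] .
qed

lemma q_top: "\<top>\<^bsub>Q\<^esub> = q \<top>"
  by (rule top_eqI[OF Q_po]) (auto simp: Q_carrier q_le top_meet_eq C_refl)

lemma quotient_is_frame: "frame Q"
proof (rule frame_criterion[OF Q_po])
  fix A assume A: "A \<subseteq> carrier Q"
  then obtain B where B: "B \<subseteq> carrier L" "A = q ` B" unfolding Q_carrier by (meson subset_image_iff)
  show "\<exists>s. least Q s (Upper Q A)" using q_Sup(1)[OF B(1)] B(2) by blast
  fix X assume "X \<in> carrier Q"
  then obtain x where x: "x \<in> carrier L" "X = q x" unfolding Q_carrier by auto
  have 1: "X \<sqinter>\<^bsub>Q\<^esub> (\<Squnion>\<^bsub>Q\<^esub>A) = q (\<Squnion>((\<lambda>b. x \<sqinter> b) ` B))"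
    using x B by (simp add: q_Sup(2) q_meet meet_Sup_distrib)
  have "(\<lambda>a. X \<sqinter>\<^bsub>Q\<^esub> a) ` A = q ` (\<lambda>b. x \<sqinter> b) ` B"
    unfolding B(2) image_image by (rule image_cong) (use x B in \<open>auto simp: q_meet subset_iff\<close>)
  moreover have "(\<lambda>b. x \<sqinter> b) ` B \<subseteq> carrier L" using x B by auto
  ultimately show "X \<sqinter>\<^bsub>Q\<^esub> (\<Squnion>\<^bsub>Q\<^esub>A) = \<Squnion>\<^bsub>Q\<^esub>((\<lambda>a. X \<sqinter>\<^bsub>Q\<^esub> a) ` A)"
    using 1 q_Sup(2) by simp
qed

lemma q_hom: "q \<in> frame_hom L Q"
  unfolding frame_hom_def by (auto simp: q_Sup q_top q_meet Q_carrier)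

end

lemma quotient_proj_hom:
  assumes "frame L" "R \<subseteq> carrier L \<times> carrier L"
  shows "frame (frame_quotient L R)" "quotient_proj L R \<in> frame_hom L (frame_quotient L R)"
    "quotient_proj L R ` carrier L = carrier (frame_quotient L R)"
proof -
  interpret frame L by fact
  interpret frame_presentation L R by unfold_locales fact
  show "frame (frame_quotient L R)" "quotient_proj L R \<in> frame_hom L (frame_quotient L R)"
    "quotient_proj L R ` carrier L = carrier (frame_quotient L R)"
    using quotient_is_frame q_hom Q_carrier by auto
qed

lemma quotient_proj_le:
  assumes "frame L" "R \<subseteq> carrier L \<times> carrier L" "(a, b) \<in> R"
  shows "quotient_proj L R a \<sqsubseteq>\<^bsub>frame_quotient L R\<^esub> quotient_proj L R b"
proof -
  interpret frame L by fact
  interpret frame_presentation L R by unfold_locales fact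
  show ?thesis using q_le[of a b] congruence_generated_is_congruence(2)[OF assms] assms by auto
qed

lemma quotient_proj_kernel:
  assumes "frame L" "R \<subseteq> carrier L \<times> carrier L"
  shows "congruence_generated L R =
    {(a, b). a \<in> carrier L \<and> b \<in> carrier L \<and> quotient_proj L R a = quotient_proj L R b}"
proof -
  interpret frame L by fact
  interpret frame_presentation L R by unfold_locales fact
  have "(a, b) \<in> C \<longleftrightarrow> a \<in> carrier L \<and> b \<in> carrier L \<and> q a = q b" for a b
    using q_eq[of a b] C_carrier[of a b] by blast
  then show ?thesis by auto
qed

lemma frame_quotient_universal:
  assumes "frame L" "frame M" "R \<subseteq> carrier L \<times> carrier L" "f \<in> frame_hom L M"
    and f_le: "\<And>a b. (a, b) \<in> R \<Longrightarrow> f a \<sqsubseteq>\<^bsub>M\<^esub> f b"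
  shows "\<exists>g \<in> frame_hom (frame_quotient L R) M. \<forall>a \<in> carrier L. g (quotient_proj L R a) = f a"
    "\<And>g h. \<lbrakk>g \<in> frame_hom (frame_quotient L R) M; h \<in> frame_hom (frame_quotient L R) M;
       \<And>a. a \<in> carrier L \<Longrightarrow> g (quotient_proj L R a) = h (quotient_proj L R a);
       x \<in> carrier (frame_quotient L R)\<rbrakk> \<Longrightarrow> g x = h x"
proof -
  interpret frame L by fact
  interpret frame_presentation L R by unfold_locales fact
  interpret M: frame M by fact
  note f = frame_homD[OF assms(4)]
  have "C \<subseteq> {(a, b). a \<in> carrier L \<and> b \<in> carrier L \<and> f a = f b}"
  proof (rule congruence_generated_is_congruence(3)[OF assms(1,3) kernel_frame_congruence[OF assms(1,2,4)]])
    fix a b assume ab: "(a, b) \<in> R"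
    then have c: "a \<in> carrier L" "b \<in> carrier L" using R by auto
    then show "(a \<sqinter>\<^bsub>L\<^esub> b, a) \<in> {(a, b). a \<in> carrier L \<and> b \<in> carrier L \<and> f a = f b}"
      using M.meet_absorb[OF f_le[OF ab]] by (simp add: f)
  qed
  then have fC: "f a = f b" if "(a, b) \<in> C" for a b using that by auto
  define g where "g X = f (SOME a. a \<in> carrier L \<and> X = q a)" for X
  have gq: "g (q a) = f a" if "a \<in> carrier L" for a
  proof -
    have "(SOME b. b \<in> carrier L \<and> q a = q b) \<in> carrier L \<and> q a = q (SOME b. b \<in> carrier L \<and> q a = q b)"
      by (rule someI[of "\<lambda>b. b \<in> carrier L \<and> q a = q b" a]) (use that in auto)
    then show ?thesis unfolding g_def using q_eq that fC by metis
  qed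
  have "g \<in> frame_hom Q M"
  proof -
    have "g (\<Squnion>\<^bsub>Q\<^esub>A) = \<Squnion>\<^bsub>M\<^esub>(g ` A)" if A: "A \<subseteq> carrier Q" for A
    proof -
      obtain B where B: "B \<subseteq> carrier L" "A = q ` B" using A unfolding Q_carrier by (meson subset_image_iff)
      have "g ` A = f ` B" unfolding B(2) image_image by (rule image_cong) (use B gq in auto)
      then show ?thesis using B by (simp add: q_Sup gq f)
    qed
    then show ?thesis unfolding frame_hom_def by (auto simp: Q_carrier gq f q_top q_meet)
  qed
  then show "\<exists>g \<in> frame_hom Q M. \<forall>a \<in> carrier L. g (q a) = f a" using gq by blast
  show "g x = h x" if "\<And>a. a \<in> carrier L \<Longrightarrow> g (q a) = h (q a)" "x \<in> carrier Q" for g h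
    using that unfolding Q_carrier by auto
qed

subsection \<open>Coproducts\<close>

lemma coprod_idealD:
  assumes "coprod_ideal L M I"
  shows "I \<subseteq> carrier L \<times> carrier M"
    "\<And>a b a' b'. \<lbrakk>(a, b) \<in> I; a' \<in> carrier L; b' \<in> carrier M; a' \<sqsubseteq>\<^bsub>L\<^esub> a; b' \<sqsubseteq>\<^bsub>M\<^esub> b\<rbrakk> \<Longrightarrow> (a', b') \<in> I"
    "\<And>A b. \<lbrakk>A \<subseteq> carrier L; b \<in> carrier M; \<And>a. a \<in> A \<Longrightarrow> (a, b) \<in> I\<rbrakk> \<Longrightarrow> (\<Squnion>\<^bsub>L\<^esub>A, b) \<in> I"
    "\<And>a B. \<lbrakk>a \<in> carrier L; B \<subseteq> carrier M; \<And>b. b \<in> B \<Longrightarrow> (a, b) \<in> I\<rbrakk> \<Longrightarrow> (a, \<Squnion>\<^bsub>M\<^esub>B) \<in> I"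
proof -
  note a = assms[unfolded coprod_ideal_def]
  show "I \<subseteq> carrier L \<times> carrier M" using a by simp
  show "\<And>a b a' b'. \<lbrakk>(a, b) \<in> I; a' \<in> carrier L; b' \<in> carrier M; a' \<sqsubseteq>\<^bsub>L\<^esub> a; b' \<sqsubseteq>\<^bsub>M\<^esub> b\<rbrakk> \<Longrightarrow> (a', b') \<in> I"
    using a by fast
  show "(\<Squnion>\<^bsub>L\<^esub>A, b) \<in> I" if "A \<subseteq> carrier L" "b \<in> carrier M" "\<And>a. a \<in> A \<Longrightarrow> (a, b) \<in> I" for A b
  proof -
    have "A \<times> {b} \<subseteq> I" using that(3) by auto
    then show ?thesis using a that(1,2) by simp
  qed
  show "(a, \<Squnion>\<^bsub>M\<^esub>B) \<in> I" if "a \<in> carrier L" "B \<subseteq> carrier M" "\<And>b. b \<in> B \<Longrightarrow> (a, b) \<in> I" for a B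
  proof -
    have "{a} \<times> B \<subseteq> I" using that(3) by auto
    then show ?thesis using a that(1,2) by simp
  qed
qed

lemma coprod_idealI:
  assumes "I \<subseteq> carrier L \<times> carrier M"
    "\<And>a b a' b'. \<lbrakk>(a, b) \<in> I; a' \<in> carrier L; b' \<in> carrier M; a' \<sqsubseteq>\<^bsub>L\<^esub> a; b' \<sqsubseteq>\<^bsub>M\<^esub> b\<rbrakk> \<Longrightarrow> (a', b') \<in> I"
    "\<And>A b. \<lbrakk>A \<subseteq> carrier L; b \<in> carrier M; \<And>a. a \<in> A \<Longrightarrow> (a, b) \<in> I\<rbrakk> \<Longrightarrow> (\<Squnion>\<^bsub>L\<^esub>A, b) \<in> I"
    "\<And>a B. \<lbrakk>a \<in> carrier L; B \<subseteq> carrier M; \<And>b. b \<in> B \<Longrightarrow> (a, b) \<in> I\<rbrakk> \<Longrightarrow> (a, \<Squnion>\<^bsub>M\<^esub>B) \<in> I"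
  shows "coprod_ideal L M I"
  unfolding coprod_ideal_def
proof (intro conjI allI impI ballI)
  show "I \<subseteq> carrier L \<times> carrier M" by (rule assms(1))
  show "case p of (a, b) \<Rightarrow> \<forall>a' \<in> carrier L. \<forall>b' \<in> carrier M. a' \<sqsubseteq>\<^bsub>L\<^esub> a \<and> b' \<sqsubseteq>\<^bsub>M\<^esub> b \<longrightarrow> (a', b') \<in> I"
    if "p \<in> I" for p
    using that assms(2) by (cases p) simp
  show "(\<Squnion>\<^bsub>L\<^esub>A, b) \<in> I" if "A \<subseteq> carrier L" "b \<in> carrier M" "A \<times> {b} \<subseteq> I" for A b
    by (rule assms(3)[OF that(1,2)]) (use that(3) in auto)
  show "(a, \<Squnion>\<^bsub>M\<^esub>B) \<in> I" if "a \<in> carrier L" "B \<subseteq> carrier M" "{a} \<times> B \<subseteq> I" for a B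
    by (rule assms(4)[OF that(1,2)]) (use that(3) in auto)
qed

locale frame_pair = L: frame L + M: frame M
  for L :: "('a, 'm) gorder_scheme" and M :: "('b, 'n) gorder_scheme"
begin

abbreviation "K \<equiv> frame_coprod L M"
abbreviation "\<iota> \<equiv> coprod_inl L M"
abbreviation "\<kappa> \<equiv> coprod_inr L M"
abbreviation "ideal \<equiv> coprod_ideal L M"

definition ideal_hull :: "('a \<times> 'b) set \<Rightarrow> ('a \<times> 'b) set" where
  "ideal_hull S = \<Inter>{I. ideal I \<and> S \<subseteq> I}"

lemma K_po: "partial_order K" unfolding frame_coprod_def by (rule set_order_po)

lemma K_simps [simp]: "I \<in> carrier K \<longleftrightarrow> ideal I" "I \<sqsubseteq>\<^bsub>K\<^esub> J \<longleftrightarrow> I \<subseteq> J"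
  by (simp_all add: frame_coprod_def)

lemma ideal_full: "ideal (carrier L \<times> carrier M)"
  by (rule coprod_idealI) auto

lemma ideal_Inter:
  assumes "\<And>I. I \<in> \<I> \<Longrightarrow> ideal I" "\<I> \<noteq> {}"
  shows "ideal (\<Inter>\<I>)"
proof (rule coprod_idealI)
  show "\<Inter>\<I> \<subseteq> carrier L \<times> carrier M" using coprod_idealD(1)[OF assms(1)] assms(2) by fast
  show "(a', b') \<in> \<Inter>\<I>"
    if h: "(a, b) \<in> \<Inter>\<I>" "a' \<in> carrier L" "b' \<in> carrier M" "a' \<sqsubseteq>\<^bsub>L\<^esub> a" "b' \<sqsubseteq>\<^bsub>M\<^esub> b" for a b a' b'
    by (rule InterI, rule coprod_idealD(2)[OF assms(1) InterD[OF h(1)] h(2-5)])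
  show "(\<Squnion>\<^bsub>L\<^esub>A, b) \<in> \<Inter>\<I>" if h: "A \<subseteq> carrier L" "b \<in> carrier M" "\<And>a. a \<in> A \<Longrightarrow> (a, b) \<in> \<Inter>\<I>" for A b
  proof (rule InterI)
    fix I assume "I \<in> \<I>"
    then show "(\<Squnion>\<^bsub>L\<^esub>A, b) \<in> I" using coprod_idealD(3)[OF assms(1) h(1,2), of I] InterD[OF h(3)] by blast
  qed
  show "(a, \<Squnion>\<^bsub>M\<^esub>B) \<in> \<Inter>\<I>" if h: "a \<in> carrier L" "B \<subseteq> carrier M" "\<And>b. b \<in> B \<Longrightarrow> (a, b) \<in> \<Inter>\<I>" for a B
  proof (rule InterI)
    fix I assume "I \<in> \<I>"
    then show "(a, \<Squnion>\<^bsub>M\<^esub>B) \<in> I" using coprod_idealD(4)[OF assms(1) h(1,2), of I] InterD[OF h(3)] by blast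
  qed
qed

lemma ideal_Int: "\<lbrakk>ideal I; ideal J\<rbrakk> \<Longrightarrow> ideal (I \<inter> J)"
  using ideal_Inter[of "{I, J}"] by auto

lemma ideal_hull:
  assumes "S \<subseteq> carrier L \<times> carrier M"
  shows "ideal (ideal_hull S)" "S \<subseteq> ideal_hull S" "\<And>I. \<lbrakk>ideal I; S \<subseteq> I\<rbrakk> \<Longrightarrow> ideal_hull S \<subseteq> I"
proof -
  show "ideal (ideal_hull S)" unfolding ideal_hull_def
    by (rule ideal_Inter) (use assms ideal_full in blast)+
qed (auto simp: ideal_hull_def)

lemma K_Sup:
  assumes "\<And>I. I \<in> \<I> \<Longrightarrow> ideal I"
  shows "least K (ideal_hull (\<Union>\<I>)) (Upper K \<I>)" "\<Squnion>\<^bsub>K\<^esub>\<I> = ideal_hull (\<Union>\<I>)"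
proof -
  have c: "\<Union>\<I> \<subseteq> carrier L \<times> carrier M" using coprod_idealD(1)[OF assms] by blast
  note h = ideal_hull[OF c]
  have 1: "\<I> \<subseteq> carrier K" "ideal_hull (\<Union>\<I>) \<in> carrier K" using assms h(1) by auto
  have 2: "I \<sqsubseteq>\<^bsub>K\<^esub> ideal_hull (\<Union>\<I>)" if "I \<in> \<I>" for I using that h(2) by auto
  have 3: "ideal_hull (\<Union>\<I>) \<sqsubseteq>\<^bsub>K\<^esub> J" if "J \<in> carrier K" "\<And>I. I \<in> \<I> \<Longrightarrow> I \<sqsubseteq>\<^bsub>K\<^esub> J" for J
    using that h(3)[of J] by auto
  show "least K (ideal_hull (\<Union>\<I>)) (Upper K \<I>)" by (rule Sup_eqI(1)[OF K_po 1]; fact 2 3)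
  show "\<Squnion>\<^bsub>K\<^esub>\<I> = ideal_hull (\<Union>\<I>)" by (rule Sup_eqI(2)[OF K_po 1]; fact 2 3)
qed

lemma K_meet: "\<lbrakk>ideal I; ideal J\<rbrakk> \<Longrightarrow> I \<sqinter>\<^bsub>K\<^esub> J = I \<inter> J"
  by (rule meet_eqI[OF K_po]) (auto simp: ideal_Int)

lemma K_top: "\<top>\<^bsub>K\<^esub> = carrier L \<times> carrier M"
  by (rule top_eqI[OF K_po]) (auto simp: ideal_full dest: coprod_idealD(1))

lemma K_frame: "frame K"
proof (rule frame_criterion[OF K_po])
  fix \<I> assume A: "\<I> \<subseteq> carrier K"
  then have I: "\<And>I. I \<in> \<I> \<Longrightarrow> ideal I" by auto
  then show "\<exists>s. least K s (Upper K \<I>)" using K_Sup(1) by blast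
  fix X assume "X \<in> carrier K"
  then have X: "ideal X" by simp
  have c: "\<Union>\<I> \<subseteq> carrier L \<times> carrier M" using coprod_idealD(1)[OF I] by blast
  note h = ideal_hull[OF c]
  have im: "(\<lambda>a. X \<sqinter>\<^bsub>K\<^esub> a) ` \<I> = (\<inter>) X ` \<I>"
    by (rule image_cong) (auto simp: K_meet I X)
  let ?U = "\<Union>((\<inter>) X ` \<I>)"
  have c': "?U \<subseteq> carrier L \<times> carrier M" using c by blast
  note h' = ideal_hull[OF c']
  let ?J = "ideal_hull ?U"
  note J = coprod_idealD[OF h'(1)]
  let ?W = "{(a, b) \<in> carrier L \<times> carrier M. \<forall>(x, y) \<in> X. (a \<sqinter>\<^bsub>L\<^esub> x, b \<sqinter>\<^bsub>M\<^esub> y) \<in> ?J}"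
  note Xc = subsetD[OF coprod_idealD(1)[OF X]]
  have W: "ideal ?W"
  proof (rule coprod_idealI)
    show "(a', b') \<in> ?W"
      if "(a, b) \<in> ?W" "a' \<in> carrier L" "b' \<in> carrier M" "a' \<sqsubseteq>\<^bsub>L\<^esub> a" "b' \<sqsubseteq>\<^bsub>M\<^esub> b" for a b a' b'
    proof -
      have "(a' \<sqinter>\<^bsub>L\<^esub> x, b' \<sqinter>\<^bsub>M\<^esub> y) \<in> ?J" if xy: "(x, y) \<in> X" for x y
      proof (rule J(2))
        show "(a \<sqinter>\<^bsub>L\<^esub> x, b \<sqinter>\<^bsub>M\<^esub> y) \<in> ?J" using \<open>(a, b) \<in> ?W\<close> xy by blast
        show "a' \<sqinter>\<^bsub>L\<^esub> x \<sqsubseteq>\<^bsub>L\<^esub> a \<sqinter>\<^bsub>L\<^esub> x" "b' \<sqinter>\<^bsub>M\<^esub> y \<sqsubseteq>\<^bsub>M\<^esub> b \<sqinter>\<^bsub>M\<^esub> y"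
          using \<open>(a, b) \<in> ?W\<close> \<open>a' \<sqsubseteq>\<^bsub>L\<^esub> a\<close> \<open>b' \<sqsubseteq>\<^bsub>M\<^esub> b\<close> \<open>a' \<in> carrier L\<close> \<open>b' \<in> carrier M\<close> Xc[OF xy]
          by (simp_all add: L.meet_mono M.meet_mono)
      qed (use Xc[OF xy] that \<open>a' \<in> carrier L\<close> \<open>b' \<in> carrier M\<close> in simp_all)
      then show ?thesis using that by blast
    qed
    show "(\<Squnion>\<^bsub>L\<^esub>A, b) \<in> ?W" if A: "A \<subseteq> carrier L" "b \<in> carrier M" "\<And>a. a \<in> A \<Longrightarrow> (a, b) \<in> ?W" for A b
    proof -
      have "(\<Squnion>\<^bsub>L\<^esub>A \<sqinter>\<^bsub>L\<^esub> x, b \<sqinter>\<^bsub>M\<^esub> y) \<in> ?J" if xy: "(x, y) \<in> X" for x y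
      proof -
        have x: "x \<in> carrier L" "y \<in> carrier M" using Xc[OF xy] by auto
        have "(\<Squnion>\<^bsub>L\<^esub>((\<lambda>a. x \<sqinter>\<^bsub>L\<^esub> a) ` A), b \<sqinter>\<^bsub>M\<^esub> y) \<in> ?J"
        proof (rule J(3))
          fix z assume "z \<in> (\<lambda>a. x \<sqinter>\<^bsub>L\<^esub> a) ` A"
          then obtain a where "a \<in> A" "z = a \<sqinter>\<^bsub>L\<^esub> x" using L.meet_commute by blast
          then show "(z, b \<sqinter>\<^bsub>M\<^esub> y) \<in> ?J" using A(3)[of a] xy by blast
        qed (use x A in auto)
        then show ?thesis using L.meet_Sup_distrib[OF x(1) A(1)] L.meet_commute by metis
      qed
      then show ?thesis using A(1,2) by auto
    qed
    show "(a, \<Squnion>\<^bsub>M\<^esub>B) \<in> ?W" if B: "a \<in> carrier L" "B \<subseteq> carrier M" "\<And>b. b \<in> B \<Longrightarrow> (a, b) \<in> ?W" for a B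
    proof -
      have "(a \<sqinter>\<^bsub>L\<^esub> x, \<Squnion>\<^bsub>M\<^esub>B \<sqinter>\<^bsub>M\<^esub> y) \<in> ?J" if xy: "(x, y) \<in> X" for x y
      proof -
        have x: "x \<in> carrier L" "y \<in> carrier M" using Xc[OF xy] by auto
        have "(a \<sqinter>\<^bsub>L\<^esub> x, \<Squnion>\<^bsub>M\<^esub>((\<lambda>b. y \<sqinter>\<^bsub>M\<^esub> b) ` B)) \<in> ?J"
        proof (rule J(4))
          fix z assume "z \<in> (\<lambda>b. y \<sqinter>\<^bsub>M\<^esub> b) ` B"
          then obtain b where "b \<in> B" "z = b \<sqinter>\<^bsub>M\<^esub> y" using M.meet_commute by blast
          then show "(a \<sqinter>\<^bsub>L\<^esub> x, z) \<in> ?J" using B(3)[of b] xy by blast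
        qed (use x B in auto)
        then show ?thesis using M.meet_Sup_distrib[OF x(2) B(2)] M.meet_commute by metis
      qed
      then show ?thesis using B(1,2) by auto
    qed
  qed blast
  have "\<Union>\<I> \<subseteq> ?W"
  proof safe
    fix a b I assume ab: "I \<in> \<I>" "(a, b) \<in> I"
    show abc: "a \<in> carrier L" "b \<in> carrier M" using coprod_idealD(1)[OF I[OF ab(1)]] ab(2) by auto
    fix x y assume xy: "(x, y) \<in> X"
    have xc: "x \<in> carrier L" "y \<in> carrier M" using Xc[OF xy] by auto
    have "(a \<sqinter>\<^bsub>L\<^esub> x, b \<sqinter>\<^bsub>M\<^esub> y) \<in> X"
      by (rule coprod_idealD(2)[OF X xy]) (use abc xc L.meet_right M.meet_right in auto)
    moreover have "(a \<sqinter>\<^bsub>L\<^esub> x, b \<sqinter>\<^bsub>M\<^esub> y) \<in> I"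
      by (rule coprod_idealD(2)[OF I[OF ab(1)] ab(2)]) (use abc xc L.meet_left M.meet_left in auto)
    ultimately show "(a \<sqinter>\<^bsub>L\<^esub> x, b \<sqinter>\<^bsub>M\<^esub> y) \<in> ?J" using h'(2) ab(1) by blast
  qed
  then have HW: "ideal_hull (\<Union>\<I>) \<subseteq> ?W" by (rule h(3)[OF W])
  have "X \<inter> ideal_hull (\<Union>\<I>) \<subseteq> ?J"
  proof safe
    fix a b assume ab: "(a, b) \<in> X" "(a, b) \<in> ideal_hull (\<Union>\<I>)"
    have "(a \<sqinter>\<^bsub>L\<^esub> a, b \<sqinter>\<^bsub>M\<^esub> b) \<in> ?J" using subsetD[OF HW ab(2)] ab(1) by blast
    moreover have "a \<sqinter>\<^bsub>L\<^esub> a = a" "b \<sqinter>\<^bsub>M\<^esub> b = b"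
      using Xc[OF ab(1)] L.meet_absorb[of a a] M.meet_absorb[of b b] by simp_all
    ultimately show "(a, b) \<in> ?J" by simp
  qed
  moreover have "?J \<subseteq> X \<inter> ideal_hull (\<Union>\<I>)"
    by (rule h'(3)[OF ideal_Int[OF X h(1)]]) (use h(2) in blast)
  ultimately have "X \<inter> ideal_hull (\<Union>\<I>) = ?J" by (rule equalityI)
  moreover have "\<Squnion>\<^bsub>K\<^esub>((\<inter>) X ` \<I>) = ?J"
    by (rule K_Sup(2)) (use ideal_Int[OF X] I in auto)
  ultimately show "X \<sqinter>\<^bsub>K\<^esub> (\<Squnion>\<^bsub>K\<^esub>\<I>) = \<Squnion>\<^bsub>K\<^esub>((\<lambda>a. X \<sqinter>\<^bsub>K\<^esub> a) ` \<I>)"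
    unfolding im using K_Sup(2)[OF I] K_meet[OF X h(1)] by simp
qed

lemma ideal_bot:
  assumes "ideal I" "x \<in> carrier L" "y \<in> carrier M"
  shows "(\<bottom>\<^bsub>L\<^esub>, y) \<in> I" "(x, \<bottom>\<^bsub>M\<^esub>) \<in> I"
  using coprod_idealD(3)[OF assms(1), of "{}" y] coprod_idealD(4)[OF assms(1), of x "{}"] assms
  by (simp_all add: L.Sup_empty M.Sup_empty)

lemma tensor_iff:
  "(x, y) \<in> coprod_tensor L M a b \<longleftrightarrow> x \<in> carrier L \<and> y \<in> carrier M \<and>
     ((x \<sqsubseteq>\<^bsub>L\<^esub> a \<and> y \<sqsubseteq>\<^bsub>M\<^esub> b) \<or> x = \<bottom>\<^bsub>L\<^esub> \<or> y = \<bottom>\<^bsub>M\<^esub>)"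
  by (auto simp: coprod_tensor_def)

lemma tensor_ideal:
  assumes "a \<in> carrier L" "b \<in> carrier M"
  shows "ideal (coprod_tensor L M a b)"
proof (rule coprod_idealI)
  show "coprod_tensor L M a b \<subseteq> carrier L \<times> carrier M" by (auto simp: coprod_tensor_def)
  show "(x', y') \<in> coprod_tensor L M a b"
    if h: "(x, y) \<in> coprod_tensor L M a b" "x' \<in> carrier L" "y' \<in> carrier M" "x' \<sqsubseteq>\<^bsub>L\<^esub> x" "y' \<sqsubseteq>\<^bsub>M\<^esub> y" for x y x' y'
  proof -
    have c: "x \<in> carrier L" "y \<in> carrier M" using h(1) by (simp_all add: tensor_iff)
    from h(1) consider "x \<sqsubseteq>\<^bsub>L\<^esub> a \<and> y \<sqsubseteq>\<^bsub>M\<^esub> b" | "x = \<bottom>\<^bsub>L\<^esub>" | "y = \<bottom>\<^bsub>M\<^esub>"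
      unfolding tensor_iff by (elim conjE disjE) simp_all
    then show ?thesis
    proof cases
      case 1
      then have "x' \<sqsubseteq>\<^bsub>L\<^esub> a" "y' \<sqsubseteq>\<^bsub>M\<^esub> b"
        using L.le_trans[OF h(4) _ h(2) c(1) assms(1)] M.le_trans[OF h(5) _ h(3) c(2) assms(2)] by simp_all
      then show ?thesis using h(2,3) by (simp add: tensor_iff)
    next
      case 2
      then have "x' = \<bottom>\<^bsub>L\<^esub>" using L.bot_unique[OF _ h(2)] h(4) by simp
      then show ?thesis using h(2,3) by (simp add: tensor_iff)
    next
      case 3
      then have "y' = \<bottom>\<^bsub>M\<^esub>" using M.bot_unique[OF _ h(3)] h(5) by simp
      then show ?thesis using h(2,3) by (simp add: tensor_iff)
    qed
  qed
  show "(\<Squnion>\<^bsub>L\<^esub>A, y) \<in> coprod_tensor L M a b"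
    if A: "A \<subseteq> carrier L" "y \<in> carrier M" "\<And>x. x \<in> A \<Longrightarrow> (x, y) \<in> coprod_tensor L M a b" for A y
  proof -
    have m: "\<Squnion>\<^bsub>L\<^esub>A \<in> carrier L" using A(1) by (rule L.Sup_closed)
    show ?thesis
    proof (cases "y = \<bottom>\<^bsub>M\<^esub>")
      case True then show ?thesis using m A(2) by (simp add: tensor_iff)
    next
      case nb: False
      show ?thesis
      proof (cases "y \<sqsubseteq>\<^bsub>M\<^esub> b")
        case True
        have "x \<sqsubseteq>\<^bsub>L\<^esub> a" if "x \<in> A" for x
          using A(3)[OF that] nb L.bottom_lower[OF assms(1)] unfolding tensor_iff by (elim conjE disjE) simp_all
        then have "\<Squnion>\<^bsub>L\<^esub>A \<sqsubseteq>\<^bsub>L\<^esub> a" by (rule L.sup_least[OF A(1) assms(1)])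
        then show ?thesis using m A(2) True by (simp add: tensor_iff)
      next
        case False
        have "x \<sqsubseteq>\<^bsub>L\<^esub> \<bottom>\<^bsub>L\<^esub>" if "x \<in> A" for x
          using A(3)[OF that] nb False unfolding tensor_iff by (elim conjE disjE) simp_all
        then have "\<Squnion>\<^bsub>L\<^esub>A \<sqsubseteq>\<^bsub>L\<^esub> \<bottom>\<^bsub>L\<^esub>" by (rule L.sup_least[OF A(1) L.bottom_closed])
        then have "\<Squnion>\<^bsub>L\<^esub>A = \<bottom>\<^bsub>L\<^esub>" by (rule L.bot_unique[OF _ m])
        then show ?thesis using m A(2) by (simp add: tensor_iff)
      qed
    qed
  qed
  show "(x, \<Squnion>\<^bsub>M\<^esub>B) \<in> coprod_tensor L M a b"
    if B: "x \<in> carrier L" "B \<subseteq> carrier M" "\<And>y. y \<in> B \<Longrightarrow> (x, y) \<in> coprod_tensor L M a b" for x B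
  proof -
    have m: "\<Squnion>\<^bsub>M\<^esub>B \<in> carrier M" using B(2) by (rule M.Sup_closed)
    show ?thesis
    proof (cases "x = \<bottom>\<^bsub>L\<^esub>")
      case True then show ?thesis using m B(1) by (simp add: tensor_iff)
    next
      case nb: False
      show ?thesis
      proof (cases "x \<sqsubseteq>\<^bsub>L\<^esub> a")
        case True
        have "y \<sqsubseteq>\<^bsub>M\<^esub> b" if "y \<in> B" for y
          using B(3)[OF that] nb M.bottom_lower[OF assms(2)] unfolding tensor_iff by (elim conjE disjE) simp_all
        then have "\<Squnion>\<^bsub>M\<^esub>B \<sqsubseteq>\<^bsub>M\<^esub> b" by (rule M.sup_least[OF B(2) assms(2)])
        then show ?thesis using m B(1) True by (simp add: tensor_iff)
      next
        case False
        have "y \<sqsubseteq>\<^bsub>M\<^esub> \<bottom>\<^bsub>M\<^esub>" if "y \<in> B" for y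
          using B(3)[OF that] nb False unfolding tensor_iff by (elim conjE disjE) simp_all
        then have "\<Squnion>\<^bsub>M\<^esub>B \<sqsubseteq>\<^bsub>M\<^esub> \<bottom>\<^bsub>M\<^esub>" by (rule M.sup_least[OF B(2) M.bottom_closed])
        then have "\<Squnion>\<^bsub>M\<^esub>B = \<bottom>\<^bsub>M\<^esub>" by (rule M.bot_unique[OF _ m])
        then show ?thesis using m B(1) by (simp add: tensor_iff)
      qed
    qed
  qed
qed

lemma tensor_mem:
  "\<lbrakk>a \<in> carrier L; b \<in> carrier M\<rbrakk> \<Longrightarrow> (a, b) \<in> coprod_tensor L M a b"
  by (simp add: coprod_tensor_def)

lemma tensor_least:
  assumes "ideal I" "(a, b) \<in> I"
  shows "coprod_tensor L M a b \<subseteq> I"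
proof safe
  fix x y assume "(x, y) \<in> coprod_tensor L M a b"
  then have c: "x \<in> carrier L" "y \<in> carrier M"
    and d: "(x \<sqsubseteq>\<^bsub>L\<^esub> a \<and> y \<sqsubseteq>\<^bsub>M\<^esub> b) \<or> x = \<bottom>\<^bsub>L\<^esub> \<or> y = \<bottom>\<^bsub>M\<^esub>" unfolding tensor_iff by simp_all
  from d show "(x, y) \<in> I"
    using coprod_idealD(2)[OF assms c] ideal_bot[OF assms(1) c] by (elim conjE disjE) simp_all
qed

lemma inl_ideal: "a \<in> carrier L \<Longrightarrow> ideal (\<iota> a)"
  unfolding coprod_inl_def by (rule tensor_ideal) auto

lemma inr_ideal: "b \<in> carrier M \<Longrightarrow> ideal (\<kappa> b)"
  unfolding coprod_inr_def by (rule tensor_ideal) auto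

lemma inl_iff: "(x, y) \<in> \<iota> a \<longleftrightarrow> x \<in> carrier L \<and> y \<in> carrier M \<and> (x \<sqsubseteq>\<^bsub>L\<^esub> a \<or> x = \<bottom>\<^bsub>L\<^esub> \<or> y = \<bottom>\<^bsub>M\<^esub>)"
  unfolding coprod_inl_def coprod_tensor_def by auto

lemma inr_iff: "(x, y) \<in> \<kappa> b \<longleftrightarrow> x \<in> carrier L \<and> y \<in> carrier M \<and> (y \<sqsubseteq>\<^bsub>M\<^esub> b \<or> x = \<bottom>\<^bsub>L\<^esub> \<or> y = \<bottom>\<^bsub>M\<^esub>)"
  unfolding coprod_inr_def coprod_tensor_def by auto

lemma tensor_eq:
  "\<lbrakk>a \<in> carrier L; b \<in> carrier M\<rbrakk> \<Longrightarrow> coprod_tensor L M a b = \<iota> a \<sqinter>\<^bsub>K\<^esub> \<kappa> b"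
  unfolding K_meet[OF inl_ideal inr_ideal]
  by (auto simp: inl_iff inr_iff) (auto simp: coprod_tensor_def)

lemma inl_hom: "\<iota> \<in> frame_hom L K"
proof -
  have "\<iota> (\<Squnion>\<^bsub>L\<^esub>A) = \<Squnion>\<^bsub>K\<^esub>(\<iota> ` A)" if A: "A \<subseteq> carrier L" for A
  proof (rule Sup_eqI(2)[OF K_po, symmetric])
    have m: "\<Squnion>\<^bsub>L\<^esub>A \<in> carrier L" using A by simp
    show "\<iota> ` A \<subseteq> carrier K" "\<iota> (\<Squnion>\<^bsub>L\<^esub>A) \<in> carrier K" using A inl_ideal by auto
    show "X \<sqsubseteq>\<^bsub>K\<^esub> \<iota> (\<Squnion>\<^bsub>L\<^esub>A)" if X: "X \<in> \<iota> ` A" for X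
    proof -
      obtain a where a: "a \<in> A" "X = \<iota> a" using X by blast
      have "a \<in> carrier L" using a A by blast
      then have "(a, \<top>\<^bsub>M\<^esub>) \<in> \<iota> (\<Squnion>\<^bsub>L\<^esub>A)"
        using L.sup_upper[OF A a(1)] by (simp add: inl_iff)
      from tensor_least[OF inl_ideal[OF m] this] show ?thesis unfolding a(2) coprod_inl_def by simp
    qed
    show "\<iota> (\<Squnion>\<^bsub>L\<^esub>A) \<sqsubseteq>\<^bsub>K\<^esub> J" if J: "J \<in> carrier K" "\<And>X. X \<in> \<iota> ` A \<Longrightarrow> X \<sqsubseteq>\<^bsub>K\<^esub> J" for J
    proof -
      have "(a, \<top>\<^bsub>M\<^esub>) \<in> J" if "a \<in> A" for a
        using J(2)[of "\<iota> a"] that tensor_mem[of a "\<top>\<^bsub>M\<^esub>"] A unfolding coprod_inl_def by auto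
      then have "(\<Squnion>\<^bsub>L\<^esub>A, \<top>\<^bsub>M\<^esub>) \<in> J" using coprod_idealD(3)[of L M J A "\<top>\<^bsub>M\<^esub>"] J(1) A by simp
      then show ?thesis unfolding coprod_inl_def using tensor_least J(1) by simp
    qed
  qed
  moreover have "\<iota> \<top>\<^bsub>L\<^esub> = \<top>\<^bsub>K\<^esub>" unfolding K_top by (auto simp: inl_iff)
  moreover have "\<iota> (a \<sqinter>\<^bsub>L\<^esub> b) = \<iota> a \<sqinter>\<^bsub>K\<^esub> \<iota> b" if ab: "a \<in> carrier L" "b \<in> carrier L" for a b
  proof -
    have "x \<sqsubseteq>\<^bsub>L\<^esub> a \<sqinter>\<^bsub>L\<^esub> b \<longleftrightarrow> x \<sqsubseteq>\<^bsub>L\<^esub> a \<and> x \<sqsubseteq>\<^bsub>L\<^esub> b" if "x \<in> carrier L" for x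
      by (rule L.le_meet_both[OF that ab])
    then show ?thesis unfolding K_meet[OF inl_ideal[OF ab(1)] inl_ideal[OF ab(2)]] by (auto simp: inl_iff)
  qed
  ultimately show ?thesis unfolding frame_hom_def using inl_ideal by auto
qed

lemma inr_hom: "\<kappa> \<in> frame_hom M K"
proof -
  have "\<kappa> (\<Squnion>\<^bsub>M\<^esub>A) = \<Squnion>\<^bsub>K\<^esub>(\<kappa> ` A)" if A: "A \<subseteq> carrier M" for A
  proof (rule Sup_eqI(2)[OF K_po, symmetric])
    have m: "\<Squnion>\<^bsub>M\<^esub>A \<in> carrier M" using A by simp
    show "\<kappa> ` A \<subseteq> carrier K" "\<kappa> (\<Squnion>\<^bsub>M\<^esub>A) \<in> carrier K" using A inr_ideal by auto
    show "X \<sqsubseteq>\<^bsub>K\<^esub> \<kappa> (\<Squnion>\<^bsub>M\<^esub>A)" if X: "X \<in> \<kappa> ` A" for X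
    proof -
      obtain a where a: "a \<in> A" "X = \<kappa> a" using X by blast
      have "a \<in> carrier M" using a A by blast
      then have "(\<top>\<^bsub>L\<^esub>, a) \<in> \<kappa> (\<Squnion>\<^bsub>M\<^esub>A)"
        using M.sup_upper[OF A a(1)] by (simp add: inr_iff)
      from tensor_least[OF inr_ideal[OF m] this] show ?thesis unfolding a(2) coprod_inr_def by simp
    qed
    show "\<kappa> (\<Squnion>\<^bsub>M\<^esub>A) \<sqsubseteq>\<^bsub>K\<^esub> J" if J: "J \<in> carrier K" "\<And>X. X \<in> \<kappa> ` A \<Longrightarrow> X \<sqsubseteq>\<^bsub>K\<^esub> J" for J
    proof -
      have "(\<top>\<^bsub>L\<^esub>, a) \<in> J" if "a \<in> A" for a
        using J(2)[of "\<kappa> a"] that tensor_mem[of "\<top>\<^bsub>L\<^esub>" a] A unfolding coprod_inr_def by auto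
      then have "(\<top>\<^bsub>L\<^esub>, \<Squnion>\<^bsub>M\<^esub>A) \<in> J" using coprod_idealD(4)[of L M J "\<top>\<^bsub>L\<^esub>" A] J(1) A by simp
      then show ?thesis unfolding coprod_inr_def using tensor_least J(1) by simp
    qed
  qed
  moreover have "\<kappa> \<top>\<^bsub>M\<^esub> = \<top>\<^bsub>K\<^esub>" unfolding K_top by (auto simp: inr_iff)
  moreover have "\<kappa> (a \<sqinter>\<^bsub>M\<^esub> b) = \<kappa> a \<sqinter>\<^bsub>K\<^esub> \<kappa> b" if ab: "a \<in> carrier M" "b \<in> carrier M" for a b
  proof -
    have "x \<sqsubseteq>\<^bsub>M\<^esub> a \<sqinter>\<^bsub>M\<^esub> b \<longleftrightarrow> x \<sqsubseteq>\<^bsub>M\<^esub> a \<and> x \<sqsubseteq>\<^bsub>M\<^esub> b" if "x \<in> carrier M" for x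
      by (rule M.le_meet_both[OF that ab])
    then show ?thesis unfolding K_meet[OF inr_ideal[OF ab(1)] inr_ideal[OF ab(2)]] by (auto simp: inr_iff)
  qed
  ultimately show ?thesis unfolding frame_hom_def using inr_ideal by auto
qed

lemma ideal_as_Sup:
  assumes "ideal I"
  shows "I = \<Squnion>\<^bsub>K\<^esub>((\<lambda>(a, b). \<iota> a \<sqinter>\<^bsub>K\<^esub> \<kappa> b) ` I)"
proof (rule Sup_eqI(2)[OF K_po, symmetric])
  have c: "a \<in> carrier L \<and> b \<in> carrier M" if "(a, b) \<in> I" for a b
    using coprod_idealD(1)[OF assms] that by auto
  have t: "\<iota> a \<sqinter>\<^bsub>K\<^esub> \<kappa> b = coprod_tensor L M a b" if "(a, b) \<in> I" for a b
    using tensor_eq c that by metis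
  show "(\<lambda>(a, b). \<iota> a \<sqinter>\<^bsub>K\<^esub> \<kappa> b) ` I \<subseteq> carrier K"
    using t tensor_ideal c by auto
  show "I \<in> carrier K" using assms by simp
  show "X \<sqsubseteq>\<^bsub>K\<^esub> I" if X: "X \<in> (\<lambda>(a, b). \<iota> a \<sqinter>\<^bsub>K\<^esub> \<kappa> b) ` I" for X
  proof -
    obtain a b where ab: "(a, b) \<in> I" "X = \<iota> a \<sqinter>\<^bsub>K\<^esub> \<kappa> b" using X by auto
    show ?thesis unfolding ab(2) t[OF ab(1)] using tensor_least[OF assms ab(1)] by simp
  qed
  show "I \<sqsubseteq>\<^bsub>K\<^esub> J" if J: "\<And>X. X \<in> (\<lambda>(a, b). \<iota> a \<sqinter>\<^bsub>K\<^esub> \<kappa> b) ` I \<Longrightarrow> X \<sqsubseteq>\<^bsub>K\<^esub> J" for J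
  proof -
    have "(a, b) \<in> J" if ab: "(a, b) \<in> I" for a b
    proof -
      have "coprod_tensor L M a b \<subseteq> J" using J[OF imageI[OF ab]] t[OF ab] by simp
      then show ?thesis using tensor_mem c[OF ab] by blast
    qed
    then show ?thesis by auto
  qed
qed

end

lemma frame_coprod_frame:
  assumes "frame L" "frame M"
  shows "frame (frame_coprod L M)" "coprod_inl L M \<in> frame_hom L (frame_coprod L M)"
    "coprod_inr L M \<in> frame_hom M (frame_coprod L M)"
proof -
  interpret frame_pair L M using assms by (simp add: frame_pair_def)
  show "frame (frame_coprod L M)" "coprod_inl L M \<in> frame_hom L (frame_coprod L M)"
    "coprod_inr L M \<in> frame_hom M (frame_coprod L M)"
    by (rule K_frame inl_hom inr_hom)+
qed

lemma frame_coprod_universal: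
  assumes "frame L" "frame M" "frame N" "f \<in> frame_hom L N" "g \<in> frame_hom M N"
  shows "copairing N f g \<in> frame_hom (frame_coprod L M) N"
    "\<And>a. a \<in> carrier L \<Longrightarrow> copairing N f g (coprod_inl L M a) = f a"
    "\<And>b. b \<in> carrier M \<Longrightarrow> copairing N f g (coprod_inr L M b) = g b"
    "\<And>h I. \<lbrakk>h \<in> frame_hom (frame_coprod L M) N;
       \<And>a. a \<in> carrier L \<Longrightarrow> h (coprod_inl L M a) = f a;
       \<And>b. b \<in> carrier M \<Longrightarrow> h (coprod_inr L M b) = g b;
       I \<in> carrier (frame_coprod L M)\<rbrakk> \<Longrightarrow> h I = copairing N f g I"
proof -
  interpret frame_pair L M using assms by (simp add: frame_pair_def)
  interpret N: frame N by fact
  let ?c = "copairing N f g"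
  let ?t = "\<lambda>(a, b). f a \<sqinter>\<^bsub>N\<^esub> g b"
  note f = frame_homD[OF assms(4)] and g = frame_homD[OF assms(5)]
  note fm = frame_hom_mono[OF assms(1,3,4)] and gm = frame_hom_mono[OF assms(2,3,5)]
  have fb: "f \<bottom>\<^bsub>L\<^esub> = \<bottom>\<^bsub>N\<^esub>" by (rule frame_hom_bot[OF assms(1,3,4)])
  have gb: "g \<bottom>\<^bsub>M\<^esub> = \<bottom>\<^bsub>N\<^esub>" by (rule frame_hom_bot[OF assms(2,3,5)])
  have ic: "a \<in> carrier L \<and> b \<in> carrier M" if "ideal I" "(a, b) \<in> I" for I a b
    using coprod_idealD(1)[OF that(1)] that(2) by auto
  have tc: "?t ` I \<subseteq> carrier N" if "ideal I" for I
    using ic[OF that] f(1) g(1) by auto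
  have cc: "?c I \<in> carrier N" if "ideal I" for I
    unfolding copairing_def by (rule N.Sup_closed[OF tc[OF that]])
  have up: "f a \<sqinter>\<^bsub>N\<^esub> g b \<sqsubseteq>\<^bsub>N\<^esub> ?c I" if "ideal I" "(a, b) \<in> I" for a b I
    unfolding copairing_def by (rule N.sup_upper[OF tc[OF that(1)]]) (use that(2) in force)
  have lst: "?c I \<sqsubseteq>\<^bsub>N\<^esub> z" if "ideal I" "z \<in> carrier N" "\<And>a b. (a, b) \<in> I \<Longrightarrow> f a \<sqinter>\<^bsub>N\<^esub> g b \<sqsubseteq>\<^bsub>N\<^esub> z" for I z
    unfolding copairing_def by (rule N.sup_least[OF tc[OF that(1)] that(2)]) (use that(3) in auto)
  have mono: "?c I \<sqsubseteq>\<^bsub>N\<^esub> ?c J" if "ideal I" "ideal J" "I \<subseteq> J" for I J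
    by (rule lst[OF that(1) cc[OF that(2)]]) (use up[OF that(2)] that(3) in blast)
  have below: "ideal {(a, b) \<in> carrier L \<times> carrier M. f a \<sqinter>\<^bsub>N\<^esub> g b \<sqsubseteq>\<^bsub>N\<^esub> z}" (is "ideal ?B")
    if z: "z \<in> carrier N" for z
  proof (rule coprod_idealI)
    show "(a', b') \<in> ?B"
      if h: "(a, b) \<in> ?B" "a' \<in> carrier L" "b' \<in> carrier M" "a' \<sqsubseteq>\<^bsub>L\<^esub> a" "b' \<sqsubseteq>\<^bsub>M\<^esub> b" for a b a' b'
    proof -
      have c: "a \<in> carrier L" "b \<in> carrier M" using h(1) by auto
      have "f a' \<sqinter>\<^bsub>N\<^esub> g b' \<sqsubseteq>\<^bsub>N\<^esub> f a \<sqinter>\<^bsub>N\<^esub> g b"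
        by (rule N.meet_mono[OF fm[OF h(2) c(1) h(4)] gm[OF h(3) c(2) h(5)]])
          (use h c f(1) g(1) in simp_all)
      moreover have "f a \<sqinter>\<^bsub>N\<^esub> g b \<sqsubseteq>\<^bsub>N\<^esub> z" using h(1) by blast
      ultimately have "f a' \<sqinter>\<^bsub>N\<^esub> g b' \<sqsubseteq>\<^bsub>N\<^esub> z"
        by (rule N.le_trans) (use h(2,3) c f(1) g(1) z in simp_all)
      then show ?thesis using h(2,3) by blast
    qed
    show "(\<Squnion>\<^bsub>L\<^esub>A, b) \<in> ?B" if A: "A \<subseteq> carrier L" "b \<in> carrier M" "\<And>a. a \<in> A \<Longrightarrow> (a, b) \<in> ?B" for A b
    proof -
      have fA: "f ` A \<subseteq> carrier N" using A f(1) by auto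
      have "g b \<sqinter>\<^bsub>N\<^esub> \<Squnion>\<^bsub>N\<^esub>(f ` A) \<sqsubseteq>\<^bsub>N\<^esub> z"
      proof (rule N.meet_Sup_le[OF fA g(1)[OF A(2)] z])
        fix x assume "x \<in> f ` A"
        then obtain a where a: "a \<in> A" "x = f a" by blast
        show "g b \<sqinter>\<^bsub>N\<^esub> x \<sqsubseteq>\<^bsub>N\<^esub> z" using A(3)[OF a(1)] unfolding a(2) N.meet_commute[of "g b"] by blast
      qed
      then show ?thesis using A(1,2) N.meet_commute[of "g b"] by (simp add: f(2))
    qed
    show "(a, \<Squnion>\<^bsub>M\<^esub>A) \<in> ?B" if A: "a \<in> carrier L" "A \<subseteq> carrier M" "\<And>b. b \<in> A \<Longrightarrow> (a, b) \<in> ?B" for a A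
    proof -
      have gA: "g ` A \<subseteq> carrier N" using A g(1) by auto
      have "f a \<sqinter>\<^bsub>N\<^esub> \<Squnion>\<^bsub>N\<^esub>(g ` A) \<sqsubseteq>\<^bsub>N\<^esub> z"
      proof (rule N.meet_Sup_le[OF gA f(1)[OF A(1)] z])
        fix x assume "x \<in> g ` A"
        then obtain b where b: "b \<in> A" "x = g b" by blast
        show "f a \<sqinter>\<^bsub>N\<^esub> x \<sqsubseteq>\<^bsub>N\<^esub> z" using A(3)[OF b(1)] unfolding b(2) by blast
      qed
      then show ?thesis using A(1,2) by (simp add: g(2))
    qed
  qed blast
  show cl: "?c (\<iota> a) = f a" if a: "a \<in> carrier L" for a
  proof (rule N.le_antisym)
    show "?c (\<iota> a) \<sqsubseteq>\<^bsub>N\<^esub> f a"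
    proof (rule lst[OF inl_ideal[OF a] f(1)[OF a]])
      have "\<iota> a \<subseteq> {(x, y) \<in> carrier L \<times> carrier M. f x \<sqinter>\<^bsub>N\<^esub> g y \<sqsubseteq>\<^bsub>N\<^esub> f a}"
        unfolding coprod_inl_def
        by (rule tensor_least[OF below[OF f(1)[OF a]]]) (use a f(1) g(1) N.meet_left in simp)
      then show "f x \<sqinter>\<^bsub>N\<^esub> g y \<sqsubseteq>\<^bsub>N\<^esub> f a" if "(x, y) \<in> \<iota> a" for x y using that by blast
    qed
    have "(a, \<top>\<^bsub>M\<^esub>) \<in> \<iota> a" using a by (simp add: inl_iff)
    from up[OF inl_ideal[OF a] this] show "f a \<sqsubseteq>\<^bsub>N\<^esub> ?c (\<iota> a)"
      by (simp add: g(3) N.top_meet_eq f(1) a)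
  qed (use cc inl_ideal f(1) a in auto)
  show cr: "?c (\<kappa> b) = g b" if b: "b \<in> carrier M" for b
  proof (rule N.le_antisym)
    show "?c (\<kappa> b) \<sqsubseteq>\<^bsub>N\<^esub> g b"
    proof (rule lst[OF inr_ideal[OF b] g(1)[OF b]])
      have "\<kappa> b \<subseteq> {(x, y) \<in> carrier L \<times> carrier M. f x \<sqinter>\<^bsub>N\<^esub> g y \<sqsubseteq>\<^bsub>N\<^esub> g b}"
        unfolding coprod_inr_def
        by (rule tensor_least[OF below[OF g(1)[OF b]]]) (use b f(1) g(1) N.meet_right in simp)
      then show "f x \<sqinter>\<^bsub>N\<^esub> g y \<sqsubseteq>\<^bsub>N\<^esub> g b" if "(x, y) \<in> \<kappa> b" for x y using that by blast
    qed
    have "(\<top>\<^bsub>L\<^esub>, b) \<in> \<kappa> b" using b by (simp add: inr_iff)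
    from up[OF inr_ideal[OF b] this] show "g b \<sqsubseteq>\<^bsub>N\<^esub> ?c (\<kappa> b)"
      by (simp add: f(3) N.meet_commute[of "\<top>\<^bsub>N\<^esub>"] N.top_meet_eq g(1) b)
  qed (use cc inr_ideal g(1) b in auto)
  have cSup: "?c (\<Squnion>\<^bsub>K\<^esub>\<I>) = \<Squnion>\<^bsub>N\<^esub>(?c ` \<I>)" if \<I>: "\<I> \<subseteq> carrier K" for \<I>
  proof -
    have I: "\<And>I. I \<in> \<I> \<Longrightarrow> ideal I" using \<I> by auto
    have c: "\<Union>\<I> \<subseteq> carrier L \<times> carrier M" using coprod_idealD(1)[OF I] by blast
    note h = ideal_hull[OF c]
    have sc: "?c ` \<I> \<subseteq> carrier N" using cc I by auto
    let ?z = "\<Squnion>\<^bsub>N\<^esub>(?c ` \<I>)"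
    have z: "?z \<in> carrier N" by (rule N.Sup_closed[OF sc])
    have "?c (ideal_hull (\<Union>\<I>)) = ?z"
    proof (rule N.le_antisym)
      show "?z \<sqsubseteq>\<^bsub>N\<^esub> ?c (ideal_hull (\<Union>\<I>))"
      proof (rule N.sup_least[OF sc cc[OF h(1)]])
        fix x assume "x \<in> ?c ` \<I>"
        then obtain I where "I \<in> \<I>" "x = ?c I" by blast
        then show "x \<sqsubseteq>\<^bsub>N\<^esub> ?c (ideal_hull (\<Union>\<I>))" using mono[OF I h(1)] h(2) by blast
      qed
      have "\<Union>\<I> \<subseteq> {(a, b) \<in> carrier L \<times> carrier M. f a \<sqinter>\<^bsub>N\<^esub> g b \<sqsubseteq>\<^bsub>N\<^esub> ?z}"
      proof safe
        fix a b J assume J: "J \<in> \<I>" "(a, b) \<in> J"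
        show ab: "a \<in> carrier L" "b \<in> carrier M" using ic[OF I[OF J(1)] J(2)] by auto
        have "?c J \<sqsubseteq>\<^bsub>N\<^esub> ?z" by (rule N.sup_upper[OF sc]) (use J in simp)
        from N.le_trans[OF up[OF I[OF J(1)] J(2)] this]
        show "f a \<sqinter>\<^bsub>N\<^esub> g b \<sqsubseteq>\<^bsub>N\<^esub> ?z" using ab f(1) g(1) cc[OF I[OF J(1)]] z by simp
      qed
      from h(3)[OF below[OF z] this] show "?c (ideal_hull (\<Union>\<I>)) \<sqsubseteq>\<^bsub>N\<^esub> ?z"
        by (intro lst[OF h(1) z]) blast
    qed (use cc[OF h(1)] z in simp_all)
    then show ?thesis using K_Sup(2)[OF I] by simp
  qed
  have cmeet: "?c (I \<sqinter>\<^bsub>K\<^esub> J) = ?c I \<sqinter>\<^bsub>N\<^esub> ?c J" if I: "ideal I" and J: "ideal J" for I J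
    unfolding K_meet[OF I J]
  proof (rule N.le_antisym)
    have IJ: "ideal (I \<inter> J)" by (rule ideal_Int[OF I J])
    show "?c (I \<inter> J) \<in> carrier N" "?c I \<sqinter>\<^bsub>N\<^esub> ?c J \<in> carrier N" using cc I J IJ by auto
    show "?c (I \<inter> J) \<sqsubseteq>\<^bsub>N\<^esub> ?c I \<sqinter>\<^bsub>N\<^esub> ?c J"
      by (rule N.meet_le) (use mono[OF IJ I] mono[OF IJ J] cc I J IJ in simp_all)
    show "?c I \<sqinter>\<^bsub>N\<^esub> ?c J \<sqsubseteq>\<^bsub>N\<^esub> ?c (I \<inter> J)"
      unfolding copairing_def[of N f g J]
    proof (rule N.meet_Sup_le[OF tc[OF J] cc[OF I] cc[OF IJ]])
      fix u assume "u \<in> ?t ` J"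
      then obtain a b where ab: "(a, b) \<in> J" "u = f a \<sqinter>\<^bsub>N\<^esub> g b" by auto
      have abc: "a \<in> carrier L" "b \<in> carrier M" using ic[OF J ab(1)] by auto
      have uc: "u \<in> carrier N" unfolding ab(2) using abc f(1) g(1) by simp
      have "u \<sqinter>\<^bsub>N\<^esub> \<Squnion>\<^bsub>N\<^esub>(?t ` I) \<sqsubseteq>\<^bsub>N\<^esub> ?c (I \<inter> J)"
      proof (rule N.meet_Sup_le[OF tc[OF I] uc cc[OF IJ]])
        fix v assume "v \<in> ?t ` I"
        then obtain x y where xy: "(x, y) \<in> I" "v = f x \<sqinter>\<^bsub>N\<^esub> g y" by auto
        have xyc: "x \<in> carrier L" "y \<in> carrier M" using ic[OF I xy(1)] by auto
        have m: "(a \<sqinter>\<^bsub>L\<^esub> x, b \<sqinter>\<^bsub>M\<^esub> y) \<in> I \<inter> J"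
          using coprod_idealD(2)[OF I xy(1), of "a \<sqinter>\<^bsub>L\<^esub> x" "b \<sqinter>\<^bsub>M\<^esub> y"]
            coprod_idealD(2)[OF J ab(1), of "a \<sqinter>\<^bsub>L\<^esub> x" "b \<sqinter>\<^bsub>M\<^esub> y"] abc xyc
            L.meet_left[of a x] L.meet_right[of a x] M.meet_left[of b y] M.meet_right[of b y]
          by simp
        have fc: "f a \<in> carrier N" "f x \<in> carrier N" "g b \<in> carrier N" "g y \<in> carrier N"
          using abc xyc f(1) g(1) by auto
        have "u \<sqinter>\<^bsub>N\<^esub> v = (f a \<sqinter>\<^bsub>N\<^esub> f x) \<sqinter>\<^bsub>N\<^esub> (g b \<sqinter>\<^bsub>N\<^esub> g y)"
          unfolding ab(2) xy(2) using fc
          by (metis N.meet_assoc N.meet_closed N.meet_commute)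
        also have "\<dots> = f (a \<sqinter>\<^bsub>L\<^esub> x) \<sqinter>\<^bsub>N\<^esub> g (b \<sqinter>\<^bsub>M\<^esub> y)"
          using abc xyc by (simp add: f(4) g(4))
        also have "\<dots> \<sqsubseteq>\<^bsub>N\<^esub> ?c (I \<inter> J)" by (rule up[OF IJ m])
        finally show "u \<sqinter>\<^bsub>N\<^esub> v \<sqsubseteq>\<^bsub>N\<^esub> ?c (I \<inter> J)" .
      qed
      then show "?c I \<sqinter>\<^bsub>N\<^esub> u \<sqsubseteq>\<^bsub>N\<^esub> ?c (I \<inter> J)"
        unfolding copairing_def[of N f g I] N.meet_commute[of u] .
    qed
  qed
  have ctop: "?c \<top>\<^bsub>K\<^esub> = \<top>\<^bsub>N\<^esub>"
    using cl[of "\<top>\<^bsub>L\<^esub>"] frame_homD(3)[OF inl_hom] f(3) by simp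
  show "?c \<in> frame_hom K N"
    unfolding frame_hom_def using cSup cmeet ctop cc by auto
  show "h I = ?c I"
    if h: "h \<in> frame_hom K N" "\<And>a. a \<in> carrier L \<Longrightarrow> h (\<iota> a) = f a"
      "\<And>b. b \<in> carrier M \<Longrightarrow> h (\<kappa> b) = g b" "I \<in> carrier K" for h I
  proof -
    have I: "ideal I" using h(4) by simp
    note hh = frame_homD[OF h(1)]
    have "(\<lambda>(a, b). \<iota> a \<sqinter>\<^bsub>K\<^esub> \<kappa> b) ` I \<subseteq> carrier K"
      using ideal_Int inl_ideal inr_ideal ic[OF I] by (auto simp: K_meet)
    then have "h (\<Squnion>\<^bsub>K\<^esub>((\<lambda>(a, b). \<iota> a \<sqinter>\<^bsub>K\<^esub> \<kappa> b) ` I)) =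
        \<Squnion>\<^bsub>N\<^esub>(h ` (\<lambda>(a, b). \<iota> a \<sqinter>\<^bsub>K\<^esub> \<kappa> b) ` I)" by (rule hh(2))
    also have "h ` (\<lambda>(a, b). \<iota> a \<sqinter>\<^bsub>K\<^esub> \<kappa> b) ` I = ?t ` I"
      unfolding image_image
    proof (rule image_cong[OF refl])
      fix p assume p: "p \<in> I"
      obtain a b where ab: "p = (a, b)" by (cases p)
      have abc: "a \<in> carrier L" "b \<in> carrier M" using ic[OF I] p ab by auto
      show "h (case p of (a, b) \<Rightarrow> \<iota> a \<sqinter>\<^bsub>K\<^esub> \<kappa> b) = ?t p"
        unfolding ab by (simp add: hh(4) inl_ideal inr_ideal abc h(2,3))
    qed
    finally show ?thesis unfolding ideal_as_Sup[OF I, symmetric] copairing_def .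
  qed
qed

subsection \<open>Biframes and bispaces\<close>

lemma is_biframeD:
  assumes "is_biframe \<L>"
  shows "frame (bf_pos \<L>)" "frame (bf_neg \<L>)" "frame (bf_main \<L>)"
    "bf_epos \<L> \<in> frame_hom (bf_pos \<L>) (bf_main \<L>)" "inj_on (bf_epos \<L>) (carrier (bf_pos \<L>))"
    "bf_eneg \<L> \<in> frame_hom (bf_neg \<L>) (bf_main \<L>)" "inj_on (bf_eneg \<L>) (carrier (bf_neg \<L>))"
    "\<And>x. x \<in> carrier (bf_main \<L>) \<Longrightarrow> \<exists>A \<subseteq> bf_rectangles \<L>. x = \<Squnion>\<^bsub>bf_main \<L>\<^esub>A"
  using assms unfolding is_biframe_def by simp_all

lemma canonical_surjection:
  assumes "is_biframe \<L>"
  shows "canonical_surjection \<L> \<in> frame_hom (frame_coprod (bf_pos \<L>) (bf_neg \<L>)) (bf_main \<L>)"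
    "\<And>x. x \<in> carrier (bf_pos \<L>) \<Longrightarrow>
       canonical_surjection \<L> (coprod_inl (bf_pos \<L>) (bf_neg \<L>) x) = bf_epos \<L> x"
    "\<And>y. y \<in> carrier (bf_neg \<L>) \<Longrightarrow>
       canonical_surjection \<L> (coprod_inr (bf_pos \<L>) (bf_neg \<L>) y) = bf_eneg \<L> y"
    "canonical_surjection \<L> ` carrier (frame_coprod (bf_pos \<L>) (bf_neg \<L>)) = carrier (bf_main \<L>)"
proof -
  note b = is_biframeD[OF assms]
  let ?K = "frame_coprod (bf_pos \<L>) (bf_neg \<L>)"
  let ?i = "coprod_inl (bf_pos \<L>) (bf_neg \<L>)" and ?j = "coprod_inr (bf_pos \<L>) (bf_neg \<L>)"
  note k = frame_coprod_frame[OF b(1,2)]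
  interpret K: frame ?K by (rule k)
  note u = frame_coprod_universal[OF b(1,2,3,4,6), folded canonical_surjection_def]
  show c: "canonical_surjection \<L> \<in> frame_hom ?K (bf_main \<L>)" by (rule u(1))
  show l: "canonical_surjection \<L> (?i x) = bf_epos \<L> x" if "x \<in> carrier (bf_pos \<L>)" for x
    by (rule u(2)[OF that])
  show r: "canonical_surjection \<L> (?j y) = bf_eneg \<L> y" if "y \<in> carrier (bf_neg \<L>)" for y
    by (rule u(3)[OF that])
  note cd = frame_homD[OF c]
  note ic = frame_homD(1)[OF k(2)] and jc = frame_homD(1)[OF k(3)]
  let ?T = "{?i x \<sqinter>\<^bsub>?K\<^esub> ?j y | x y. x \<in> carrier (bf_pos \<L>) \<and> y \<in> carrier (bf_neg \<L>)}"
  have T: "?T \<subseteq> carrier ?K" using ic jc by auto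
  have rect: "bf_rectangles \<L> \<subseteq> canonical_surjection \<L> ` ?T"
  proof
    fix z assume "z \<in> bf_rectangles \<L>"
    then obtain x y where xy: "x \<in> carrier (bf_pos \<L>)" "y \<in> carrier (bf_neg \<L>)"
        "z = bf_epos \<L> x \<sqinter>\<^bsub>bf_main \<L>\<^esub> bf_eneg \<L> y"
      unfolding bf_rectangles_def by blast
    have "z = canonical_surjection \<L> (?i x \<sqinter>\<^bsub>?K\<^esub> ?j y)"
      using xy by (simp add: cd(4)[OF ic jc] l r)
    then show "z \<in> canonical_surjection \<L> ` ?T" using xy(1,2) by blast
  qed
  show "canonical_surjection \<L> ` carrier ?K = carrier (bf_main \<L>)"
  proof
    show "canonical_surjection \<L> ` carrier ?K \<subseteq> carrier (bf_main \<L>)" using cd(1) by auto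
    show "carrier (bf_main \<L>) \<subseteq> canonical_surjection \<L> ` carrier ?K"
    proof
      fix z assume z: "z \<in> carrier (bf_main \<L>)"
      obtain A where A: "A \<subseteq> bf_rectangles \<L>" "z = \<Squnion>\<^bsub>bf_main \<L>\<^esub>A"
        using b(8)[OF z] by (elim exE conjE)
      obtain B where B: "B \<subseteq> ?T" "A = canonical_surjection \<L> ` B"
        by (rule subset_imageE[OF order_trans[OF A(1) rect]])
      have "z = canonical_surjection \<L> (\<Squnion>\<^bsub>?K\<^esub>B)" using A(2) B cd(2)[of B] T by simp
      moreover have "\<Squnion>\<^bsub>?K\<^esub>B \<in> carrier ?K" by (rule K.Sup_closed) (use B(1) T in blast)
      ultimately show "z \<in> canonical_surjection \<L> ` carrier ?K" by blast
    qed
  qed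
qed

lemma coprod_as_Sup_rectangles:
  assumes "frame L" "frame M" "I \<in> carrier (frame_coprod L M)"
  shows "\<exists>A \<subseteq> {coprod_inl L M x \<sqinter>\<^bsub>frame_coprod L M\<^esub> coprod_inr L M y | x y.
      x \<in> carrier L \<and> y \<in> carrier M}. I = \<Squnion>\<^bsub>frame_coprod L M\<^esub>A"
proof -
  interpret frame_pair L M using assms by (simp add: frame_pair_def)
  have I: "ideal I" using assms(3) by simp
  have "(\<lambda>(a, b). \<iota> a \<sqinter>\<^bsub>K\<^esub> \<kappa> b) ` I \<subseteq>
      {\<iota> x \<sqinter>\<^bsub>K\<^esub> \<kappa> y | x y. x \<in> carrier L \<and> y \<in> carrier M}"
    using coprod_idealD(1)[OF I] by fast
  then show ?thesis using ideal_as_Sup[OF I] by blast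
qed

lemma coprod_biframe_is_biframe:
  assumes "is_biframe \<L>"
  shows "is_biframe (coprod_biframe \<L>)"
proof -
  note b = is_biframeD[OF assms]
  note k = frame_coprod_frame[OF b(1,2)]
  note c = canonical_surjection[OF assms]
  have "inj_on (coprod_inl (bf_pos \<L>) (bf_neg \<L>)) (carrier (bf_pos \<L>))"
    using b(5) c(2) unfolding inj_on_def by metis
  moreover have "inj_on (coprod_inr (bf_pos \<L>) (bf_neg \<L>)) (carrier (bf_neg \<L>))"
    using b(7) c(3) unfolding inj_on_def by metis
  ultimately show ?thesis
    unfolding is_biframe_def bf_rectangles_def
    using b(1,2) k coprod_as_Sup_rectangles[OF b(1,2)]
    by (simp add: coprod_biframe_def)
qed

lemma patch_openin:
  "openin (bs_pos X) U \<Longrightarrow> openin (patch X) U" "openin (bs_neg X) U \<Longrightarrow> openin (patch X) U"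
  unfolding patch_def by (auto intro: topology_generated_by_Basis)

lemma topspace_patch: "topspace (patch X) = topspace (bs_pos X) \<union> topspace (bs_neg X)"
  unfolding patch_def topology_generated_by_topspace by (auto dest: openin_subset)

lemma opens_inclusion_hom:
  assumes "\<And>U. openin S U \<Longrightarrow> openin T U" "topspace S = topspace T"
  shows "(\<lambda>U. U) \<in> frame_hom (opens_frame S) (opens_frame T)"
proof -
  have "\<Squnion>\<^bsub>opens_frame S\<^esub>A = \<Squnion>\<^bsub>opens_frame T\<^esub>A" if "A \<subseteq> {U. openin S U}" for A
  proof -
    have "openin S U" "openin T U" if "U \<in> A" for U using that \<open>A \<subseteq> _\<close> assms(1) by auto
    then show ?thesis using opens_Sup(2)[of A S] opens_Sup(2)[of A T] by simp
  qed
  then show ?thesis unfolding frame_hom_def using assms by (auto simp: opens_top opens_meet)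
qed

lemma fin_relation_carrier:
  fixes X :: "'x bispace"
  defines "K \<equiv> frame_coprod (opens_frame (bs_pos X)) (opens_frame (bs_neg X))"
  shows "fin_relation X \<subseteq> carrier K \<times> carrier K"
proof -
  note k = frame_coprod_frame[OF opens_frame[of "bs_pos X"] opens_frame[of "bs_neg X"], folded K_def]
  interpret K: frame K by (rule k)
  show ?thesis
    unfolding fin_relation_def Let_def K_def[symmetric]
    using frame_homD(1)[OF k(2)] frame_homD(1)[OF k(3)] by auto
qed

lemma bOmega_fin_is_biframe:
  fixes X :: "'x bispace"
  assumes X: "is_bispace X"
  shows "is_biframe (bOmega_fin X)"
proof -
  define P where "P = opens_frame (bs_pos X)"
  define N where "N = opens_frame (bs_neg X)"
  define K where "K = frame_coprod P N"
  define R where "R = fin_relation X"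
  define T where "T = opens_frame (patch X)"
  define i where "i = coprod_inl P N"
  define j where "j = coprod_inr P N"
  define q where "q = quotient_proj K R"
  define Q where "Q = frame_quotient K R"
  have P: "frame P" and N: "frame N" and T: "frame T"
    unfolding P_def N_def T_def by (rule opens_frame)+
  have Pc: "U \<in> carrier P \<longleftrightarrow> openin (bs_pos X) U" and Nc: "U \<in> carrier N \<longleftrightarrow> openin (bs_neg X) U"
    for U unfolding P_def N_def by simp_all
  note k = frame_coprod_frame[OF P N, folded K_def i_def j_def]
  have R: "R \<subseteq> carrier K \<times> carrier K"
    unfolding R_def K_def P_def N_def by (rule fin_relation_carrier)
  note qq = quotient_proj_hom[OF k(1) R, folded q_def Q_def]
  interpret K: frame K by (rule k)
  note ih = frame_homD[OF k(2)] and jh = frame_homD[OF k(3)] and qh = frame_homD[OF qq(2)]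
  have eq: "bOmega_fin X = \<lparr>bf_pos = P, bf_neg = N, bf_main = Q,
      bf_epos = (\<lambda>U. q (i U)), bf_eneg = (\<lambda>U. q (j U))\<rparr>"
    unfolding bOmega_fin_def Let_def P_def N_def K_def R_def i_def j_def q_def Q_def by simp
  have tp: "topspace (patch X) = topspace (bs_pos X)" "topspace (patch X) = topspace (bs_neg X)"
    using X unfolding topspace_patch is_bispace_def by auto
  have pT: "(\<lambda>U. U) \<in> frame_hom P T" unfolding P_def T_def
    by (rule opens_inclusion_hom) (simp_all add: patch_openin tp(1))
  have nT: "(\<lambda>U. U) \<in> frame_hom N T" unfolding N_def T_def
    by (rule opens_inclusion_hom) (simp_all add: patch_openin tp(2)[symmetric])
  define c where "c = copairing T (\<lambda>U. U) (\<lambda>U. U :: 'x set)"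
  note u = frame_coprod_universal[OF P N T pT nT, folded K_def i_def j_def c_def]
  note ch = frame_homD[OF u(1)]
  have cR: "c a \<sqsubseteq>\<^bsub>T\<^esub> c b" if ab: "(a, b) \<in> R" for a b
  proof -
    obtain U U' V V' where h: "a = i U \<sqinter>\<^bsub>K\<^esub> j U'" "b = i V \<squnion>\<^bsub>K\<^esub> j V'"
      "U \<in> carrier P" "V \<in> carrier P" "U' \<in> carrier N" "V' \<in> carrier N" "U \<inter> U' \<subseteq> V \<union> V'"
      using ab unfolding R_def fin_relation_def Let_def i_def j_def K_def P_def N_def by blast
    have op: "openin (patch X) U" "openin (patch X) U'" "openin (patch X) V" "openin (patch X) V'"
      using h(3-6) unfolding Pc Nc by (simp_all add: patch_openin)
    have "c a = U \<inter> U'"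
      unfolding h(1) ch(4)[OF ih(1)[OF h(3)] jh(1)[OF h(5)]] u(2)[OF h(3)] u(3)[OF h(5)]
      unfolding T_def by (rule opens_meet[OF op(1,2)])
    moreover have "c b = V \<union> V'"
    proof -
      have "c b = \<Squnion>\<^bsub>T\<^esub>{V, V'}"
        unfolding h(2) join_def using ch(2)[of "{i V, j V'}"] ih(1)[OF h(4)] jh(1)[OF h(6)]
          u(2)[OF h(4)] u(3)[OF h(6)] by simp
      also have "\<dots> = \<Union>{V, V'}" unfolding T_def by (rule opens_Sup(2)) (use op in auto)
      finally show ?thesis by simp
    qed
    ultimately show ?thesis using h(7) unfolding T_def opens_frame_def by simp
  qed
  obtain g where g: "\<And>a. a \<in> carrier K \<Longrightarrow> g (q a) = c a"
    using frame_quotient_universal(1)[OF k(1) T R u(1) cR] unfolding q_def by blast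
  have gi: "g (q (i U)) = U" if "U \<in> carrier P" for U using g[OF ih(1)[OF that]] u(2)[OF that] by simp
  have gj: "g (q (j U)) = U" if "U \<in> carrier N" for U using g[OF jh(1)[OF that]] u(3)[OF that] by simp
  have inj: "inj_on (\<lambda>U. q (i U)) (carrier P)" "inj_on (\<lambda>U. q (j U)) (carrier N)"
    unfolding inj_on_def using gi gj by metis+
  have rect: "\<exists>A \<subseteq> {q (i x) \<sqinter>\<^bsub>Q\<^esub> q (j y) | x y. x \<in> carrier P \<and> y \<in> carrier N}. z = \<Squnion>\<^bsub>Q\<^esub>A"
    if "z \<in> carrier Q" for z
  proof -
    obtain I where I: "I \<in> carrier K" "z = q I" using \<open>z \<in> carrier Q\<close> unfolding qq(3)[symmetric] by blast
    obtain A where A: "A \<subseteq> {i x \<sqinter>\<^bsub>K\<^esub> j y | x y. x \<in> carrier P \<and> y \<in> carrier N}" "I = \<Squnion>\<^bsub>K\<^esub>A"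
      using coprod_as_Sup_rectangles[OF P N, of I] I(1) unfolding K_def i_def j_def by blast
    have Ac: "A \<subseteq> carrier K" using A(1) ih(1) jh(1) by auto
    have "z = \<Squnion>\<^bsub>Q\<^esub>(q ` A)" unfolding I(2) A(2) by (rule qh(2)[OF Ac])
    moreover have "q ` A \<subseteq> {q (i x) \<sqinter>\<^bsub>Q\<^esub> q (j y) | x y. x \<in> carrier P \<and> y \<in> carrier N}"
    proof
      fix w assume "w \<in> q ` A"
      then obtain x y where xy: "x \<in> carrier P" "y \<in> carrier N" "w = q (i x \<sqinter>\<^bsub>K\<^esub> j y)"
        using A(1) by blast
      then have "w = q (i x) \<sqinter>\<^bsub>Q\<^esub> q (j y)" using qh(4)[OF ih(1) jh(1)] by simp
      then show "w \<in> {q (i x) \<sqinter>\<^bsub>Q\<^esub> q (j y) | x y. x \<in> carrier P \<and> y \<in> carrier N}"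
        using xy(1,2) by blast
    qed
    ultimately show ?thesis by blast
  qed
  show ?thesis
    unfolding eq is_biframe_def bf_rectangles_def
    using P N qq(1) frame_hom_comp[OF k(2) qq(2)] frame_hom_comp[OF k(3) qq(2)] inj rect by simp
qed

lemma istopology_points:
  assumes "frame P" "\<And>f. f \<in> F \<Longrightarrow> s f \<in> frame_hom P two"
  shows "istopology (\<lambda>U. \<exists>a \<in> carrier P. U = {f \<in> F. s f a})"
proof -
  interpret P: frame P by fact
  note s = frame_homD[OF assms(2)]
  show ?thesis unfolding istopology_def
  proof (intro conjI allI impI)
    fix S T assume "\<exists>a \<in> carrier P. S = {f \<in> F. s f a}" "\<exists>a \<in> carrier P. T = {f \<in> F. s f a}"
    then obtain a b where ab: "a \<in> carrier P" "b \<in> carrier P" "S = {f \<in> F. s f a}" "T = {f \<in> F. s f b}"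
      by blast
    have "S \<inter> T = {f \<in> F. s f (a \<sqinter>\<^bsub>P\<^esub> b)}" unfolding ab(3,4) using s(4)[OF _ ab(1,2)] by auto
    then show "\<exists>a \<in> carrier P. S \<inter> T = {f \<in> F. s f a}"
      by (rule bexI[OF _ P.meet_closed[OF ab(1,2)]])
  next
    fix \<K> assume k: "\<forall>S \<in> \<K>. \<exists>a \<in> carrier P. S = {f \<in> F. s f a}"
    define A where "A = {a \<in> carrier P. {f \<in> F. s f a} \<in> \<K>}"
    have A: "A \<subseteq> carrier P" unfolding A_def by blast
    have "\<K> = (\<lambda>a. {f \<in> F. s f a}) ` A"
    proof
      show "(\<lambda>a. {f \<in> F. s f a}) ` A \<subseteq> \<K>" unfolding A_def by (rule image_subsetI) simp
      show "\<K> \<subseteq> (\<lambda>a. {f \<in> F. s f a}) ` A"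
      proof
        fix S assume S: "S \<in> \<K>"
        obtain a where a: "a \<in> carrier P" "S = {f \<in> F. s f a}" using bspec[OF k S] by (elim bexE)
        have "a \<in> A" using S a unfolding A_def by simp
        then show "S \<in> (\<lambda>a. {f \<in> F. s f a}) ` A" unfolding a(2) by (rule imageI)
      qed
    qed
    moreover have "s f (\<Squnion>\<^bsub>P\<^esub>A) \<longleftrightarrow> (\<exists>a \<in> A. s f a)" if "f \<in> F" for f
      using s(2)[OF that A] by (simp add: image_iff)
    ultimately have "\<Union>\<K> = {f \<in> F. s f (\<Squnion>\<^bsub>P\<^esub>A)}" by auto
    then show "\<exists>a \<in> carrier P. \<Union>\<K> = {f \<in> F. s f a}" by (rule bexI[OF _ P.Sup_closed[OF A]])
  qed
qed

lemma bpoints_hom: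
  assumes "f \<in> bpoints \<L>"
  shows "fst f \<in> frame_hom (bf_pos \<L>) two" "snd f \<in> frame_hom (bf_neg \<L>) two"
  using assms unfolding bpoints_def biframe_maps_def two_biframe_def by auto

lemma openin_bpt_pos:
  assumes "is_biframe \<L>"
  shows "openin (bs_pos (bpt \<L>)) U \<longleftrightarrow> (\<exists>a \<in> carrier (bf_pos \<L>). U = {f \<in> bpoints \<L>. fst f a})"
  using topology_inverse'[OF istopology_points[where F = "bpoints \<L>" and s = fst,
      OF is_biframeD(1)[OF assms] bpoints_hom(1)]]
  by (simp add: bpt_def)

lemma openin_bpt_neg:
  assumes "is_biframe \<L>"
  shows "openin (bs_neg (bpt \<L>)) U \<longleftrightarrow> (\<exists>a \<in> carrier (bf_neg \<L>). U = {f \<in> bpoints \<L>. snd f a})"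
  using topology_inverse'[OF istopology_points[where F = "bpoints \<L>" and s = snd,
      OF is_biframeD(2)[OF assms] bpoints_hom(2)]]
  by (simp add: bpt_def)

lemma topspace_bpt:
  assumes "is_biframe \<L>"
  shows "topspace (bs_pos (bpt \<L>)) = bpoints \<L>" "topspace (bs_neg (bpt \<L>)) = bpoints \<L>"
proof -
  interpret P: frame "bf_pos \<L>" by (rule is_biframeD(1)[OF assms])
  interpret N: frame "bf_neg \<L>" by (rule is_biframeD(2)[OF assms])
  have "bpoints \<L> = {f \<in> bpoints \<L>. fst f \<top>\<^bsub>bf_pos \<L>\<^esub>}"
    using frame_homD(3)[OF bpoints_hom(1)] by auto
  then have "openin (bs_pos (bpt \<L>)) (bpoints \<L>)" unfolding openin_bpt_pos[OF assms] by blast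
  then have 1: "bpoints \<L> \<subseteq> topspace (bs_pos (bpt \<L>))" by (rule openin_subset)
  obtain a where "topspace (bs_pos (bpt \<L>)) = {f \<in> bpoints \<L>. fst f a}"
    using openin_topspace[of "bs_pos (bpt \<L>)"] unfolding openin_bpt_pos[OF assms] by (elim bexE)
  then have "topspace (bs_pos (bpt \<L>)) \<subseteq> bpoints \<L>" by simp
  then show "topspace (bs_pos (bpt \<L>)) = bpoints \<L>" using 1 by (rule equalityI)
  have "bpoints \<L> = {f \<in> bpoints \<L>. snd f \<top>\<^bsub>bf_neg \<L>\<^esub>}"
    using frame_homD(3)[OF bpoints_hom(2)] by auto
  then have "openin (bs_neg (bpt \<L>)) (bpoints \<L>)" unfolding openin_bpt_neg[OF assms] by blast
  then have 1: "bpoints \<L> \<subseteq> topspace (bs_neg (bpt \<L>))" by (rule openin_subset)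
  obtain a where "topspace (bs_neg (bpt \<L>)) = {f \<in> bpoints \<L>. snd f a}"
    using openin_topspace[of "bs_neg (bpt \<L>)"] unfolding openin_bpt_neg[OF assms] by (elim bexE)
  then have "topspace (bs_neg (bpt \<L>)) \<subseteq> bpoints \<L>" by simp
  then show "topspace (bs_neg (bpt \<L>)) = bpoints \<L>" using 1 by (rule equalityI)
qed

lemma is_bispace_bpt: "is_biframe \<L> \<Longrightarrow> is_bispace (bpt \<L>)"
  by (simp add: is_bispace_def topspace_bpt)

lemma is_bispace_bisubspace: "is_bispace X \<Longrightarrow> is_bispace (bisubspace X S)"
  by (simp add: is_bispace_def bisubspace_def)

lemma topspace_Sk:
  assumes "is_bispace X"
  shows "topspace (bs_pos (Sk X)) = bs_points X" "topspace (bs_neg (Sk X)) = bs_points X"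
proof -
  have e: "topspace (bs_neg X) = topspace (bs_pos X)" using assms by (simp add: is_bispace_def)
  have u: "\<Union>({U. openin S U} \<union> {F. closedin T F}) = topspace S" if "topspace T = topspace S"
    for S T :: "'a topology"
  proof
    show "\<Union>({U. openin S U} \<union> {F. closedin T F}) \<subseteq> topspace S"
    proof (rule Union_least)
      fix U assume "U \<in> {U. openin S U} \<union> {F. closedin T F}"
      then show "U \<subseteq> topspace S"
        using openin_subset[of S U] closedin_subset[of T U] that by (elim UnE) simp_all
    qed
    show "topspace S \<subseteq> \<Union>({U. openin S U} \<union> {F. closedin T F})"
      by (rule Union_upper) simp
  qed
  show "topspace (bs_pos (Sk X)) = bs_points X"
    unfolding Sk_def bs_points_def bispace.simps topology_generated_by_topspace u[OF e] by (rule refl)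
  show "topspace (bs_neg (Sk X)) = bs_points X"
    unfolding Sk_def bs_points_def bispace.simps topology_generated_by_topspace u[OF e[symmetric]]
    by (rule e)
qed

end

theory Submission
  imports Defs
begin

text \<open>
  A point of \<open>bOmega_fin Y\<close> is a pair of completely prime filters \<open>p\<close>, \<open>q\<close> of positive and negative
  opens such that \<open>U \<inter> U' \<subseteq> V \<union> V'\<close>, \<open>p U\<close> and \<open>q U'\<close> imply \<open>p V\<close> or \<open>q V'\<close>. The sets
  \<open>U \<inter> U' - (V \<union> V')\<close> form a basis of the Skula patch topology. Hence a point \<open>x\<close> of the Skula patch
  closure of \<open>S\<close> induces a well-defined point of \<open>bOmega_fin\<close> of the bisubspace \<open>S\<close>, so that bisober
  bisubspaces are closed. Conversely a point \<open>(p, q)\<close> of \<open>bOmega_fin\<close> of the bisubspace \<open>S\<close> pulls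
  back along the traces of the opens of \<open>bpt \<L>\<close> on \<open>S\<close> to a pair of maps into \<open>two\<close>, which is a
  bipoint of \<open>\<L>\<close> and lies in the Skula patch closure of \<open>S\<close>.
\<close>

section \<open>Frame maps into the two-element frame\<close>

text \<open>In \<open>two\<close> a join is true exactly when some member is, so frame maps into
  \<open>two\<close> are completely prime filters. This is the form in which points are handled
  below.\<close>

lemma frame_hom_two_iff:
  "f \<in> frame_hom L two \<longleftrightarrow>
     (\<forall>A \<subseteq> carrier L. f (\<Squnion>\<^bsub>L\<^esub>A) \<longleftrightarrow> (\<exists>a \<in> A. f a)) \<and> f \<top>\<^bsub>L\<^esub> \<and>
     (\<forall>x \<in> carrier L. \<forall>y \<in> carrier L. f (x \<sqinter>\<^bsub>L\<^esub> y) \<longleftrightarrow> f x \<and> f y)"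
  unfolding frame_hom_def by (simp add: image_iff)

lemma frame_hom_two_Sup:
  "\<lbrakk>f \<in> frame_hom L two; A \<subseteq> carrier L\<rbrakk> \<Longrightarrow> f (\<Squnion>\<^bsub>L\<^esub>A) \<longleftrightarrow> (\<exists>a \<in> A. f a)"
  unfolding frame_hom_two_iff by simp

text \<open>Components of biframe maps must be extensional. Restricting is harmless because joins,
  meets and the top stay in the carrier.\<close>

lemma frame_hom_two_restrict:
  assumes "frame L" "f \<in> frame_hom L two"
  shows "restrict f (carrier L) \<in> frame_hom L two"
proof -
  interpret frame L by fact
  have "(\<exists>a \<in> A. restrict f (carrier L) a) \<longleftrightarrow> (\<exists>a \<in> A. f a)" if "A \<subseteq> carrier L" for A
    using that by (auto simp: restrict_def)
  then show ?thesis using assms(2) unfolding frame_hom_two_iff by simp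
qed

text \<open>A point of the coproduct accepts an ideal as soon as it accepts one of its rectangles.
  Statements about the coproduct thus become statements about pairs \<open>(a, b)\<close>.\<close>

lemma copairing_two: "copairing two f g I \<longleftrightarrow> (\<exists>(a, b) \<in> I. f a \<and> g b)"
  unfolding copairing_def two_simps image_iff by (rule bex_cong[OF refl]) auto

text \<open>The homomorphism theorem: \<open>h\<close> picks preimages under the surjection
  \<open>q\<close>, and \<open>ker\<close> makes the choice irrelevant. It serves for the canonical
  surjection and for the trace maps onto the opens of a bisubspace.\<close>

lemma frame_hom_factor:
  assumes "q \<in> frame_hom K M" "q ` carrier K = carrier M" "c \<in> frame_hom K N" "frame K"
    and ker: "\<And>a b. \<lbrakk>a \<in> carrier K; b \<in> carrier K; q a = q b\<rbrakk> \<Longrightarrow> c a = c b"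
  shows "\<exists>h \<in> frame_hom M N. \<forall>a \<in> carrier K. h (q a) = c a"
proof -
  interpret K: frame K by fact
  note q = frame_homD[OF assms(1)] and c = frame_homD[OF assms(3)]
  define h where "h x = c (inv_into (carrier K) q x)" for x
  have hq: "h (q a) = c a" if "a \<in> carrier K" for a
    unfolding h_def
    by (rule ker) (use that in \<open>simp_all add: inv_into_into f_inv_into_f\<close>)
  have "h (\<Squnion>\<^bsub>M\<^esub>A) = \<Squnion>\<^bsub>N\<^esub>(h ` A)" if A: "A \<subseteq> carrier M" for A
  proof -
    \<comment> \<open>Lifting the whole set \<open>A\<close> to a set \<open>B\<close> of preimages
      reduces join preservation of \<open>h\<close> to that of \<open>q\<close> and
      \<open>c\<close>.\<close>
    obtain B where B: "B \<subseteq> carrier K" "A = q ` B"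
      using A unfolding assms(2)[symmetric] by (rule subset_imageE)
    have "h ` A = c ` B"
      unfolding B(2) image_image by (rule image_cong) (use B(1) hq in auto)
    then show ?thesis unfolding B(2) q(2)[OF B(1), symmetric] by (simp add: hq B(1) c(2))
  qed
  moreover have "h x \<in> carrier N" if "x \<in> carrier M" for x
    using that unfolding assms(2)[symmetric] by (auto simp: hq c(1))
  moreover have "h \<top>\<^bsub>M\<^esub> = \<top>\<^bsub>N\<^esub>" unfolding q(3)[symmetric] by (simp add: hq c(3))
  moreover have "h (x \<sqinter>\<^bsub>M\<^esub> y) = h x \<sqinter>\<^bsub>N\<^esub> h y" if xy: "x \<in> carrier M" "y \<in> carrier M" for x y
  proof -
    obtain a b where ab: "a \<in> carrier K" "b \<in> carrier K" "x = q a" "y = q b"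
      using xy unfolding assms(2)[symmetric] by blast
    show ?thesis
      unfolding ab(3,4) q(4)[OF ab(1,2), symmetric] using ab(1,2) by (simp add: hq c(4))
  qed
  ultimately have "h \<in> frame_hom M N" unfolding frame_hom_def by blast
  then show ?thesis using hq by blast
qed


section \<open>Bipoints\<close>

lemma bpoints_iff:
  "f \<in> bpoints \<L> \<longleftrightarrow>
     fst f \<in> frame_hom (bf_pos \<L>) two \<inter> extensional (carrier (bf_pos \<L>)) \<and>
     snd f \<in> frame_hom (bf_neg \<L>) two \<inter> extensional (carrier (bf_neg \<L>)) \<and>
     (\<exists>h \<in> frame_hom (bf_main \<L>) two.
        (\<forall>x \<in> carrier (bf_pos \<L>). h (bf_epos \<L> x) = fst f x) \<and>
        (\<forall>y \<in> carrier (bf_neg \<L>). h (bf_eneg \<L> y) = snd f y))"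
  unfolding bpoints_def biframe_maps_def two_biframe_def by (cases f) simp

lemma bpoint_eqI:
  assumes "f \<in> bpoints \<L>" "g \<in> bpoints \<L>"
    "\<And>a. a \<in> carrier (bf_pos \<L>) \<Longrightarrow> fst f a = fst g a"
    "\<And>b. b \<in> carrier (bf_neg \<L>) \<Longrightarrow> snd f b = snd g b"
  shows "f = g"
proof (rule prod_eqI)
  show "fst f = fst g"
    by (rule extensionalityI[of _ "carrier (bf_pos \<L>)"]) (use assms in \<open>simp_all add: bpoints_iff\<close>)
  show "snd f = snd g"
    by (rule extensionalityI[of _ "carrier (bf_neg \<L>)"]) (use assms in \<open>simp_all add: bpoints_iff\<close>)
qed

text \<open>Composing the main component \<open>h\<close> with the canonical surjection gives a
  frame map on the coproduct that extends both components of \<open>f\<close>. By uniqueness it is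
  their copairing, whose value therefore depends only on the image in the main frame.\<close>

lemma bpoints_kernel:
  assumes "is_biframe \<L>" "f \<in> bpoints \<L>" "(I, J) \<in> canonical_kernel \<L>"
  shows "(\<exists>(a, b) \<in> I. fst f a \<and> snd f b) \<longleftrightarrow> (\<exists>(a, b) \<in> J. fst f a \<and> snd f b)"
proof -
  note s = canonical_surjection[OF assms(1)]
  obtain h where h: "h \<in> frame_hom (bf_main \<L>) two"
    "\<And>x. x \<in> carrier (bf_pos \<L>) \<Longrightarrow> h (bf_epos \<L> x) = fst f x"
    "\<And>y. y \<in> carrier (bf_neg \<L>) \<Longrightarrow> h (bf_eneg \<L> y) = snd f y"
    using assms(2) unfolding bpoints_iff by blast
  note u = frame_coprod_universal(4)[OF is_biframeD(1,2)[OF assms(1)] two_frame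
      bpoints_hom[OF assms(2)] frame_hom_comp[OF s(1) h(1)]]
  have "h (canonical_surjection \<L> I) \<longleftrightarrow> (\<exists>(a, b) \<in> I. fst f a \<and> snd f b)"
    if "I \<in> carrier (frame_coprod (bf_pos \<L>) (bf_neg \<L>))" for I
    unfolding copairing_two[symmetric] by (rule u) (simp_all add: s h that)
  from this[of I] this[of J] show ?thesis using assms(3) unfolding canonical_kernel_def by simp
qed

text \<open>The converse of \<open>bpoints_kernel\<close>: a copairing that is constant on the
  fibres of the canonical surjection descends along it, and this supplies the main
  component.\<close>

lemma bpointsI:
  assumes "is_biframe \<L>"
    "p \<in> frame_hom (bf_pos \<L>) two" "q \<in> frame_hom (bf_neg \<L>) two"
    "p \<in> extensional (carrier (bf_pos \<L>))" "q \<in> extensional (carrier (bf_neg \<L>))"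
    and ker: "\<And>I J a b. \<lbrakk>(I, J) \<in> canonical_kernel \<L>; (a, b) \<in> I; p a; q b\<rbrakk> \<Longrightarrow>
        \<exists>(u, v) \<in> J. p u \<and> q v"
  shows "(p, q) \<in> bpoints \<L>"
proof -
  note s = canonical_surjection[OF assms(1)]
  note u = frame_coprod_universal[OF is_biframeD(1,2)[OF assms(1)] two_frame assms(2,3)]
  note k = frame_coprod_frame[OF is_biframeD(1,2)[OF assms(1)]]
  have "copairing two p q I = copairing two p q J"
    if "I \<in> carrier (frame_coprod (bf_pos \<L>) (bf_neg \<L>))"
      "J \<in> carrier (frame_coprod (bf_pos \<L>) (bf_neg \<L>))"
      "canonical_surjection \<L> I = canonical_surjection \<L> J" for I J
  proof -
    \<comment> \<open>The kernel is symmetric, so the one-sided \<open>ker\<close> gives both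
      implications.\<close>
    have "(I, J) \<in> canonical_kernel \<L>" "(J, I) \<in> canonical_kernel \<L>"
      using that unfolding canonical_kernel_def by simp_all
    from ker[OF this(1)] ker[OF this(2)] show ?thesis unfolding copairing_two by blast
  qed
  from frame_hom_factor[OF s(1,4) u(1) k(1) this]
  obtain h where h: "h \<in> frame_hom (bf_main \<L>) two"
    "\<And>I. I \<in> carrier (frame_coprod (bf_pos \<L>) (bf_neg \<L>)) \<Longrightarrow>
       h (canonical_surjection \<L> I) = copairing two p q I" by blast
  have "h (bf_epos \<L> x) = p x" if "x \<in> carrier (bf_pos \<L>)" for x
    using h(2)[OF frame_homD(1)[OF k(2) that]] s(2)[OF that] u(2)[OF that] by simp
  moreover have "h (bf_eneg \<L> y) = q y" if "y \<in> carrier (bf_neg \<L>)" for y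
    using h(2)[OF frame_homD(1)[OF k(3) that]] s(3)[OF that] u(3)[OF that] by simp
  ultimately show ?thesis unfolding bpoints_iff fst_conv snd_conv using assms(2-5) h(1) by blast
qed

section \<open>Bipoints of the finitary biframe of opens\<close>

lemma bOmega_fin_sel:
  "bf_pos (bOmega_fin X) = opens_frame (bs_pos X)"
  "bf_neg (bOmega_fin X) = opens_frame (bs_neg X)"
  by (simp_all add: bOmega_fin_def Let_def)

text \<open>Two universal properties are chained: a pair of points extends uniquely to the
  coproduct, and the extension descends to the quotient exactly when it respects the inequalities in
  \<open>fin_relation X\<close>. Read in \<open>two\<close>, such an inequality is the implication
  in the last conjunct.\<close>

lemma bpoints_bOmega_fin_iff:
  "f \<in> bpoints (bOmega_fin X) \<longleftrightarrow>
     fst f \<in> frame_hom (opens_frame (bs_pos X)) two \<inter> extensional {U. openin (bs_pos X) U} \<and>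
     snd f \<in> frame_hom (opens_frame (bs_neg X)) two \<inter> extensional {U. openin (bs_neg X) U} \<and>
     (\<forall>U U' V V'. openin (bs_pos X) U \<longrightarrow> openin (bs_neg X) U' \<longrightarrow> openin (bs_pos X) V \<longrightarrow>
        openin (bs_neg X) V' \<longrightarrow> U \<inter> U' \<subseteq> V \<union> V' \<longrightarrow> fst f U \<longrightarrow> snd f U' \<longrightarrow>
        fst f V \<or> snd f V')"
    (is "_ \<longleftrightarrow> ?P \<and> ?N \<and> ?R")
proof -
  define P where "P = opens_frame (bs_pos X)"
  define N where "N = opens_frame (bs_neg X)"
  define K where "K = frame_coprod P N"
  define R where "R = fin_relation X"
  define i where "i = coprod_inl P N"
  define j where "j = coprod_inr P N"
  define \<pi> where "\<pi> = quotient_proj K R"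
  define Q where "Q = frame_quotient K R"
  have P: "frame P" and N: "frame N" unfolding P_def N_def by (rule opens_frame)+
  have Pc: "U \<in> carrier P \<longleftrightarrow> openin (bs_pos X) U" and Nc: "U \<in> carrier N \<longleftrightarrow> openin (bs_neg X) U"
    for U unfolding P_def N_def by simp_all
  note k = frame_coprod_frame[OF P N, folded K_def i_def j_def]
  interpret K: frame K by (rule k)
  note ih = frame_homD[OF k(2)] and jh = frame_homD[OF k(3)]
  have R: "R \<subseteq> carrier K \<times> carrier K"
    unfolding R_def K_def P_def N_def by (rule fin_relation_carrier)
  note \<pi> = quotient_proj_hom[OF k(1) R, folded \<pi>_def Q_def]
  have Riff: "(a, b) \<in> R \<longleftrightarrow> (\<exists>U U' V V'. a = i U \<sqinter>\<^bsub>K\<^esub> j U' \<and> b = i V \<squnion>\<^bsub>K\<^esub> j V' \<and>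
      U \<in> carrier P \<and> V \<in> carrier P \<and> U' \<in> carrier N \<and> V' \<in> carrier N \<and> U \<inter> U' \<subseteq> V \<union> V')"
    for a b unfolding R_def fin_relation_def Let_def i_def j_def K_def P_def N_def by auto
  have main: "bf_main (bOmega_fin X) = Q" "bf_epos (bOmega_fin X) = (\<lambda>U. \<pi> (i U))"
      "bf_eneg (bOmega_fin X) = (\<lambda>U. \<pi> (j U))"
    unfolding bOmega_fin_def Let_def P_def N_def K_def R_def i_def j_def \<pi>_def Q_def by simp_all
  have lhs: "f \<in> bpoints (bOmega_fin X) \<longleftrightarrow> ?P \<and> ?N \<and> (\<exists>h \<in> frame_hom Q two.
      (\<forall>U \<in> carrier P. h (\<pi> (i U)) = fst f U) \<and> (\<forall>U \<in> carrier N. h (\<pi> (j U)) = snd f U))"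
    unfolding bpoints_iff bOmega_fin_sel main P_def N_def by simp
  \<comment> \<open>Both directions need these values: \<open>c\<close> is first the composite of
    \<open>h\<close> with the quotient projection, then the copairing.\<close>
  have vals: "c (i U \<sqinter>\<^bsub>K\<^esub> j U') \<longleftrightarrow> fst f U \<and> snd f U'" "c (i U \<squnion>\<^bsub>K\<^esub> j U') \<longleftrightarrow> fst f U \<or> snd f U'"
    if "c \<in> frame_hom K two" "\<And>U. U \<in> carrier P \<Longrightarrow> c (i U) = fst f U"
      "\<And>U. U \<in> carrier N \<Longrightarrow> c (j U) = snd f U" "U \<in> carrier P" "U' \<in> carrier N" for c U U'
    using frame_homD(4)[OF that(1) ih(1)[OF that(4)] jh(1)[OF that(5)]]
      frame_homD(2)[OF that(1), of "{i U, j U'}"] ih(1)[OF that(4)] jh(1)[OF that(5)] that(2-5)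
    by (auto simp: join_def)
  have "(\<exists>h \<in> frame_hom Q two. (\<forall>U \<in> carrier P. h (\<pi> (i U)) = fst f U) \<and>
      (\<forall>U \<in> carrier N. h (\<pi> (j U)) = snd f U)) \<longleftrightarrow> ?R" if f: ?P ?N
  proof
    assume "\<exists>h \<in> frame_hom Q two. (\<forall>U \<in> carrier P. h (\<pi> (i U)) = fst f U) \<and>
      (\<forall>U \<in> carrier N. h (\<pi> (j U)) = snd f U)"
    then obtain h where h: "h \<in> frame_hom Q two" "\<And>U. U \<in> carrier P \<Longrightarrow> h (\<pi> (i U)) = fst f U"
      "\<And>U. U \<in> carrier N \<Longrightarrow> h (\<pi> (j U)) = snd f U" by blast
    note v = vals[OF frame_hom_comp[OF \<pi>(2) h(1)] h(2,3)]
    show ?R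
    proof (intro allI impI)
      fix U U' V V'
      assume o: "openin (bs_pos X) U" "openin (bs_neg X) U'" "openin (bs_pos X) V"
        "openin (bs_neg X) V'" "U \<inter> U' \<subseteq> V \<union> V'" "fst f U" "snd f U'"
      have r: "(i U \<sqinter>\<^bsub>K\<^esub> j U', i V \<squnion>\<^bsub>K\<^esub> j V') \<in> R" unfolding Riff Pc Nc using o(1-5) by blast
      then have c: "i U \<sqinter>\<^bsub>K\<^esub> j U' \<in> carrier K" "i V \<squnion>\<^bsub>K\<^esub> j V' \<in> carrier K" using R by auto
      have "h (\<pi> (i U \<sqinter>\<^bsub>K\<^esub> j U')) \<longrightarrow> h (\<pi> (i V \<squnion>\<^bsub>K\<^esub> j V'))"
        using frame_hom_mono[OF \<pi>(1) two_frame h(1) frame_homD(1)[OF \<pi>(2) c(1)]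
            frame_homD(1)[OF \<pi>(2) c(2)]]
          quotient_proj_le[OF k(1) R r, folded \<pi>_def Q_def] by simp
      then show "fst f V \<or> snd f V'" using v o by (simp add: Pc Nc)
    qed
  next
    assume r: ?R
    have ph: "fst f \<in> frame_hom P two" "snd f \<in> frame_hom N two"
      using f unfolding P_def N_def by blast+
    note u = frame_coprod_universal[OF P N two_frame ph, folded K_def i_def j_def]
    have "copairing two (fst f) (snd f) a \<sqsubseteq>\<^bsub>two\<^esub> copairing two (fst f) (snd f) b"
      if ab: "(a, b) \<in> R" for a b
    proof -
      obtain U U' V V' where h: "a = i U \<sqinter>\<^bsub>K\<^esub> j U'" "b = i V \<squnion>\<^bsub>K\<^esub> j V'"
        "U \<in> carrier P" "V \<in> carrier P" "U' \<in> carrier N" "V' \<in> carrier N" "U \<inter> U' \<subseteq> V \<union> V'"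
        using ab unfolding Riff by blast
      show ?thesis
        unfolding h(1,2) two_simps vals(1)[OF u(1-3) h(3,5), simplified]
          vals(2)[OF u(1-3) h(4,6), simplified]
        using r h(3-7) unfolding Pc Nc by blast
    qed
    from frame_quotient_universal(1)[OF k(1) two_frame R u(1) this]
    obtain h where h: "h \<in> frame_hom Q two"
      "\<And>a. a \<in> carrier K \<Longrightarrow> h (\<pi> a) = copairing two (fst f) (snd f) a"
      unfolding \<pi>_def Q_def by blast
    have "h (\<pi> (i U)) = fst f U" if "U \<in> carrier P" for U
      using h(2)[OF ih(1)[OF that]] u(2)[OF that] by simp
    moreover have "h (\<pi> (j U)) = snd f U" if "U \<in> carrier N" for U
      using h(2)[OF jh(1)[OF that]] u(3)[OF that] by simp
    ultimately show "\<exists>h \<in> frame_hom Q two. (\<forall>U \<in> carrier P. h (\<pi> (i U)) = fst f U) \<and>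
      (\<forall>U \<in> carrier N. h (\<pi> (j U)) = snd f U)" using h(1) by blast
  qed
  then show ?thesis unfolding lhs by blast
qed


section \<open>Bisobriety\<close>

lemma frame_hom_opens_twoI:
  assumes "\<And>A. (\<And>U. U \<in> A \<Longrightarrow> openin T U) \<Longrightarrow> p (\<Union>A) \<longleftrightarrow> (\<exists>U \<in> A. p U)" "p (topspace T)"
    "\<And>U V. \<lbrakk>openin T U; openin T V\<rbrakk> \<Longrightarrow> p (U \<inter> V) \<longleftrightarrow> p U \<and> p V"
  shows "p \<in> frame_hom (opens_frame T) two"
  unfolding frame_hom_two_iff using assms
  by (simp add: opens_top opens_meet opens_Sup(2) subset_iff)

text \<open>For neighbourhood filters the condition imposed by \<open>fin_relation X\<close> only
  says that a point of \<open>U \<inter> U'\<close> lies in \<open>V \<union> V'\<close>.\<close>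

lemma nbhd_point_in_bpoints:
  assumes "is_bispace X" "x \<in> bs_points X"
  shows "nbhd_point X x \<in> bpoints (bOmega_fin X)"
proof -
  have "restrict (\<lambda>U. x \<in> U) {U. openin T U} \<in> frame_hom (opens_frame T) two"
    if "x \<in> topspace T" for T
    by (rule frame_hom_opens_twoI) (use that in \<open>auto simp: openin_Union restrict_def\<close>)
  then show ?thesis
    using assms unfolding bpoints_bOmega_fin_iff nbhd_point_def is_bispace_def bs_points_def by auto
qed

text \<open>The opens of \<open>T\<close> are indexed by those of \<open>S\<close> through
  \<open>s\<close>, and \<open>h\<close> matches the two indexings, so the bijection transports one
  topology to the other. The instances of \<open>s\<close> are \<open>fst\<close> and
  \<open>snd\<close>.\<close>

lemma homeomorphic_map_by_basic_preimages:
  assumes "bij_betw h (topspace S) (topspace T)"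
    "\<And>W. openin T W \<longleftrightarrow> (\<exists>U. openin S U \<and> W = {y \<in> topspace T. s y U})"
    "\<And>x U. \<lbrakk>x \<in> topspace S; openin S U\<rbrakk> \<Longrightarrow> s (h x) U \<longleftrightarrow> x \<in> U"
  shows "homeomorphic_map S T h"
proof -
  have img: "h ` topspace S = topspace T" using assms(1) by (rule bij_betw_imp_surj_on)
  have "openin S {x \<in> topspace S. h x \<in> W} \<longleftrightarrow> openin T W" if W: "W \<subseteq> topspace T" for W
  proof
    assume o: "openin S {x \<in> topspace S. h x \<in> W}"
    have "W = {y \<in> topspace T. s y {x \<in> topspace S. h x \<in> W}}"
      using W assms(3)[OF _ o] unfolding img[symmetric] by auto
    then show "openin T W" unfolding assms(2) using o by blast
  next
    assume "openin T W"
    then obtain U where U: "openin S U" "W = {y \<in> topspace T. s y U}" unfolding assms(2) by blast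
    have "{x \<in> topspace S. h x \<in> W} = U"
      using openin_subset[OF U(1)] assms(3)[OF _ U(1)] img unfolding U(2) by auto
    then show "openin S {x \<in> topspace S. h x \<in> W}" using U(1) by simp
  qed
  then show ?thesis
    unfolding homeomorphic_map_def quotient_map_def using img assms(1) by (simp add: bij_betw_def)
qed

text \<open>The opens of the point bispace are indexed by the opens of \<open>X\<close> itself, so a
  bijective \<open>nbhd_point X\<close> is automatically a homeomorphism for both
  topologies.\<close>

lemma bisober_iff:
  assumes "is_bispace X"
  shows "bisober X \<longleftrightarrow> inj_on (nbhd_point X) (bs_points X) \<and>
    (\<forall>f \<in> bpoints (bOmega_fin X). \<exists>x \<in> bs_points X. nbhd_point X x = f)"
proof -
  note b = bOmega_fin_is_biframe[OF assms]
  have tn: "topspace (bs_neg X) = bs_points X" "topspace (bs_pos X) = bs_points X"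
    using assms by (simp_all add: is_bispace_def bs_points_def)
  have "bij_betw (nbhd_point X) (bs_points X) (bpoints (bOmega_fin X)) \<longleftrightarrow>
      inj_on (nbhd_point X) (bs_points X) \<and>
      (\<forall>f \<in> bpoints (bOmega_fin X). \<exists>x \<in> bs_points X. nbhd_point X x = f)"
    unfolding bij_betw_def set_eq_iff image_iff using nbhd_point_in_bpoints[OF assms] by metis
  moreover have "bisober X \<longleftrightarrow> bij_betw (nbhd_point X) (bs_points X) (bpoints (bOmega_fin X))"
  proof
    assume "bisober X"
    then have "homeomorphic_map (bs_pos X) (bs_pos (bpt (bOmega_fin X))) (nbhd_point X)"
      unfolding bisober_def bihomeomorphic_map_def by simp
    then show "bij_betw (nbhd_point X) (bs_points X) (bpoints (bOmega_fin X))"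
      unfolding homeomorphic_map_def quotient_map_def bij_betw_def
      by (simp add: topspace_bpt[OF b] tn)
  next
    assume bij: "bij_betw (nbhd_point X) (bs_points X) (bpoints (bOmega_fin X))"
    have "homeomorphic_map (bs_pos X) (bs_pos (bpt (bOmega_fin X))) (nbhd_point X)"
    proof (rule homeomorphic_map_by_basic_preimages[where s = fst])
      show "bij_betw (nbhd_point X) (topspace (bs_pos X)) (topspace (bs_pos (bpt (bOmega_fin X))))"
        using bij by (simp add: topspace_bpt[OF b] tn)
      show "fst (nbhd_point X x) U \<longleftrightarrow> x \<in> U" if "openin (bs_pos X) U" for x U
        using that by (simp add: nbhd_point_def)
    qed (simp add: openin_bpt_pos[OF b] topspace_bpt[OF b] bOmega_fin_sel)
    moreover have "homeomorphic_map (bs_neg X) (bs_neg (bpt (bOmega_fin X))) (nbhd_point X)"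
    proof (rule homeomorphic_map_by_basic_preimages[where s = snd])
      show "bij_betw (nbhd_point X) (topspace (bs_neg X)) (topspace (bs_neg (bpt (bOmega_fin X))))"
        using bij by (simp add: topspace_bpt[OF b] tn)
      show "snd (nbhd_point X x) U \<longleftrightarrow> x \<in> U" if "openin (bs_neg X) U" for x U
        using that by (simp add: nbhd_point_def)
    qed (simp add: openin_bpt_neg[OF b] topspace_bpt[OF b] bOmega_fin_sel)
    ultimately show "bisober X" unfolding bisober_def bihomeomorphic_map_def using assms by simp
  qed
  ultimately show ?thesis by simp
qed


section \<open>The Skula patch topology\<close>

text \<open>Induction on the generation of \<open>W\<close>: a union inherits neighbourhoods from
  its members, and closure of \<open>\<B>\<close> under binary intersections settles the
  intersection case.\<close>

lemma openin_topology_generated_by_refine: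
  assumes "openin (topology_generated_by \<S>) W" "x \<in> W"
    "\<And>S x. \<lbrakk>S \<in> \<S>; x \<in> S\<rbrakk> \<Longrightarrow> \<exists>B \<in> \<B>. x \<in> B \<and> B \<subseteq> S"
    "\<And>B C. \<lbrakk>B \<in> \<B>; C \<in> \<B>\<rbrakk> \<Longrightarrow> B \<inter> C \<in> \<B>"
  shows "\<exists>B \<in> \<B>. x \<in> B \<and> B \<subseteq> W"
proof -
  have "generate_topology_on \<S> W" using assms(1) by (simp add: openin_topology_generated_by_iff)
  then show ?thesis using assms(2)
  proof (induction arbitrary: x)
    case (Int a b)
    have x: "x \<in> a" "x \<in> b" using Int.prems by simp_all
    obtain B where B: "B \<in> \<B>" "x \<in> B" "B \<subseteq> a" using Int.IH(1)[OF x(1)] by (elim bexE conjE)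
    obtain C where C: "C \<in> \<B>" "x \<in> C" "C \<subseteq> b" using Int.IH(2)[OF x(2)] by (elim bexE conjE)
    show ?case by (rule bexI[OF _ assms(4)[OF B(1) C(1)]]) (use B C in blast)
  next
    case (UN K)
    obtain k where k: "k \<in> K" "x \<in> k" using UN.prems by (rule UnionE)
    obtain B where B: "B \<in> \<B>" "x \<in> B" "B \<subseteq> k" using UN.IH[OF k] by (elim bexE conjE)
    show ?case by (rule bexI[OF _ B(1)]) (use B k in blast)
  next
    case (Basis s)
    then show ?case by (rule assms(3))
  qed simp
qed

text \<open>Finite intersections of subbasic Skula sets of both signs collapse to this form. It
  mirrors \<open>fin_relation\<close>: such a set misses \<open>S\<close> exactly when the traces of
  the four opens on \<open>S\<close> satisfy the inclusion required there.\<close>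

definition Sk_basis :: "'x bispace \<Rightarrow> 'x set set" where
  "Sk_basis X = {U \<inter> U' - (V \<union> V') | U U' V V'. openin (bs_pos X) U \<and> openin (bs_neg X) U' \<and>
     openin (bs_pos X) V \<and> openin (bs_neg X) V'}"

lemma Sk_basisI:
  "\<lbrakk>openin (bs_pos X) U; openin (bs_neg X) U'; openin (bs_pos X) V; openin (bs_neg X) V'\<rbrakk> \<Longrightarrow>
    U \<inter> U' - (V \<union> V') \<in> Sk_basis X"
  unfolding Sk_basis_def by blast

lemma Sk_basis_Int:
  assumes "B \<in> Sk_basis X" "C \<in> Sk_basis X"
  shows "B \<inter> C \<in> Sk_basis X"
proof -
  obtain U U' V V' where B: "B = U \<inter> U' - (V \<union> V')" "openin (bs_pos X) U" "openin (bs_neg X) U'"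
    "openin (bs_pos X) V" "openin (bs_neg X) V'"
    using assms(1) unfolding Sk_basis_def by blast
  obtain W W' Z Z' where C: "C = W \<inter> W' - (Z \<union> Z')" "openin (bs_pos X) W" "openin (bs_neg X) W'"
    "openin (bs_pos X) Z" "openin (bs_neg X) Z'"
    using assms(2) unfolding Sk_basis_def by blast
  have "B \<inter> C = (U \<inter> W) \<inter> (U' \<inter> W') - ((V \<union> Z) \<union> (V' \<union> Z'))" unfolding B(1) C(1) by blast
  also have "\<dots> \<in> Sk_basis X" by (rule Sk_basisI) (use B C in auto)
  finally show ?thesis .
qed

text \<open>The topology is generated in two layers, first the two Skula topologies and then their
  patch, so the refinement lemma is applied once for each layer.\<close>

lemma openin_patch_Sk_iff:
  assumes "is_bispace X"
  shows "openin (patch (Sk X)) W \<longleftrightarrow> (\<forall>x \<in> W. \<exists>B \<in> Sk_basis X. x \<in> B \<and> B \<subseteq> W)"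
proof -
  let ?S = "{U. openin (bs_pos X) U} \<union> {F. closedin (bs_neg X) F}"
  let ?T = "{U. openin (bs_neg X) U} \<union> {F. closedin (bs_pos X) F}"
  have t: "topspace (bs_neg X) = topspace (bs_pos X)" using assms by (simp add: is_bispace_def)
  \<comment> \<open>Each of the four kinds of subbasic sets arises by filling the other places with
    the whole space or the empty set, which are open in both topologies.\<close>
  have sub: "S \<in> Sk_basis X" if S: "S \<in> ?S \<union> ?T" for S
  proof -
    have op: "openin (bs_pos X) (topspace (bs_pos X))" "openin (bs_neg X) (topspace (bs_pos X))"
      using openin_topspace[of "bs_pos X"] openin_topspace[of "bs_neg X"] by (simp_all add: t)
    consider "openin (bs_pos X) S" | "openin (bs_neg X) S" | "closedin (bs_pos X) S"
      | "closedin (bs_neg X) S" using S by blast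
    then show ?thesis
    proof cases
      case 1
      from Sk_basisI[OF this op(2) openin_empty openin_empty] openin_subset[OF 1]
      show ?thesis by (simp add: Int_absorb2)
    next
      case 2
      from Sk_basisI[OF op(1) this openin_empty openin_empty] openin_subset[OF 2]
      show ?thesis by (simp add: Int_absorb1 t)
    next
      case 3
      then have "openin (bs_pos X) (topspace (bs_pos X) - S)" "S \<subseteq> topspace (bs_pos X)"
        by (simp_all add: closedin_def)
      from Sk_basisI[OF op this(1) openin_empty] this(2)
      show ?thesis by (simp add: double_diff)
    next
      case 4
      then have "openin (bs_neg X) (topspace (bs_pos X) - S)" "S \<subseteq> topspace (bs_pos X)"
        by (simp_all add: closedin_def t)
      from Sk_basisI[OF op openin_empty this(1)] this(2)
      show ?thesis by (simp add: double_diff)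
    qed
  qed
  have gen: "openin (patch (Sk X)) S" if "S \<in> ?S \<union> ?T" for S
    using that patch_openin[of "Sk X" S]
    by (auto simp: Sk_def intro: topology_generated_by_Basis)
  have basis: "openin (patch (Sk X)) B" if B: "B \<in> Sk_basis X" for B
  proof -
    obtain U U' V V' where B: "B = U \<inter> U' - (V \<union> V')" "openin (bs_pos X) U" "openin (bs_neg X) U'"
      "openin (bs_pos X) V" "openin (bs_neg X) V'"
      using B unfolding Sk_basis_def by blast
    have "B = U \<inter> U' \<inter> (topspace (bs_pos X) - V) \<inter> (topspace (bs_neg X) - V')"
      using openin_subset[OF B(2)] unfolding B(1) t by blast
    also have "openin (patch (Sk X)) \<dots>"
      by (intro openin_Int gen) (use B(2-5) in \<open>simp_all add: closedin_diff\<close>)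
    finally show ?thesis .
  qed
  \<comment> \<open>The inner layer: opens of either Skula topology are refined by
    \<open>Sk_basis X\<close>. They are the generators of the outer layer.\<close>
  have S: "\<exists>B \<in> Sk_basis X. x \<in> B \<and> B \<subseteq> S"
    if "openin (bs_pos (Sk X)) S \<or> openin (bs_neg (Sk X)) S" "x \<in> S" for S x
  proof -
    from that(1) consider "openin (topology_generated_by ?S) S" | "openin (topology_generated_by ?T) S"
      unfolding Sk_def by auto
    then show ?thesis
    proof cases
      case 1
      show ?thesis
        by (rule openin_topology_generated_by_refine[OF 1 that(2) _ Sk_basis_Int]) (use sub in blast)
    next
      case 2
      show ?thesis
        by (rule openin_topology_generated_by_refine[OF 2 that(2) _ Sk_basis_Int]) (use sub in blast)
    qed
  qed
  show ?thesis
  proof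
    assume "openin (patch (Sk X)) W"
    note W = this[unfolded patch_def]
    show "\<forall>x \<in> W. \<exists>B \<in> Sk_basis X. x \<in> B \<and> B \<subseteq> W"
    proof
      fix x assume "x \<in> W"
      from W this show "\<exists>B \<in> Sk_basis X. x \<in> B \<and> B \<subseteq> W"
        by (rule openin_topology_generated_by_refine[OF _ _ _ Sk_basis_Int]) (rule S, simp_all)
    qed
  next
    assume "\<forall>x \<in> W. \<exists>B \<in> Sk_basis X. x \<in> B \<and> B \<subseteq> W"
    then show "openin (patch (Sk X)) W" using basis openin_subopen[of "patch (Sk X)" W] by blast
  qed
qed

text \<open>Members of \<open>Sk_basis X\<close> are contained in the space, so for them lying in
  the complement of \<open>S\<close> means missing \<open>S\<close>.\<close>

lemma closedin_patch_Sk_iff: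
  assumes "is_bispace X" "S \<subseteq> bs_points X"
  shows "closedin (patch (Sk X)) S \<longleftrightarrow>
    (\<forall>x \<in> bs_points X. (\<forall>B \<in> Sk_basis X. x \<in> B \<longrightarrow> B \<inter> S \<noteq> {}) \<longrightarrow> x \<in> S)"
proof -
  have t: "topspace (patch (Sk X)) = bs_points X"
    by (simp add: topspace_patch topspace_Sk[OF assms(1)])
  have B: "B \<subseteq> bs_points X" if "B \<in> Sk_basis X" for B
    using that unfolding Sk_basis_def bs_points_def by (auto dest: openin_subset)
  have "(\<exists>B \<in> Sk_basis X. x \<in> B \<and> B \<subseteq> bs_points X - S) \<longleftrightarrow>
      (\<exists>B \<in> Sk_basis X. x \<in> B \<and> B \<inter> S = {})" for x
    by (rule bex_cong[OF refl]) (use B in blast)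
  then show ?thesis
    unfolding closedin_def t openin_patch_Sk_iff[OF assms(1)] using assms(2) by auto
qed


section \<open>Bisubspaces of the bispace of points\<close>

lemma openin_subtopology_trace:
  assumes "\<And>V. openin T V \<longleftrightarrow> (\<exists>a \<in> C. V = {f \<in> F. s f a})" "S \<subseteq> F"
  shows "openin (subtopology T S) U \<longleftrightarrow> (\<exists>a \<in> C. U = {f \<in> S. s f a})"
proof -
  have e: "{f \<in> F. s f a} \<inter> S = {f \<in> S. s f a}" for a using assms(2) by auto
  have "openin (subtopology T S) U \<longleftrightarrow> (\<exists>a \<in> C. U = {f \<in> F. s f a} \<inter> S)"
    unfolding openin_subtopology assms(1) by blast
  then show ?thesis unfolding e .
qed

lemma openin_bisubspace:
  assumes "is_biframe \<L>" "S \<subseteq> bpoints \<L>"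
  shows "openin (bs_pos (bisubspace (bpt \<L>) S)) U \<longleftrightarrow>
      (\<exists>a \<in> carrier (bf_pos \<L>). U = {f \<in> S. fst f a})"
    "openin (bs_neg (bisubspace (bpt \<L>) S)) U \<longleftrightarrow>
      (\<exists>a \<in> carrier (bf_neg \<L>). U = {f \<in> S. snd f a})"
  unfolding bisubspace_def bispace.simps
  by (rule openin_subtopology_trace[OF openin_bpt_pos[OF assms(1)] assms(2)],
      rule openin_subtopology_trace[OF openin_bpt_neg[OF assms(1)] assms(2)])

section \<open>Traces of the components on a set of bipoints\<close>

text \<open>Each \<open>s f\<close> preserves joins, finite meets and the top, and unions and
  intersections of traces are computed point by point in \<open>f\<close>. The resulting map is onto
  the opens of \<open>T\<close>, so points can be moved along it.\<close>

lemma trace_frame_hom: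
  assumes "frame P" "\<And>f. f \<in> S \<Longrightarrow> s f \<in> frame_hom P two"
    "\<And>U. openin T U \<longleftrightarrow> (\<exists>a \<in> carrier P. U = {f \<in> S. s f a})" "topspace T = S"
  shows "(\<lambda>a. {f \<in> S. s f a}) \<in> frame_hom P (opens_frame T)"
proof -
  interpret P: frame P by fact
  have op: "openin T {f \<in> S. s f a}" if "a \<in> carrier P" for a using that assms(3) by blast
  note s = assms(2)[unfolded frame_hom_two_iff]
  have "{f \<in> S. s f (\<Squnion>\<^bsub>P\<^esub>A)} = \<Squnion>\<^bsub>opens_frame T\<^esub>((\<lambda>a. {f \<in> S. s f a}) ` A)"
    if "A \<subseteq> carrier P" for A
  proof -
    have "\<Squnion>\<^bsub>opens_frame T\<^esub>((\<lambda>a. {f \<in> S. s f a}) ` A) = \<Union>((\<lambda>a. {f \<in> S. s f a}) ` A)"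
      by (rule opens_Sup(2)) (use op that in auto)
    moreover have "s f (\<Squnion>\<^bsub>P\<^esub>A) \<longleftrightarrow> (\<exists>a \<in> A. s f a)" if "f \<in> S" for f
      using s[OF that] \<open>A \<subseteq> carrier P\<close> by blast
    ultimately show ?thesis by auto
  qed
  moreover have "{f \<in> S. s f \<top>\<^bsub>P\<^esub>} = \<top>\<^bsub>opens_frame T\<^esub>" unfolding opens_top assms(4) using s by blast
  moreover have "{f \<in> S. s f (a \<sqinter>\<^bsub>P\<^esub> b)} =
      {f \<in> S. s f a} \<sqinter>\<^bsub>opens_frame T\<^esub> {f \<in> S. s f b}"
    if "a \<in> carrier P" "b \<in> carrier P" for a b
    unfolding opens_meet[OF op[OF that(1)] op[OF that(2)]] using s that by blast
  ultimately show ?thesis unfolding frame_hom_def using op by simp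
qed

context
  fixes \<L> :: "('p, 'n, 'a) biframe" and S
  assumes bf: "is_biframe \<L>" and S: "S \<subseteq> bpoints \<L>"
begin

abbreviation (input) "Y \<equiv> bisubspace (bpt \<L>) S"

lemma topspace_bisubspace: "topspace (bs_pos Y) = S" "topspace (bs_neg Y) = S" "bs_points Y = S"
  using S by (auto simp: bisubspace_def bs_points_def topspace_bpt[OF bf])

lemma trace_pos:
  "(\<lambda>a. {f \<in> S. fst f a}) \<in> frame_hom (bf_pos \<L>) (opens_frame (bs_pos Y))"
  by (rule trace_frame_hom[where s = fst, OF is_biframeD(1)[OF bf] _ openin_bisubspace(1)[OF bf S]
        topspace_bisubspace(1)])
    (use bpoints_hom(1) S in blast)

lemma trace_neg:
  "(\<lambda>b. {f \<in> S. snd f b}) \<in> frame_hom (bf_neg \<L>) (opens_frame (bs_neg Y))"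
  by (rule trace_frame_hom[where s = snd, OF is_biframeD(2)[OF bf] _ openin_bisubspace(2)[OF bf S]
        topspace_bisubspace(2)])
    (use bpoints_hom(2) S in blast)

lemma trace_pos_surj:
  "(\<lambda>a. {f \<in> S. fst f a}) ` carrier (bf_pos \<L>) = carrier (opens_frame (bs_pos Y))"
  unfolding carrier_opens openin_bisubspace(1)[OF bf S] by blast

lemma trace_neg_surj:
  "(\<lambda>b. {f \<in> S. snd f b}) ` carrier (bf_neg \<L>) = carrier (opens_frame (bs_neg Y))"
  unfolding carrier_opens openin_bisubspace(2)[OF bf S] by blast

lemma openin_trace:
  "a \<in> carrier (bf_pos \<L>) \<Longrightarrow> openin (bs_pos Y) {f \<in> S. fst f a}"
  "b \<in> carrier (bf_neg \<L>) \<Longrightarrow> openin (bs_neg Y) {f \<in> S. snd f b}"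
  unfolding openin_bisubspace[OF bf S] by blast+

lemma nbhd_point_bisubspace:
  "a \<in> carrier (bf_pos \<L>) \<Longrightarrow> x \<in> S \<Longrightarrow> fst (nbhd_point Y x) {f \<in> S. fst f a} \<longleftrightarrow> fst x a"
  "b \<in> carrier (bf_neg \<L>) \<Longrightarrow> x \<in> S \<Longrightarrow> snd (nbhd_point Y x) {f \<in> S. snd f b} \<longleftrightarrow> snd x b"
  by (simp_all add: nbhd_point_def openin_trace)

text \<open>A bipoint is determined by its values, and these can be read off from which traces
  contain it. Hence only surjectivity is at stake in bisobriety of a bisubspace.\<close>

lemma inj_on_nbhd_point: "inj_on (nbhd_point Y) S"
proof (rule inj_onI)
  fix x y assume xy: "x \<in> S" "y \<in> S" "nbhd_point Y x = nbhd_point Y y"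
  show "x = y"
  proof (rule bpoint_eqI)
    show "x \<in> bpoints \<L>" "y \<in> bpoints \<L>" using xy S by auto
    show "fst x a = fst y a" if "a \<in> carrier (bf_pos \<L>)" for a
      using nbhd_point_bisubspace(1)[OF that xy(1)] nbhd_point_bisubspace(1)[OF that xy(2)] xy(3)
      by simp
    show "snd x b = snd y b" if "b \<in> carrier (bf_neg \<L>)" for b
      using nbhd_point_bisubspace(2)[OF that xy(1)] nbhd_point_bisubspace(2)[OF that xy(2)] xy(3)
      by simp
  qed
qed

section \<open>Bisober bisubspaces are Skula patch-closed\<close>

lemma bisober_imp_closed:
  assumes sober: "\<And>f. f \<in> bpoints (bOmega_fin Y) \<Longrightarrow> \<exists>x \<in> S. nbhd_point Y x = f"
    and x: "x \<in> bpoints \<L>" "\<And>B. \<lbrakk>B \<in> Sk_basis (bpt \<L>); x \<in> B\<rbrakk> \<Longrightarrow> B \<inter> S \<noteq> {}"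
  shows "x \<in> S"
proof -
  interpret P: frame "bf_pos \<L>" by (rule is_biframeD(1)[OF bf])
  interpret N: frame "bf_neg \<L>" by (rule is_biframeD(2)[OF bf])
  note xh = bpoints_hom[OF x(1), unfolded frame_hom_two_iff]
  \<comment> \<open>Otherwise the basic Skula set cut out by \<open>u\<close>, \<open>u'\<close>,
    \<open>v\<close>, \<open>v'\<close> would contain \<open>x\<close> and miss
    \<open>S\<close>.\<close>
  have sep: "fst x v \<or> snd x v'"
    if c: "u \<in> carrier (bf_pos \<L>)" "u' \<in> carrier (bf_neg \<L>)" "v \<in> carrier (bf_pos \<L>)"
      "v' \<in> carrier (bf_neg \<L>)" "fst x u" "snd x u'"
      and inc: "{f \<in> S. fst f u} \<inter> {f \<in> S. snd f u'} \<subseteq> {f \<in> S. fst f v} \<union> {f \<in> S. snd f v'}"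
    for u u' v v'
  proof (rule ccontr)
    assume "\<not> (fst x v \<or> snd x v')"
    moreover have "{f \<in> bpoints \<L>. fst f u} \<inter> {f \<in> bpoints \<L>. snd f u'} -
        ({f \<in> bpoints \<L>. fst f v} \<union> {f \<in> bpoints \<L>. snd f v'}) \<in> Sk_basis (bpt \<L>)"
      by (rule Sk_basisI) (use c openin_bpt_pos[OF bf] openin_bpt_neg[OF bf] in blast)+
    ultimately show False using x(2) x(1) c(5,6) inc by blast
  qed
  \<comment> \<open>The negative side of \<open>sep\<close> is made trivial: \<open>x\<close>
    accepts the top and rejects the empty join.\<close>
  have pos: "fst x v" if "u \<in> carrier (bf_pos \<L>)" "v \<in> carrier (bf_pos \<L>)" "fst x u"
    "{f \<in> S. fst f u} \<subseteq> {f \<in> S. fst f v}" for u v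
    using sep[of u "\<top>\<^bsub>bf_neg \<L>\<^esub>" v "\<Squnion>\<^bsub>bf_neg \<L>\<^esub>{}"] that xh by auto
  have neg: "snd x v" if "u \<in> carrier (bf_neg \<L>)" "v \<in> carrier (bf_neg \<L>)" "snd x u"
    "{f \<in> S. snd f u} \<subseteq> {f \<in> S. snd f v}" for u v
    using sep[of "\<top>\<^bsub>bf_pos \<L>\<^esub>" u "\<Squnion>\<^bsub>bf_pos \<L>\<^esub>{}" v] that xh by auto
  \<comment> \<open>By \<open>pos\<close> in both directions, elements with equal traces on
    \<open>S\<close> have equal values at \<open>x\<close>, so the positive component of
    \<open>x\<close> factors through the trace map.\<close>
  obtain h where h: "h \<in> frame_hom (opens_frame (bs_pos Y)) two"
    "\<And>a. a \<in> carrier (bf_pos \<L>) \<Longrightarrow> h {f \<in> S. fst f a} = fst x a"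
  proof -
    have "\<exists>h \<in> frame_hom (opens_frame (bs_pos Y)) two.
        \<forall>a \<in> carrier (bf_pos \<L>). h {f \<in> S. fst f a} = fst x a"
    proof (rule frame_hom_factor[OF trace_pos trace_pos_surj bpoints_hom(1)[OF x(1)]
          is_biframeD(1)[OF bf]])
      fix u v
      assume "u \<in> carrier (bf_pos \<L>)" "v \<in> carrier (bf_pos \<L>)" "{f \<in> S. fst f u} = {f \<in> S. fst f v}"
      then show "fst x u = fst x v" using pos[of u v] pos[of v u] by auto
    qed
    then show thesis using that by blast
  qed
  obtain k where k: "k \<in> frame_hom (opens_frame (bs_neg Y)) two"
    "\<And>b. b \<in> carrier (bf_neg \<L>) \<Longrightarrow> k {f \<in> S. snd f b} = snd x b"
  proof -
    have "\<exists>h \<in> frame_hom (opens_frame (bs_neg Y)) two.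
        \<forall>a \<in> carrier (bf_neg \<L>). h {f \<in> S. snd f a} = snd x a"
    proof (rule frame_hom_factor[OF trace_neg trace_neg_surj bpoints_hom(2)[OF x(1)]
          is_biframeD(2)[OF bf]])
      fix u v
      assume "u \<in> carrier (bf_neg \<L>)" "v \<in> carrier (bf_neg \<L>)" "{f \<in> S. snd f u} = {f \<in> S. snd f v}"
      then show "snd x u = snd x v" using neg[of u v] neg[of v u] by auto
    qed
    then show thesis using that by blast
  qed
  define p where "p = restrict h {U. openin (bs_pos Y) U}"
  define q where "q = restrict k {U. openin (bs_neg Y) U}"
  have p: "p {f \<in> S. fst f a} = fst x a" if "a \<in> carrier (bf_pos \<L>)" for a
    using h(2)[OF that] openin_trace(1)[OF that] by (simp add: p_def)
  have q: "q {f \<in> S. snd f b} = snd x b" if "b \<in> carrier (bf_neg \<L>)" for b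
    using k(2)[OF that] openin_trace(2)[OF that] by (simp add: q_def)
  have "(p, q) \<in> bpoints (bOmega_fin Y)"
    unfolding bpoints_bOmega_fin_iff fst_conv snd_conv
  proof (intro conjI allI impI)
    show "p \<in> frame_hom (opens_frame (bs_pos Y)) two \<inter> extensional {U. openin (bs_pos Y) U}"
      using frame_hom_two_restrict[OF opens_frame h(1)] by (simp add: p_def)
    show "q \<in> frame_hom (opens_frame (bs_neg Y)) two \<inter> extensional {U. openin (bs_neg Y) U}"
      using frame_hom_two_restrict[OF opens_frame k(1)] by (simp add: q_def)
    fix U U' V V'
    assume o: "openin (bs_pos Y) U" "openin (bs_neg Y) U'" "openin (bs_pos Y) V"
      "openin (bs_neg Y) V'" "U \<inter> U' \<subseteq> V \<union> V'" "p U" "q U'"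
    obtain u u' v v' where uv: "u \<in> carrier (bf_pos \<L>)" "U = {f \<in> S. fst f u}"
      "u' \<in> carrier (bf_neg \<L>)" "U' = {f \<in> S. snd f u'}"
      "v \<in> carrier (bf_pos \<L>)" "V = {f \<in> S. fst f v}"
      "v' \<in> carrier (bf_neg \<L>)" "V' = {f \<in> S. snd f v'}"
      using o(1-4) unfolding openin_bisubspace[OF bf S] by blast
    show "p V \<or> q V'"
      using sep[OF uv(1,3,5,7)] o(5-7) p[OF uv(1)] p[OF uv(5)] q[OF uv(3)] q[OF uv(7)]
      unfolding uv(2,4,6,8) by simp
  qed
  then obtain y where y: "y \<in> S" "nbhd_point Y y = (p, q)" using sober by blast
  have "y = x"
  proof (rule bpoint_eqI)
    show "y \<in> bpoints \<L>" "x \<in> bpoints \<L>" using y S x by auto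
    show "fst y a = fst x a" if "a \<in> carrier (bf_pos \<L>)" for a
      using nbhd_point_bisubspace(1)[OF that y(1)] p[OF that] y(2) by simp
    show "snd y b = snd x b" if "b \<in> carrier (bf_neg \<L>)" for b
      using nbhd_point_bisubspace(2)[OF that y(1)] q[OF that] y(2) by simp
  qed
  then show ?thesis using y(1) by simp
qed

section \<open>Skula patch-closed bisubspaces are bisober\<close>

lemma closed_imp_bisober:
  assumes closed: "\<And>x. \<lbrakk>x \<in> bpoints \<L>; \<And>B. \<lbrakk>B \<in> Sk_basis (bpt \<L>); x \<in> B\<rbrakk> \<Longrightarrow> B \<inter> S \<noteq> {}\<rbrakk> \<Longrightarrow> x \<in> S"
    and f: "f \<in> bpoints (bOmega_fin Y)"
  shows "\<exists>x \<in> S. nbhd_point Y x = f"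
proof -
  interpret P: frame "bf_pos \<L>" by (rule is_biframeD(1)[OF bf])
  interpret N: frame "bf_neg \<L>" by (rule is_biframeD(2)[OF bf])
  obtain p q where pq: "f = (p, q)" by (cases f)
  note ff = f[unfolded bpoints_bOmega_fin_iff pq fst_conv snd_conv]
  have fh: "p \<in> frame_hom (opens_frame (bs_pos Y)) two" "q \<in> frame_hom (opens_frame (bs_neg Y)) two"
    and fe: "p \<in> extensional {U. openin (bs_pos Y) U}" "q \<in> extensional {U. openin (bs_neg Y) U}"
    using ff by blast+
  define p' where "p' = restrict (\<lambda>a. p {f \<in> S. fst f a}) (carrier (bf_pos \<L>))"
  define q' where "q' = restrict (\<lambda>b. q {f \<in> S. snd f b}) (carrier (bf_neg \<L>))"
  have hom: "p' \<in> frame_hom (bf_pos \<L>) two" "q' \<in> frame_hom (bf_neg \<L>) two"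
    unfolding p'_def q'_def
    by (rule frame_hom_two_restrict[OF is_biframeD(1)[OF bf] frame_hom_comp[OF trace_pos fh(1)]])
      (rule frame_hom_two_restrict[OF is_biframeD(2)[OF bf] frame_hom_comp[OF trace_neg fh(2)]])
  \<comment> \<open>The inclusion is tested at members of \<open>S\<close> only. It is the inclusion
    of traces to which the condition on bipoints of \<open>bOmega_fin\<close> applies.\<close>
  have sep: "p' v \<or> q' v'"
    if c: "u \<in> carrier (bf_pos \<L>)" "u' \<in> carrier (bf_neg \<L>)" "v \<in> carrier (bf_pos \<L>)"
      "v' \<in> carrier (bf_neg \<L>)" "p' u" "q' u'"
      and inc: "\<And>s. \<lbrakk>s \<in> S; fst s u; snd s u'\<rbrakk> \<Longrightarrow> fst s v \<or> snd s v'" for u u' v v'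
  proof -
    have o: "openin (bs_pos Y) {f \<in> S. fst f u}" "openin (bs_neg Y) {f \<in> S. snd f u'}"
      "openin (bs_pos Y) {f \<in> S. fst f v}" "openin (bs_neg Y) {f \<in> S. snd f v'}"
      using c(1-4) by (simp_all add: openin_trace)
    have "{f \<in> S. fst f u} \<inter> {f \<in> S. snd f u'} \<subseteq> {f \<in> S. fst f v} \<union> {f \<in> S. snd f v'}"
      using inc by blast
    then have "p {f \<in> S. fst f v} \<or> q {f \<in> S. snd f v'}"
      using ff o c(5,6) c(1,2) unfolding p'_def q'_def restrict_apply' by simp
    then show ?thesis unfolding p'_def q'_def using c by simp
  qed
  have x: "(p', q') \<in> bpoints \<L>"
  proof (rule bpointsI[OF bf hom])
    show "p' \<in> extensional (carrier (bf_pos \<L>))" "q' \<in> extensional (carrier (bf_neg \<L>))"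
      by (simp_all add: p'_def q'_def)
    fix I J a b assume IJ: "(I, J) \<in> canonical_kernel \<L>" "(a, b) \<in> I" "p' a" "q' b"
    have "coprod_ideal (bf_pos \<L>) (bf_neg \<L>) I" "coprod_ideal (bf_pos \<L>) (bf_neg \<L>) J"
      using IJ(1) unfolding canonical_kernel_def frame_coprod_def by simp_all
    note c = coprod_idealD(1)[OF this(1)] coprod_idealD(1)[OF this(2)]
    show "\<exists>(u, v) \<in> J. p' u \<and> q' v"
    proof (rule ccontr)
      assume no: "\<not> (\<exists>(u, v) \<in> J. p' u \<and> q' v)"
      txt \<open>However the rectangles of \<open>J\<close> are distributed over two parts, the trace of \<open>J\<close> on \<open>S\<close> is
        covered by the positive sides of the first and the negative sides of the second part.\<close>
      define G where "G = {u. \<exists>v. (u, v) \<in> J \<and> \<not> p' u}"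
      define H where "H = {v. \<exists>u. (u, v) \<in> J \<and> p' u}"
      have GH: "G \<subseteq> carrier (bf_pos \<L>)" "H \<subseteq> carrier (bf_neg \<L>)" using c(2) by (auto simp: G_def H_def)
      have "p' (\<Squnion>\<^bsub>bf_pos \<L>\<^esub>G) \<or> q' (\<Squnion>\<^bsub>bf_neg \<L>\<^esub>H)"
      proof (rule sep[OF _ _ P.Sup_closed[OF GH(1)] N.Sup_closed[OF GH(2)] IJ(3,4)])
        show "a \<in> carrier (bf_pos \<L>)" "b \<in> carrier (bf_neg \<L>)" using c(1) IJ(2) by auto
        fix s assume s: "s \<in> S" "fst s a" "snd s b"
        have sb: "s \<in> bpoints \<L>" using s(1) S by blast
        \<comment> \<open>\<open>s\<close> is a bipoint of the biframe, so it cannot distinguish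
          \<open>I\<close> from \<open>J\<close>: accepting \<open>(a, b)\<close> in
          \<open>I\<close> forces it to accept some rectangle of \<open>J\<close>.\<close>
        obtain u v where uv: "(u, v) \<in> J" "fst s u" "snd s v"
          using bpoints_kernel[OF bf sb IJ(1)] IJ(2) s by blast
        then have "u \<in> G \<or> v \<in> H" unfolding G_def H_def by blast
        then show "fst s (\<Squnion>\<^bsub>bf_pos \<L>\<^esub>G) \<or> snd s (\<Squnion>\<^bsub>bf_neg \<L>\<^esub>H)"
          using frame_hom_two_Sup[OF bpoints_hom(1)[OF sb] GH(1)]
            frame_hom_two_Sup[OF bpoints_hom(2)[OF sb] GH(2)] uv(2,3) by blast
      qed
      \<comment> \<open>Both joins are rejected because \<open>p'\<close> and \<open>q'\<close>
        preserve joins: \<open>p'\<close> fails throughout \<open>G\<close> by definition, and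
        \<open>q'\<close> fails throughout \<open>H\<close> because by \<open>no\<close> a rectangle
        of \<open>J\<close> with \<open>p' u\<close> has \<open>q' v\<close> false. This contradicts
        \<open>sep\<close>.\<close>
      moreover have "\<not> p' (\<Squnion>\<^bsub>bf_pos \<L>\<^esub>G)" using frame_hom_two_Sup[OF hom(1) GH(1)] unfolding G_def by blast
      moreover have "\<not> q' (\<Squnion>\<^bsub>bf_neg \<L>\<^esub>H)" using frame_hom_two_Sup[OF hom(2) GH(2)] no unfolding H_def by blast
      ultimately show False by blast
    qed
  qed
  have xS: "(p', q') \<in> S"
  proof (rule closed[OF x])
    fix B assume Bx: "B \<in> Sk_basis (bpt \<L>)" "(p', q') \<in> B"
    obtain u u' v v' where B: "B = {f \<in> bpoints \<L>. fst f u} \<inter> {f \<in> bpoints \<L>. snd f u'} -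
        ({f \<in> bpoints \<L>. fst f v} \<union> {f \<in> bpoints \<L>. snd f v'})"
      "u \<in> carrier (bf_pos \<L>)" "u' \<in> carrier (bf_neg \<L>)" "v \<in> carrier (bf_pos \<L>)"
      "v' \<in> carrier (bf_neg \<L>)" "p' u" "q' u'" "\<not> p' v" "\<not> q' v'"
    proof -
      obtain U U' V V' where W: "B = U \<inter> U' - (V \<union> V')" "openin (bs_pos (bpt \<L>)) U"
        "openin (bs_neg (bpt \<L>)) U'" "openin (bs_pos (bpt \<L>)) V" "openin (bs_neg (bpt \<L>)) V'"
        using Bx(1) unfolding Sk_basis_def by blast
      obtain u where u: "u \<in> carrier (bf_pos \<L>)" "U = {f \<in> bpoints \<L>. fst f u}"
        using W(2) unfolding openin_bpt_pos[OF bf] by blast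
      obtain u' where u': "u' \<in> carrier (bf_neg \<L>)" "U' = {f \<in> bpoints \<L>. snd f u'}"
        using W(3) unfolding openin_bpt_neg[OF bf] by blast
      obtain v where v: "v \<in> carrier (bf_pos \<L>)" "V = {f \<in> bpoints \<L>. fst f v}"
        using W(4) unfolding openin_bpt_pos[OF bf] by blast
      obtain v' where v': "v' \<in> carrier (bf_neg \<L>)" "V' = {f \<in> bpoints \<L>. snd f v'}"
        using W(5) unfolding openin_bpt_neg[OF bf] by blast
      show thesis
        by (rule that[of u u' v v'])
          (use W(1) Bx(2) x u v u' v' in simp_all)
    qed
    \<comment> \<open>If \<open>S\<close> had no such member, the inclusion in \<open>sep\<close>
      would hold on \<open>S\<close> and force \<open>p' v\<close> or \<open>q' v'\<close>.\<close>
    obtain s where "s \<in> S" "fst s u" "snd s u'" "\<not> fst s v" "\<not> snd s v'"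
      using sep[OF B(2-7)] B(8,9) by blast
    then have "s \<in> B \<inter> S" unfolding B(1) using S by blast
    then show "B \<inter> S \<noteq> {}" by blast
  qed
  \<comment> \<open>Every positive open of the bisubspace is the trace of some \<open>a\<close>, and
    there both sides evaluate to \<open>p' a\<close>.\<close>
  have "restrict (\<lambda>U. (p', q') \<in> U) {U. openin (bs_pos Y) U} = p"
  proof (rule extensionalityI[OF restrict_extensional fe(1)])
    fix U assume U: "U \<in> {U. openin (bs_pos Y) U}"
    then obtain a where "a \<in> carrier (bf_pos \<L>)" "U = {f \<in> S. fst f a}"
      unfolding openin_bisubspace[OF bf S] by blast
    then show "restrict (\<lambda>U. (p', q') \<in> U) {U. openin (bs_pos Y) U} U = p U"
      using xS U by (simp add: p'_def)
  qed
  moreover have "restrict (\<lambda>U. (p', q') \<in> U) {U. openin (bs_neg Y) U} = q"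
  proof (rule extensionalityI[OF restrict_extensional fe(2)])
    fix U assume U: "U \<in> {U. openin (bs_neg Y) U}"
    then obtain a where "a \<in> carrier (bf_neg \<L>)" "U = {f \<in> S. snd f a}"
      unfolding openin_bisubspace[OF bf S] by blast
    then show "restrict (\<lambda>U. (p', q') \<in> U) {U. openin (bs_neg Y) U} U = q U"
      using xS U by (simp add: q'_def)
  qed
  ultimately show ?thesis using xS unfolding nbhd_point_def pq by blast
qed

end

theorem theorem4p11:
  fixes \<L> :: "('p, 'n, 'a) biframe"
  assumes "finitary_biframe \<L>"
  shows "\<forall>S. S \<subseteq> bs_points (bpt \<L>) \<longrightarrow>
           (bisober (bisubspace (bpt \<L>) S) \<longleftrightarrow> closedin (patch (Sk (bpt \<L>))) S)"
proof (intro allI impI)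
  have bf: "is_biframe \<L>" using assms by (simp add: finitary_biframe_def)
  have pts: "bs_points (bpt \<L>) = bpoints \<L>" by (simp add: bs_points_def topspace_bpt[OF bf])
  fix S assume "S \<subseteq> bs_points (bpt \<L>)"
  then have S: "S \<subseteq> bpoints \<L>" by (simp add: pts)
  note sober = bisober_iff[OF is_bispace_bisubspace[OF is_bispace_bpt[OF bf], of S],
      unfolded topspace_bisubspace(3)[OF bf S]]
  note closed = closedin_patch_Sk_iff[OF is_bispace_bpt[OF bf], of S, unfolded pts, OF S]
  show "bisober (bisubspace (bpt \<L>) S) \<longleftrightarrow> closedin (patch (Sk (bpt \<L>))) S"
  proof
    assume "bisober (bisubspace (bpt \<L>) S)"
    then have "\<exists>x \<in> S. nbhd_point (bisubspace (bpt \<L>) S) x = f"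
      if "f \<in> bpoints (bOmega_fin (bisubspace (bpt \<L>) S))" for f
      using that unfolding sober by blast
    note x = bisober_imp_closed[OF bf S this]
    show "closedin (patch (Sk (bpt \<L>))) S"
      unfolding closed by (intro ballI impI) (rule x, simp_all)
  next
    assume "closedin (patch (Sk (bpt \<L>))) S"
    then have "x \<in> S" if "x \<in> bpoints \<L>" "\<And>B. \<lbrakk>B \<in> Sk_basis (bpt \<L>); x \<in> B\<rbrakk> \<Longrightarrow> B \<inter> S \<noteq> {}" for x
      using that unfolding closed by simp
    note f = closed_imp_bisober[OF bf S this]
    \<comment> \<open>Injectivity holds for every set of bipoints, so closedness is needed only to
      realise each bipoint as a member of \<open>S\<close>.\<close>
    show "bisober (bisubspace (bpt \<L>) S)"
      unfolding sober by (intro conjI ballI inj_on_nbhd_point[OF bf S]) (rule f)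
  qed
qed

end
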